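(* Let $k$, $\chi$, $U(\chi)$, $\tau$, $\mathbf c\in k^n$, $B_i\in U(\chi)$, $\mathrm{Heis}(\chi)^\vee$, $B_i^\vee\in\mathrm{Heis}(\chi)^\vee$ be as in the context. Let $p(x_1,\dots,x_n)$ be a homogeneous noncommutative polynomial of degree $\lambda\in\mathbb N^n$. Then $$\pi_{0,0}\circ P_{-\lambda}\big(p(B_1,\dots,B_n)\big)=\pi_{0,0}^\vee\big(p(B_1^\vee,\dots,B_n^\vee)\big).$$ Furthermore, if $\lambda$ does not lie in the submonoid of $\mathbb N^n$ generated by the elements $\alpha_i+\alpha_{\tau(i)}$, $i\in I$, then $P_{-\lambda}\circ\pi_{0,0}\big(p(B_1,\dots,B_n)\big)=0$ in $U(\chi)^{\mathrm{poly}}$.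
   Context: Let $k$ be a field, $\mathbb N=\{0,1,2,\dots\}$, $I=\{1,\dots,n\}$, $\{\alpha_i\}_{i\in I}$ the standard basis of $\mathbb Z^n$. Let $\chi:\mathbb Z^n\times\mathbb Z^n\to k^\times$ be a bicharacter with $q_{ij}:=\chi(\alpha_i,\alpha_j)=q_{ji}$ for all $i,j$. $H=k[K_i^{\pm1}\mid i\in I]$ is the group algebra of $\mathbb Z^n$ and $K_\lambda=K_1^{\lambda_1}\cdots K_n^{\lambda_n}$. $\widetilde U(\chi)$ is the Hopf algebra with generators $E_i,F_i,K_i^{\pm1}$, relations $K_iK_i^{-1}=1=K_i^{-1}K_i$, $K_iK_j=K_jK_i$, $K_iE_j=q_{ij}E_jK_i$, $K_iF_j=q_{ij}^{-1}F_jK_i$, $E_iF_j-F_jE_i=\delta_{ij}(K_i-K_i^{-1})$ and coproduct $\Delta(E_i)=E_i\otimes1+K_i\otimes E_i$, $\Delta(F_i)=F_i\otimes K_i^{-1}+1\otimes F_i$, $\Delta(K_i)=K_i\otimes K_i$. The subalgebras generated by the $E_i$, resp. the $F_i$, are the tensor algebras $T(V^+(\chi))$, $T(V^-(\chi))$ on $V^+(\chi)=\mathrm{span}\{E_i\}$, $V^-(\chi)=\mathrm{span}\{F_i\}$. $V^+(\chi)$ is a Yetter–Drinfeld module over $H$ with $K_i\cdot E_j=q_{ij}E_j$, $\delta(E_i)=K_i\otimes E_i$, so $T(V^+(\chi))$ is a $\mathbb Z^n$-graded braided Hopf algebra ($\deg E_i=\alpha_i$). $\omega$ is the algebra automorphism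 of $\widetilde U(\chi)$ with $\omega(E_i)=F_i$, $\omega(F_i)=E_i$, $\omega(K_i)=K_i^{-1}$. Fix a $\mathbb Z^n$-graded biideal $\mathcal I\subseteq\bigoplus_{m\ge2}T(V^+(\chi))_m$. Put $U(\chi)=\widetilde U(\chi)/(\mathcal I,\omega(\mathcal I))$, $U^+=T(V^+(\chi))/\mathcal I$ (a pre-Nichols algebra of diagonal type), $U^-=T(V^-(\chi))/\omega(\mathcal I)$. Multiplication $U^+\otimes H\otimes U^-\to U(\chi)$ is a linear isomorphism; $U^\pm$ are graded with $\deg E_i=\alpha_i$, $\deg F_i=-\alpha_i$. Let $\tau:I\to I$ be a bijection with $\tau^2=\mathrm{id}$, $q_{\tau(i)\tau(j)}=q_{ij}$, and assume $\tau(\mathcal I)=\mathcal I$ for the automorphism $E_i\mapsto E_{\tau(i)}$; extend $\tau$ to $\mathbb Z^n$ by $\tau(\alpha_i)=\alpha_{\tau(i)}$ and put $\mathbb Z^n_\theta=\{\lambda\in\mathbb Z^n\mid\tau(\lambda)=-\lambda\}$. For $\mathbf c=(c_1,\dots,c_n)\in k^n$ put $B_i=F_i+c_iE_{\tau(i)}K_i^{-1}\in U(\chi)$. Projections: let $G^-\subset U(\chi)$ be the subalgebra generated by the $F_iK_i$; $U(\chi)=\bigoplus_{\lambda\in\mathbb Z^n}U^+K_\lambda G^-$ and $P_\lambda:U(\chi)\to U^+K_\lambda G^-$ is the corresponding projection. Also $U(\chi)=\bigoplus_{\alpha,\beta\in\mathbb N^n}U^+_\alpha HU^-_{-\beta}$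 and $\pi_{0,0}:U(\chi)\to H$ is the projection onto the summand $\alpha=\beta=0$. Negative Heisenberg double: $\widetilde E_i=E_iK_i^{-1}$, $G^+$ is the subalgebra of $U(\chi)$ generated by the $\widetilde E_i$, and $U(\chi)^{\mathrm{poly}}$ is the subalgebra of $U(\chi)$ generated by $F_i,\widetilde E_i,K_i^{-1},K_iK_{\tau(i)}^{-1}$, $i\in I$. It is $\mathbb N$-filtered by the degree function $\deg(\widetilde E_i)=\deg(F_i)=\deg(K_i^{-1})=1$, $\deg(K_iK_{\tau(i)}^{-1})=0$ on generators, and $\mathrm{Heis}(\chi)^\vee$ is the associated graded algebra. Keep the same letters for the classes of $\widetilde E_i,F_i$ and $K_\lambda$ ($\lambda\in-\mathbb N^n+\mathbb Z^n_\theta$) in $\mathrm{Heis}(\chi)^\vee$. Then $G^+$, $k[K_\lambda\mid\lambda\in-\mathbb N^n+\mathbb Z^n_\theta]$, $U^-$ are subalgebras of $\mathrm{Heis}(\chi)^\vee$ and multiplication from their tensor product (in this order) to $\mathrm{Heis}(\chi)^\vee$ is a linear isomorphism. With $G^+_+,U^-_+$ the augmentation ideals, $\pi^\vee_{0,0}:\mathrm{Heis}(\chi)^\vee\to k[K_\lambda\mid\lambda\in-\mathbb N^n+\mathbb Z^n_\theta]$ is the projection with kernel $G^+_+\mathrm{Heis}(\chi)^\vee+\mathrm{Heis}(\chi)^\vee U^-_+$. Put $B_i^\vee=F_i+c_i\widetilde E_{\tau(i)}(K_{\tau(i)}K_i^{-1})\in\mathrm{Heis}(\chi)^\vee$. Both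 sides of the first claimed identity are compared via the identification of $K_\mu$ in $U(\chi)$ with $K_\mu$ in $\mathrm{Heis}(\chi)^\vee$. Noncommutative polynomials are elements of $k\langle x_1,\dots,x_n\rangle$, homogeneous with respect to $\deg x_i=\alpha_i$. *)

theory Defs
  imports
    "HOL-Algebra.QuotRing"
    "HOL-Algebra.Generated_Rings"
    "HOL-Algebra.Generated_Groups"
    "HOL-Analysis.Finite_Cartesian_Product"
    "HOL-Library.Poly_Mapping"
begin

section \<open>Algebras over a field\<close>

text \<open>A \<open>k\<close>-algebra is a ring record together with its structure map from \<open>k\<close> to the centre.\<close>

record ('a, 'k) kalgebra = "'a ring" +
  scal :: "'k \<Rightarrow> 'a"

definition lin_span :: "('a, 'k) kalgebra \<Rightarrow> 'a set \<Rightarrow> 'a set" where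
  "lin_span A S = generate (add_monoid A) (range (scal A) <#>\<^bsub>A\<^esub> S)"

definition gen_subalgebra :: "('a, 'k) kalgebra \<Rightarrow> 'a set \<Rightarrow> 'a set" where
  "gen_subalgebra A S = generate_ring A (range (scal A) \<union> S)"

definition alg_quot :: "('a, 'k) kalgebra \<Rightarrow> 'a set \<Rightarrow> ('a set, 'k) kalgebra" where
  "alg_quot A J = ring.extend (A Quot J) (kalgebra.fields (\<lambda>c. J +>\<^bsub>A\<^esub> scal A c))"

definition lin_comb ::
  "('a, 'k) kalgebra \<Rightarrow> ('x \<Rightarrow> 'a) \<Rightarrow> ('x \<Rightarrow>\<^sub>0 'k::zero) \<Rightarrow> 'a" where
  "lin_comb A v a = (\<Oplus>\<^bsub>A\<^esub>x\<in>Poly_Mapping.keys a. scal A (Poly_Mapping.lookup a x) \<otimes>\<^bsub>A\<^esub> v x)"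

definition list_prod :: "('a, 'k) kalgebra \<Rightarrow> 'a list \<Rightarrow> 'a" where
  "list_prod A xs = foldr (mult A) xs \<one>\<^bsub>A\<^esub>"

text \<open>Projection onto the subspace \<open>V\<close> along the complementary subspace \<open>W\<close>, and projection onto the
  \<open>j\<close>-th summand of a direct sum of the subspaces \<open>V i\<close>, \<open>i \<in> N\<close>.\<close>

definition proj_along :: "('a, 'k) kalgebra \<Rightarrow> 'a set \<Rightarrow> 'a set \<Rightarrow> 'a \<Rightarrow> 'a" where
  "proj_along A V W x = (THE y. y \<in> V \<and> x \<ominus>\<^bsub>A\<^esub> y \<in> W)"

definition summand_proj ::
  "('a, 'k) kalgebra \<Rightarrow> 'j set \<Rightarrow> ('j \<Rightarrow> 'a set) \<Rightarrow> 'j \<Rightarrow> 'a \<Rightarrow> 'a" where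
  "summand_proj A N V j = proj_along A (V j) (lin_span A (\<Union>i\<in>N - {j}. V i))"


section \<open>Filtrations and associated graded algebras\<close>

text \<open>The step \<open>m\<close> of the filtration defined by a degree function \<open>d\<close> on generators \<open>v\<close>.\<close>

definition gen_filtration ::
  "('a, 'k) kalgebra \<Rightarrow> ('g \<Rightarrow> 'a) \<Rightarrow> ('g \<Rightarrow> nat) \<Rightarrow> nat \<Rightarrow> 'a set" where
  "gen_filtration A v d m =
     lin_span A {list_prod A (map v gs) | gs. sum_list (map d gs) \<le> m}"

definition prev_step :: "('a, 'k) kalgebra \<Rightarrow> (nat \<Rightarrow> 'a set) \<Rightarrow> nat \<Rightarrow> 'a set" where
  "prev_step A F m = (if m = 0 then {\<zero>\<^bsub>A\<^esub>} else F (m - 1))"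

text \<open>The class of \<open>x \<in> F m\<close> in the homogeneous component \<open>F m / F (m - 1)\<close>.\<close>

definition gr_class ::
  "('a, 'k) kalgebra \<Rightarrow> (nat \<Rightarrow> 'a set) \<Rightarrow> nat \<Rightarrow> 'a \<Rightarrow> nat \<Rightarrow> 'a set" where
  "gr_class A F m x = (\<lambda>l. if l = m then prev_step A F m +>\<^bsub>A\<^esub> x else prev_step A F l)"

text \<open>The direct sum of the quotients \<open>F m / F (m - 1)\<close>: families of cosets, almost all of them zero
  (the zero coset being \<open>F (m - 1)\<close> itself).  As for \<open>rcoset_mult\<close>, the product of cosets is
  the union over all representatives.\<close>

definition assoc_graded ::
  "('a, 'k) kalgebra \<Rightarrow> (nat \<Rightarrow> 'a set) \<Rightarrow> (nat \<Rightarrow> 'a set, 'k) kalgebra" where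
  "assoc_graded A F =
    \<lparr> carrier = {f. (\<forall>m. \<exists>x\<in>F m. f m = prev_step A F m +>\<^bsub>A\<^esub> x) \<and>
                    finite {m. f m \<noteq> prev_step A F m}},
      mult = (\<lambda>f g m. \<Union>a\<in>Pi UNIV f. \<Union>b\<in>Pi UNIV g.
                prev_step A F m +>\<^bsub>A\<^esub> (\<Oplus>\<^bsub>A\<^esub>i\<in>{..m}. a i \<otimes>\<^bsub>A\<^esub> b (m - i))),
      one = gr_class A F 0 \<one>\<^bsub>A\<^esub>,
      zero = prev_step A F,
      add = (\<lambda>f g m. f m <+>\<^bsub>A\<^esub> g m),
      scal = (\<lambda>c. gr_class A F 0 (scal A c)) \<rparr>"


section \<open>Free algebras\<close>

text \<open>Words are wrapped so that the free monoid can be made an instance of \<open>monoid_add\<close>; the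
  multiplication of \<open>Poly_Mapping\<close> on finitely supported functions on words is then that of the
  free algebra.\<close>

datatype 'g word = Word (letters: "'g list")

instantiation word :: (type) monoid_add
begin
definition zero_word_def: "0 = Word []"
definition plus_word_def: "u + v = Word (letters u @ letters v)"
instance by standard (simp_all add: zero_word_def plus_word_def)
end

type_synonym ('g, 'k) nc_poly = "'g word \<Rightarrow>\<^sub>0 'k"

definition letter :: "'g \<Rightarrow> ('g, 'k::field) nc_poly" where
  "letter g = Poly_Mapping.single (Word [g]) 1"

definition free_algebra :: "(('g, 'k::field) nc_poly, 'k) kalgebra" where
  "free_algebra =
    \<lparr> carrier = UNIV, mult = (*), one = 1, zero = 0, add = (+),
      scal = (\<lambda>c. Poly_Mapping.single 0 c) \<rparr>"

text \<open>\<open>nc_eval A v p\<close> is \<open>p(v\<^sub>1, \<dots>, v\<^sub>n)\<close>.\<close>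

definition nc_eval ::
  "('a, 'k) kalgebra \<Rightarrow> ('g \<Rightarrow> 'a) \<Rightarrow> ('g, 'k::field) nc_poly \<Rightarrow> 'a" where
  "nc_eval A v p = lin_comb A (\<lambda>w. list_prod A (map v (letters w))) p"


section \<open>Degrees, bicharacters and biideals of the tensor algebra\<close>

text \<open>The index set is a finite linearly ordered type \<open>'i\<close>, and the lattice of degrees is \<open>'i zn\<close>
  (not written \<open>int ^ 'i\<close>, which would force the sort of \<open>'i\<close> to be \<open>finite\<close> only), with standard basis \<open>alpha i\<close>.\<close>

type_synonym 'i zn = "(int, 'i) vec"

definition alpha :: "'i \<Rightarrow> 'i::finite zn" where
  "alpha i = axis i 1"

definition nonneg :: "('i::finite zn) set" where
  "nonneg = {l. \<forall>i. 0 \<le> l $ i}"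

definition word_degree :: "'i word \<Rightarrow> 'i::finite zn" where
  "word_degree w = sum_list (map alpha (letters w))"

definition homogeneous :: "'i::finite zn \<Rightarrow> ('i, 'k::field) nc_poly set" where
  "homogeneous l = {p. \<forall>w\<in>Poly_Mapping.keys p. word_degree w = l}"

definition bicharacter :: "('i::finite zn \<Rightarrow> 'i zn \<Rightarrow> 'k::field) \<Rightarrow> bool" where
  "bicharacter chi \<longleftrightarrow>
     (\<forall>a b. chi a b \<noteq> 0) \<and>
     (\<forall>a b c. chi (a + b) c = chi a c * chi b c) \<and>
     (\<forall>a b c. chi a (b + c) = chi a b * chi a c)"

text \<open>The tensor algebra on the span of the \<open>E\<^sub>i\<close> is \<open>free_algebra\<close> on \<open>'i\<close>.  Its tensor square has
  the pairs of words as a basis and carries the braided product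
  \<open>(x \<otimes> y)(x' \<otimes> y') = x (K\<^bsub>deg y\<^esub> \<cdot> x') \<otimes> y y' = chi (deg y) (deg x') xx' \<otimes> yy'\<close>
  coming from the braiding of Yetter-Drinfeld modules.\<close>

type_synonym ('i, 'k) nc_poly2 = "('i word \<times> 'i word) \<Rightarrow>\<^sub>0 'k"

definition tensor ::
  "('i, 'k::field) nc_poly \<Rightarrow> ('i, 'k) nc_poly \<Rightarrow> ('i, 'k) nc_poly2" where
  "tensor x y =
     (\<Sum>u\<in>Poly_Mapping.keys x. \<Sum>v\<in>Poly_Mapping.keys y.
        Poly_Mapping.single (u, v) (Poly_Mapping.lookup x u * Poly_Mapping.lookup y v))"

definition braided_mult ::
  "('i::finite zn \<Rightarrow> 'i zn \<Rightarrow> 'k::field) \<Rightarrow>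
     ('i, 'k) nc_poly2 \<Rightarrow> ('i, 'k) nc_poly2 \<Rightarrow> ('i, 'k) nc_poly2" where
  "braided_mult chi X Y =
     (\<Sum>(u, v)\<in>Poly_Mapping.keys X. \<Sum>(u', v')\<in>Poly_Mapping.keys Y.
        Poly_Mapping.single (u + u', v + v')
          (chi (word_degree v) (word_degree u') *
             Poly_Mapping.lookup X (u, v) * Poly_Mapping.lookup Y (u', v')))"

text \<open>The braided coproduct: the algebra map with \<open>E\<^sub>i \<mapsto> E\<^sub>i \<otimes> 1 + 1 \<otimes> E\<^sub>i\<close>.\<close>

definition coproduct_word ::
  "('i::finite zn \<Rightarrow> 'i zn \<Rightarrow> 'k::field) \<Rightarrow> 'i word \<Rightarrow> ('i, 'k) nc_poly2" where
  "coproduct_word chi w =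
     foldr (\<lambda>i. braided_mult chi (tensor (letter i) 1 + tensor 1 (letter i))) (letters w) (tensor 1 1)"

definition coproduct ::
  "('i::finite zn \<Rightarrow> 'i zn \<Rightarrow> 'k::field) \<Rightarrow> ('i, 'k) nc_poly \<Rightarrow> ('i, 'k) nc_poly2" where
  "coproduct chi x =
     (\<Sum>w\<in>Poly_Mapping.keys x.
        Poly_Mapping.map ((*) (Poly_Mapping.lookup x w)) (coproduct_word chi w))"

definition counit :: "('g, 'k::field) nc_poly \<Rightarrow> 'k" where
  "counit x = Poly_Mapping.lookup x 0"

definition tensor_subspace ::
  "('i, 'k::field) nc_poly set \<Rightarrow> ('i, 'k) nc_poly set \<Rightarrow> ('i, 'k) nc_poly2 set" where
  "tensor_subspace V W = {sum_list (map (\<lambda>(x, y). tensor x y) ts) | ts. set ts \<subseteq> V \<times> W}"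

definition biideal ::
  "('i::finite zn \<Rightarrow> 'i zn \<Rightarrow> 'k::field) \<Rightarrow> ('i, 'k) nc_poly set \<Rightarrow> bool" where
  "biideal chi J \<longleftrightarrow>
     ideal J free_algebra \<and>
     (\<forall>x\<in>J. counit x = 0) \<and>
     (\<forall>x\<in>J. \<exists>s\<in>tensor_subspace J UNIV. \<exists>t\<in>tensor_subspace UNIV J. coproduct chi x = s + t)"

definition homogeneous_part ::
  "'i::finite zn \<Rightarrow> ('i, 'k::field) nc_poly \<Rightarrow> ('i, 'k) nc_poly" where
  "homogeneous_part l x =
     (\<Sum>w\<in>{w\<in>Poly_Mapping.keys x. word_degree w = l}.
        Poly_Mapping.single w (Poly_Mapping.lookup x w))"

definition graded_subspace :: "('i::finite, 'k::field) nc_poly set \<Rightarrow> bool" where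
  "graded_subspace J \<longleftrightarrow> (\<forall>x\<in>J. \<forall>l. homogeneous_part l x \<in> J)"

definition length_at_least_two :: "('g, 'k::field) nc_poly set" where
  "length_at_least_two = {x. \<forall>w\<in>Poly_Mapping.keys x. 2 \<le> length (letters w)}"


section \<open>The quotient \<open>U(\<chi>)\<close> of the Hopf algebra \<open>Ut\<close> given by generators and relations\<close>

datatype 'i u_gen = GE 'i | GF 'i | GK 'i | GKinv 'i

definition Ut_relations ::
  "('i::finite zn \<Rightarrow> 'i zn \<Rightarrow> 'k::field) \<Rightarrow> ('i u_gen, 'k) nc_poly set" where
  "Ut_relations chi =
     (let E = (\<lambda>i. letter (GE i)); F = (\<lambda>i. letter (GF i));
          K = (\<lambda>i. letter (GK i)); Kinv = (\<lambda>i. letter (GKinv i));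
          q = (\<lambda>i j. chi (alpha i) (alpha j));
          sc = (\<lambda>c. Poly_Mapping.single 0 c)
      in {K i * Kinv i - 1 | i. True} \<union>
         {Kinv i * K i - 1 | i. True} \<union>
         {K i * K j - K j * K i | i j. True} \<union>
         {K i * E j - sc (q i j) * E j * K i | i j. True} \<union>
         {K i * F j - sc (inverse (q i j)) * F j * K i | i j. True} \<union>
         {E i * F j - F j * E i - (if i = j then K i - Kinv i else 0) | i j. True})"

definition Ut_ideal ::
  "('i::finite zn \<Rightarrow> 'i zn \<Rightarrow> 'k::field) \<Rightarrow> ('i u_gen, 'k) nc_poly set" where
  "Ut_ideal chi = Idl\<^bsub>free_algebra\<^esub> (Ut_relations chi)"

type_synonym ('i, 'k) ut = "('i u_gen, 'k) nc_poly set"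
type_synonym ('i, 'k) u = "('i, 'k) ut set"

definition Ut :: "('i::finite zn \<Rightarrow> 'i zn \<Rightarrow> 'k::field) \<Rightarrow> (('i, 'k) ut, 'k) kalgebra" where
  "Ut chi = alg_quot free_algebra (Ut_ideal chi)"

definition Ut_gen ::
  "('i::finite zn \<Rightarrow> 'i zn \<Rightarrow> 'k::field) \<Rightarrow> 'i u_gen \<Rightarrow> ('i, 'k) ut" where
  "Ut_gen chi g = Ut_ideal chi +>\<^bsub>free_algebra\<^esub> letter g"

fun omega_gen :: "'i u_gen \<Rightarrow> 'i u_gen" where
  "omega_gen (GE i) = GF i"
| "omega_gen (GF i) = GE i"
| "omega_gen (GK i) = GKinv i"
| "omega_gen (GKinv i) = GK i"

text \<open>The involution \<open>omega_gen\<close> of the generators preserves \<open>Ut_ideal chi\<close> (for symmetric \<open>q\<close>), so that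
  the image of a coset is a coset.\<close>

definition omega :: "('i, 'k::field) ut \<Rightarrow> ('i, 'k) ut" where
  "omega X = nc_eval free_algebra (\<lambda>g. letter (omega_gen g)) ` X"

text \<open>The biideal \<open>J\<close>, viewed inside the subalgebra of \<open>Ut chi\<close> generated by the \<open>E\<^sub>i\<close>.\<close>

definition Ut_embed ::
  "('i::finite zn \<Rightarrow> 'i zn \<Rightarrow> 'k::field) \<Rightarrow> ('i, 'k) nc_poly set \<Rightarrow> ('i, 'k) ut set" where
  "Ut_embed chi J = nc_eval (Ut chi) (\<lambda>i. Ut_gen chi (GE i)) ` J"

definition U_ideal ::
  "('i::finite zn \<Rightarrow> 'i zn \<Rightarrow> 'k::field) \<Rightarrow> ('i, 'k) nc_poly set \<Rightarrow> ('i, 'k) ut set" where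
  "U_ideal chi J = Idl\<^bsub>Ut chi\<^esub> (Ut_embed chi J \<union> omega ` Ut_embed chi J)"

definition U_alg ::
  "('i::finite zn \<Rightarrow> 'i zn \<Rightarrow> 'k::field) \<Rightarrow> ('i, 'k) nc_poly set \<Rightarrow> (('i, 'k) u, 'k) kalgebra" where
  "U_alg chi J = alg_quot (Ut chi) (U_ideal chi J)"

definition U_gen ::
  "('i::finite zn \<Rightarrow> 'i zn \<Rightarrow> 'k::field) \<Rightarrow> ('i, 'k) nc_poly set \<Rightarrow> 'i u_gen \<Rightarrow> ('i, 'k) u" where
  "U_gen chi J g = U_ideal chi J +>\<^bsub>Ut chi\<^esub> Ut_gen chi g"

definition U_E where "U_E chi J i = U_gen chi J (GE i)"
definition U_F where "U_F chi J i = U_gen chi J (GF i)"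
definition U_Ki where "U_Ki chi J i = U_gen chi J (GK i)"
definition U_Kinv where "U_Kinv chi J i = U_gen chi J (GKinv i)"

definition U_K ::
  "('i::{finite,linorder} zn \<Rightarrow> 'i zn \<Rightarrow> 'k::field) \<Rightarrow> ('i, 'k) nc_poly set \<Rightarrow>
     'i zn \<Rightarrow> ('i, 'k) u" where
  "U_K chi J l =
     list_prod (U_alg chi J)
       (map (\<lambda>i. if 0 \<le> l $ i then U_Ki chi J i [^]\<^bsub>U_alg chi J\<^esub> nat (l $ i)
                 else U_Kinv chi J i [^]\<^bsub>U_alg chi J\<^esub> nat (- (l $ i)))
            (sorted_list_of_set UNIV))"


section \<open>Triangular decompositions of \<open>U(\<chi>)\<close> and projections\<close>

text \<open>\<open>U_minus_part chi J b\<close> is the component of degree \<open>- b\<close>.\<close>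

definition U_plus where "U_plus chi J = gen_subalgebra (U_alg chi J) (range (U_E chi J))"
definition U_plus_part where
  "U_plus_part chi J a = nc_eval (U_alg chi J) (U_E chi J) ` homogeneous a"
definition U_minus_part where
  "U_minus_part chi J b = nc_eval (U_alg chi J) (U_F chi J) ` homogeneous b"
definition U_zero where
  "U_zero chi J = gen_subalgebra (U_alg chi J) (range (U_Ki chi J) \<union> range (U_Kinv chi J))"
definition G_minus where
  "G_minus chi J =
     gen_subalgebra (U_alg chi J) (range (\<lambda>i. U_F chi J i \<otimes>\<^bsub>U_alg chi J\<^esub> U_Ki chi J i))"

definition P_proj ::
  "('i::{finite,linorder} zn \<Rightarrow> 'i zn \<Rightarrow> 'k::field) \<Rightarrow> ('i, 'k) nc_poly set \<Rightarrow>
     'i zn \<Rightarrow> ('i, 'k) u \<Rightarrow> ('i, 'k) u" where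
  "P_proj chi J =
     summand_proj (U_alg chi J) UNIV
       (\<lambda>l. lin_span (U_alg chi J)
              (U_plus chi J <#>\<^bsub>U_alg chi J\<^esub> {U_K chi J l} <#>\<^bsub>U_alg chi J\<^esub> G_minus chi J))"

definition pi00 ::
  "('i::finite zn \<Rightarrow> 'i zn \<Rightarrow> 'k::field) \<Rightarrow> ('i, 'k) nc_poly set \<Rightarrow>
     ('i, 'k) u \<Rightarrow> ('i, 'k) u" where
  "pi00 chi J =
     summand_proj (U_alg chi J) (nonneg \<times> nonneg)
       (\<lambda>(a, b). lin_span (U_alg chi J)
          (U_plus_part chi J a <#>\<^bsub>U_alg chi J\<^esub> U_zero chi J <#>\<^bsub>U_alg chi J\<^esub> U_minus_part chi J b))
       (0, 0)"


section \<open>The involution \<open>\<tau>\<close> and the elements \<open>B\<^sub>i\<close>\<close>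

definition tau_lattice :: "('i \<Rightarrow> 'i) \<Rightarrow> 'i::finite zn \<Rightarrow> 'i zn" where
  "tau_lattice tau l = (\<Sum>i\<in>UNIV. (l $ i) *s alpha (tau i))"

definition tau_tensor :: "('i \<Rightarrow> 'i) \<Rightarrow> ('i, 'k::field) nc_poly \<Rightarrow> ('i, 'k) nc_poly" where
  "tau_tensor tau = nc_eval free_algebra (\<lambda>i. letter (tau i))"

definition lattice_theta :: "('i \<Rightarrow> 'i) \<Rightarrow> ('i::finite zn) set" where
  "lattice_theta tau = {l. tau_lattice tau l = - l}"

text \<open>The monoid \<open>- \<nat>\<^sup>n + \<int>\<^sup>n\<^sub>\<theta>\<close> of exponents.\<close>

definition poly_lattice :: "('i \<Rightarrow> 'i) \<Rightarrow> ('i::finite zn) set" where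
  "poly_lattice tau = {- a + t | a t. a \<in> nonneg \<and> t \<in> lattice_theta tau}"

inductive_set tau_submonoid :: "('i \<Rightarrow> 'i) \<Rightarrow> ('i::finite zn) set" for tau where
  zero: "0 \<in> tau_submonoid tau"
| step: "l \<in> tau_submonoid tau \<Longrightarrow> l + (alpha i + alpha (tau i)) \<in> tau_submonoid tau"

definition B_elem ::
  "('i::finite zn \<Rightarrow> 'i zn \<Rightarrow> 'k::field) \<Rightarrow> ('i, 'k) nc_poly set \<Rightarrow> ('i \<Rightarrow> 'i) \<Rightarrow> ('k, 'i) vec \<Rightarrow>
     'i \<Rightarrow> ('i, 'k) u" where
  "B_elem chi J tau c i =
     U_F chi J i \<oplus>\<^bsub>U_alg chi J\<^esub>
       scal (U_alg chi J) (c $ i) \<otimes>\<^bsub>U_alg chi J\<^esub> U_E chi J (tau i) \<otimes>\<^bsub>U_alg chi J\<^esub> U_Kinv chi J i"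


section \<open>The negative Heisenberg double\<close>

definition U_Et where
  "U_Et chi J i = U_E chi J i \<otimes>\<^bsub>U_alg chi J\<^esub> U_Kinv chi J i"

datatype 'i poly_gen = PE 'i | PF 'i | PKinv 'i | PKtheta 'i

fun poly_gen_value ::
  "('i::finite zn \<Rightarrow> 'i zn \<Rightarrow> 'k::field) \<Rightarrow> ('i, 'k) nc_poly set \<Rightarrow> ('i \<Rightarrow> 'i) \<Rightarrow>
     'i poly_gen \<Rightarrow> ('i, 'k) u" where
  "poly_gen_value chi J tau (PE i) = U_Et chi J i"
| "poly_gen_value chi J tau (PF i) = U_F chi J i"
| "poly_gen_value chi J tau (PKinv i) = U_Kinv chi J i"
| "poly_gen_value chi J tau (PKtheta i) = U_Ki chi J i \<otimes>\<^bsub>U_alg chi J\<^esub> U_Kinv chi J (tau i)"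

fun poly_gen_degree :: "'i poly_gen \<Rightarrow> nat" where
  "poly_gen_degree (PE i) = 1"
| "poly_gen_degree (PF i) = 1"
| "poly_gen_degree (PKinv i) = 1"
| "poly_gen_degree (PKtheta i) = 0"

definition U_poly ::
  "('i::finite zn \<Rightarrow> 'i zn \<Rightarrow> 'k::field) \<Rightarrow> ('i, 'k) nc_poly set \<Rightarrow> ('i \<Rightarrow> 'i) \<Rightarrow>
     (('i, 'k) u, 'k) kalgebra" where
  "U_poly chi J tau =
     (U_alg chi J) \<lparr> carrier := gen_subalgebra (U_alg chi J) (range (poly_gen_value chi J tau)) \<rparr>"

definition U_poly_filtration where
  "U_poly_filtration chi J tau =
     gen_filtration (U_poly chi J tau) (poly_gen_value chi J tau) poly_gen_degree"

type_synonym ('i, 'k) heis = "nat \<Rightarrow> ('i, 'k) u set"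

definition Heis ::
  "('i::finite zn \<Rightarrow> 'i zn \<Rightarrow> 'k::field) \<Rightarrow> ('i, 'k) nc_poly set \<Rightarrow> ('i \<Rightarrow> 'i) \<Rightarrow>
     (('i, 'k) heis, 'k) kalgebra" where
  "Heis chi J tau = assoc_graded (U_poly chi J tau) (U_poly_filtration chi J tau)"

definition Heis_class ::
  "('i::finite zn \<Rightarrow> 'i zn \<Rightarrow> 'k::field) \<Rightarrow> ('i, 'k) nc_poly set \<Rightarrow> ('i \<Rightarrow> 'i) \<Rightarrow>
     nat \<Rightarrow> ('i, 'k) u \<Rightarrow> ('i, 'k) heis" where
  "Heis_class chi J tau = gr_class (U_poly chi J tau) (U_poly_filtration chi J tau)"

definition Heis_E where "Heis_E chi J tau i = Heis_class chi J tau 1 (U_Et chi J i)"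
definition Heis_F where "Heis_F chi J tau i = Heis_class chi J tau 1 (U_F chi J i)"

text \<open>For \<open>l = - a + t\<close> with \<open>a\<close> in \<open>\<nat>\<^sup>n\<close> and \<open>t\<close> in \<open>\<int>\<^sup>n\<^sub>\<theta>\<close> the coordinates of \<open>t\<close> sum up to \<open>0\<close>, so the degree
  of \<open>K\<^sub>l\<close>, which is that of a product of \<open>\<Sum>i. a $ i\<close> generators \<open>K\<^sub>i\<^sup>-\<^sup>1\<close>, is minus the sum of the
  coordinates of \<open>l\<close>.\<close>

definition Heis_K where
  "Heis_K chi J tau l = Heis_class chi J tau (nat (- (\<Sum>i\<in>UNIV. l $ i))) (U_K chi J l)"

text \<open>The augmentation ideals of \<open>G\<^sup>+\<close> and \<open>U\<^sup>-\<close> inside \<open>Heis\<close> consist of the values of the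
  noncommutative polynomials without constant term.\<close>

definition Heis_G_plus_aug where
  "Heis_G_plus_aug chi J tau = nc_eval (Heis chi J tau) (Heis_E chi J tau) ` {p. counit p = 0}"
definition Heis_U_minus_aug where
  "Heis_U_minus_aug chi J tau = nc_eval (Heis chi J tau) (Heis_F chi J tau) ` {p. counit p = 0}"

definition pi00_Heis ::
  "('i::{finite,linorder} zn \<Rightarrow> 'i zn \<Rightarrow> 'k::field) \<Rightarrow> ('i, 'k) nc_poly set \<Rightarrow> ('i \<Rightarrow> 'i) \<Rightarrow>
     ('i, 'k) heis \<Rightarrow> ('i, 'k) heis" where
  "pi00_Heis chi J tau =
     proj_along (Heis chi J tau)
       (lin_span (Heis chi J tau) (Heis_K chi J tau ` poly_lattice tau))
       (lin_span (Heis chi J tau)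
          ((Heis_G_plus_aug chi J tau <#>\<^bsub>Heis chi J tau\<^esub> carrier (Heis chi J tau)) \<union>
           (carrier (Heis chi J tau) <#>\<^bsub>Heis chi J tau\<^esub> Heis_U_minus_aug chi J tau)))"

definition B_Heis ::
  "('i::{finite,linorder} zn \<Rightarrow> 'i zn \<Rightarrow> 'k::field) \<Rightarrow> ('i, 'k) nc_poly set \<Rightarrow> ('i \<Rightarrow> 'i) \<Rightarrow>
     ('k, 'i) vec \<Rightarrow> 'i \<Rightarrow> ('i, 'k) heis" where
  "B_Heis chi J tau c i =
     Heis_F chi J tau i \<oplus>\<^bsub>Heis chi J tau\<^esub>
       scal (Heis chi J tau) (c $ i) \<otimes>\<^bsub>Heis chi J tau\<^esub> Heis_E chi J tau (tau i)
         \<otimes>\<^bsub>Heis chi J tau\<^esub> Heis_K chi J tau (alpha (tau i) - alpha i)"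

text \<open>The identification \<open>K\<^sub>l \<leftrightarrow> K\<^sub>l\<close> of the span of the \<open>K\<^sub>l\<close>, \<open>l \<in> poly_lattice tau\<close>, in \<open>U(\<chi>)\<close> with
  the corresponding subalgebra of \<open>Heis\<close>: both are linearly independent families, so this relation
  is the graph of a linear isomorphism.\<close>

definition K_identified ::
  "('i::{finite,linorder} zn \<Rightarrow> 'i zn \<Rightarrow> 'k::field) \<Rightarrow> ('i, 'k) nc_poly set \<Rightarrow> ('i \<Rightarrow> 'i) \<Rightarrow>
     ('i, 'k) u \<Rightarrow> ('i, 'k) heis \<Rightarrow> bool" where
  "K_identified chi J tau x y \<longleftrightarrow>
     (\<exists>a. Poly_Mapping.keys a \<subseteq> poly_lattice tau \<and>
          x = lin_comb (U_alg chi J) (U_K chi J) a \<and>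
          y = lin_comb (Heis chi J tau) (Heis_K chi J tau) a)"

end

theory Submission
  imports Defs "HOL-Algebra.UnivPoly"
begin

text \<open>Let \<open>X = T \<otimes> k[\<int>\<^sup>n] \<otimes> T\<close> have the basis \<open>(u, m, v)\<close>, standing for \<open>E\<^sub>u K\<^sub>m F\<^sub>v\<close>.  Left multiplication defines an
  action of the free algebra on \<open>X\<close> that satisfies the relations of \<open>Ut\<close>.  A biideal \<open>J\<close> in degrees at least two is
  stable under the skew derivations describing the commutators of \<open>E\<^sub>u\<close> with \<open>F\<^sub>i\<close>, so the subspace
  \<open>N = J \<otimes> k[\<int>\<^sup>n] \<otimes> T + T \<otimes> k[\<int>\<^sup>n] \<otimes> J\<close> is stable and \<open>U(\<chi>) = X / N\<close>.  As \<open>N\<close> is graded by \<open>(deg u, m, deg v)\<close>, the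
  projections and the filtration of \<open>U(\<chi>)\<^sup>p\<^sup>o\<^sup>l\<^sup>y\<close> amount to restricting coefficients to sets of basis elements: the
  \<open>\<lambda>\<close>-th summand is given by \<open>m = \<lambda> + deg v\<close>, and it lies in filtration degree minus the coordinate sum of \<open>\<lambda>\<close>.

  If \<open>p\<close> is homogeneous of degree \<open>\<lambda>\<close>, then \<open>p(B)\<close> only meets the summands for elements of \<open>- \<lambda> + \<nat>\<^sup>n\<close>.  Hence its symbol of
  degree \<open>|\<lambda>|\<close>, which is \<open>p(B\<^sup>\<or>)\<close>, is the symbol of its component in the summand \<open>- \<lambda>\<close>, and both sides of the identity are
  \<open>a K\<^sub>-\<^sub>\<lambda>\<close> with \<open>a\<close> the coefficient of \<open>p(B)\<close> at \<open>(0, - \<lambda>, 0)\<close>.  The weights of \<open>p(B)\<close> lie in \<open>- \<lambda>\<close> plus the submonoid generated by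
  the \<open>\<alpha>\<^sub>i + \<alpha>\<^sub>\<tau>\<^sub>i\<close>, so \<open>a\<close> vanishes if \<open>\<lambda>\<close> is not in this submonoid.\<close>

section \<open>Linear maps between spaces of finitely supported functions\<close>

text \<open>The triangular decomposition has to be established here: \<open>U_alg\<close> is given
  by generators and relations, and the projections are definite descriptions, which say nothing
  before the sums are known to be direct. Spanning is a straightening of words. Independence modulo
  \<open>N\<close> comes from letting words act on the basis vector of 1: a normal form is recovered
  from its action, while the relations act by zero and both copies of \<open>J\<close> act into
  \<open>N\<close>. The delicate copy is the one in the letters F, which acts simply only on vectors
  without letters E; the general vector is reached by pulling letters E out to the left, at the
  price of skew derivatives of elements of \<open>J\<close>. The link with the Heisenberg double is
  the commutator of E_i and F_i. Its K_i term lies 2 \<alpha>_i above its K_i^{-1} term in the index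
  l of U^+ K_l G^-, and for the same reason two filtration steps lower. So it is lost both in the
  extreme summand and in the symbol. The coefficient at (0, - \<lambda>, 0) makes sense on U because
  \<open>J\<close> has no constant terms, so that \<open>N\<close> has no terms K_m.\<close>

abbreviation coef :: "('b \<Rightarrow>\<^sub>0 'k::zero) \<Rightarrow> 'b \<Rightarrow> 'k" where "coef \<equiv> Poly_Mapping.lookup"
abbreviation supp :: "('b \<Rightarrow>\<^sub>0 'k::zero) \<Rightarrow> 'b set" where "supp \<equiv> Poly_Mapping.keys"
abbreviation sing :: "'b \<Rightarrow> 'k \<Rightarrow> ('b \<Rightarrow>\<^sub>0 'k::zero)" where "sing \<equiv> Poly_Mapping.single"

text \<open>Available for an arbitrary index type, so also for elements indexed by pairs and
  triples; the body is literally the scaling that occurs in \<open>coproduct\<close>.\<close>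

definition pscale :: "'k::field \<Rightarrow> ('b \<Rightarrow>\<^sub>0 'k) \<Rightarrow> ('b \<Rightarrow>\<^sub>0 'k)" (infixr \<open>\<cdot>\<close> 75) where
  "c \<cdot> x = Poly_Mapping.map ((*) c) x"

lemma coef_pscale [simp]: "coef (c \<cdot> x) b = c * coef x b"
  unfolding pscale_def by (simp add: Poly_Mapping.map.rep_eq when_def)

lemma pscale_mult: "c \<cdot> x = sing 0 c * x" for x :: "'b::monoid_add \<Rightarrow>\<^sub>0 'k::field"
  unfolding pscale_def by (rule Poly_Mapping.mult_map_scale_conv_mult)

global_interpretation pm: vector_space "pscale :: 'k::field \<Rightarrow> ('b \<Rightarrow>\<^sub>0 'k) \<Rightarrow> ('b \<Rightarrow>\<^sub>0 'k)"
  by unfold_locales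
    (auto intro!: poly_mapping_eqI simp: lookup_add algebra_simps)

lemma pscale_sing [simp]: "c \<cdot> sing b d = sing b (c * d)"
  by (rule poly_mapping_eqI) (simp add: lookup_single when_def)

lemma mult_pscale_left: "(c \<cdot> x) * y = c \<cdot> (x * y)"
  for x y :: "'b::monoid_add \<Rightarrow>\<^sub>0 'k::field"
  by (simp add: pscale_mult mult.assoc)

text \<open>A constant is supported at the neutral element, so it commutes with every single term
  because the field is commutative; the induction adds one term at a time.\<close>

lemma sing_zero_central: "x * sing 0 c = sing 0 c * x"
  for x :: "'b::monoid_add \<Rightarrow>\<^sub>0 'k::field"
proof (induction x rule: update_induct)
  case const then show ?case by simp
next
  case (update f a b)
  have "Poly_Mapping.update a b f = f + sing a b"
    using update.hyps by (intro poly_mapping_eqI)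
      (auto simp: lookup_update lookup_add lookup_single in_keys_iff when_def)
  then show ?case using update.IH
    by (simp add: distrib_left distrib_right mult_single mult.commute)
qed

lemma mult_pscale_right: "x * (c \<cdot> y) = c \<cdot> (x * y)"
  for x y :: "'b::monoid_add \<Rightarrow>\<^sub>0 'k::field"
  by (metis pscale_mult mult.assoc sing_zero_central)

definition lin :: "(('b \<Rightarrow>\<^sub>0 'k::field) \<Rightarrow> ('c \<Rightarrow>\<^sub>0 'k)) \<Rightarrow> bool" where
  "lin f \<longleftrightarrow> (\<forall>x y. f (x + y) = f x + f y) \<and> (\<forall>c x. f (c \<cdot> x) = c \<cdot> f x)"

lemma linI: "(\<And>x y. f (x + y) = f x + f y) \<Longrightarrow> (\<And>c x. f (c \<cdot> x) = c \<cdot> f x) \<Longrightarrow> lin f"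
  by (simp add: lin_def)

lemma lin_add: "lin f \<Longrightarrow> f (x + y) = f x + f y"
  and lin_scale: "lin f \<Longrightarrow> f (c \<cdot> x) = c \<cdot> f x"
  by (simp_all add: lin_def)

lemma lin_zero [simp]: "lin f \<Longrightarrow> f 0 = 0"
  using lin_scale[of f 0 0] by simp

lemma lin_uminus: "lin f \<Longrightarrow> f (- x) = - f x"
  using lin_scale[of f "- 1" x] by (simp add: pm.scale_minus_left)

lemma lin_diff: "lin f \<Longrightarrow> f (x - y) = f x - f y"
  using lin_add[of f x "- y"] by (simp add: lin_uminus)

lemma lin_sum: "lin f \<Longrightarrow> f (sum g S) = (\<Sum>s\<in>S. f (g s))"
  by (induction S rule: infinite_finite_induct) (auto simp: lin_add)

lemma lin_id [simp]: "lin (\<lambda>x. x)" by (simp add: lin_def)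

lemma lin_const_zero [simp]: "lin (\<lambda>x. 0)" by (simp add: lin_def)

lemma lin_compose: "lin f \<Longrightarrow> lin g \<Longrightarrow> lin (\<lambda>x. f (g x))"
  by (simp add: lin_def)

lemma lin_plus: "lin f \<Longrightarrow> lin g \<Longrightarrow> lin (\<lambda>x. f x + g x)"
  by (rule linI) (simp_all add: lin_add lin_scale pm.scale_right_distrib)

lemma lin_minus: "lin f \<Longrightarrow> lin g \<Longrightarrow> lin (\<lambda>x. f x - g x)"
  by (rule linI) (simp_all add: lin_add lin_scale pm.scale_right_diff_distrib)

lemma lin_scaled: "lin f \<Longrightarrow> lin (\<lambda>x. c \<cdot> f x)"
  by (rule linI) (simp_all add: lin_add lin_scale pm.scale_right_distrib mult.commute)

lemma lin_mult_left: "lin (\<lambda>x. a * x)" for a :: "'b::monoid_add \<Rightarrow>\<^sub>0 'k::field"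
  by (rule linI) (simp_all add: distrib_left mult_pscale_right)

lemma lin_mult_right: "lin (\<lambda>x. x * a)" for a :: "'b::monoid_add \<Rightarrow>\<^sub>0 'k::field"
  by (rule linI) (simp_all add: distrib_right mult_pscale_left)

definition lext :: "('b \<Rightarrow> ('c \<Rightarrow>\<^sub>0 'k::field)) \<Rightarrow> ('b \<Rightarrow>\<^sub>0 'k) \<Rightarrow> ('c \<Rightarrow>\<^sub>0 'k)" where
  "lext f x = (\<Sum>b\<in>supp x. coef x b \<cdot> f b)"

lemma lext_superset:
  "finite S \<Longrightarrow> supp x \<subseteq> S \<Longrightarrow> lext f x = (\<Sum>b\<in>S. coef x b \<cdot> f b)"
  unfolding lext_def by (rule sum.mono_neutral_left) (auto simp: in_keys_iff)

lemma lin_lext [simp]: "lin (lext f)"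
proof (rule linI)
  fix x y :: "'a \<Rightarrow>\<^sub>0 'b"
  let ?S = "supp x \<union> supp y"
  have "supp (x + y) \<subseteq> ?S" by (rule Poly_Mapping.keys_add)
  then show "lext f (x + y) = lext f x + lext f y"
    by (subst (1 2 3) lext_superset[of ?S])
      (auto simp: lookup_add pm.scale_left_distrib sum.distrib)
next
  fix c and x :: "'a \<Rightarrow>\<^sub>0 'b"
  have "supp (c \<cdot> x) \<subseteq> supp x" by (auto simp: in_keys_iff)
  then show "lext f (c \<cdot> x) = c \<cdot> lext f x"
    by (subst (1 2) lext_superset[of "supp x"]) (auto simp: pm.scale_sum_right)
qed

lemma lext_sing [simp]: "lext f (sing b c) = c \<cdot> f b"
  by (simp add: lext_def)

lemma lext_expand: "lext (\<lambda>b. sing b 1) x = x"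
proof (rule poly_mapping_eqI)
  fix k
  have "coef (lext (\<lambda>b. sing b 1) x) k = (\<Sum>b\<in>supp x. if b = k then coef x b else 0)"
    unfolding lext_def by (simp add: lookup_sum lookup_single when_def)
  also have "\<dots> = coef x k" by (simp add: in_keys_iff)
  finally show "coef (lext (\<lambda>b. sing b 1) x) k = coef x k" .
qed

lemma lin_eq_lext: "lin f \<Longrightarrow> f x = lext (\<lambda>b. f (sing b 1)) x"
  using lin_sum[of f "\<lambda>b. coef x b \<cdot> sing b 1" "supp x"] lext_expand[of x]
  by (simp add: lext_def lin_scale del: pscale_sing)

lemma lin_eqI: "lin f \<Longrightarrow> lin g \<Longrightarrow> (\<And>b. f (sing b 1) = g (sing b 1)) \<Longrightarrow> f x = g x"
  using lin_eq_lext[of f x] lin_eq_lext[of g x] by simp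

lemma lin_sing: "lin f \<Longrightarrow> f (sing b c) = c \<cdot> f (sing b 1)"
  using lin_scale[of f c "sing b 1"] by simp

section \<open>Coordinate subspaces and restriction of coefficients\<close>

definition on :: "'b set \<Rightarrow> ('b \<Rightarrow>\<^sub>0 'k::field) set" where
  "on B = {x. supp x \<subseteq> B}"

lemma subspace_on [simp]: "pm.subspace (on B)"
  unfolding pm.subspace_def on_def
  by (auto simp: in_keys_iff lookup_add subset_iff) (metis add_0)

text \<open>The image of x is a combination of the images of the basis elements in its support.
  Nearly all invariance statements below are reduced to basis elements in this way.\<close>

lemma lin_into_subspace:
  assumes "lin f" "pm.subspace S" "x \<in> on B" "\<And>b. b \<in> B \<Longrightarrow> f (sing b 1) \<in> S"
  shows "f x \<in> S"
  unfolding lin_eq_lext[OF assms(1), of x] lext_def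
  using assms by (intro pm.subspace_sum pm.subspace_scale) (auto simp: on_def)

lemma subspace_vimage: "lin f \<Longrightarrow> pm.subspace S \<Longrightarrow> pm.subspace {x. f x \<in> S}"
  by (simp add: pm.subspace_def lin_add lin_scale)

lemma lin_span_into:
  assumes "lin f" "pm.subspace S" "\<And>b. b \<in> G \<Longrightarrow> f b \<in> S" "x \<in> pm.span G"
  shows "f x \<in> S"
  using pm.span_minimal[of G "{x. f x \<in> S}"] assms subspace_vimage[of f S] by blast

text \<open>Through \<open>Psi\<close> this cut will induce both projections of U, provided that the
  set is a union of multidegrees.\<close>

definition restr :: "'b set \<Rightarrow> ('b \<Rightarrow>\<^sub>0 'k::field) \<Rightarrow> ('b \<Rightarrow>\<^sub>0 'k)" where
  "restr B = lext (\<lambda>b. if b \<in> B then sing b 1 else 0)"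

lemma lin_restr [simp]: "lin (restr B)" by (simp add: restr_def)

lemma restr_sing: "restr B (sing b c) = (if b \<in> B then sing b c else 0)"
  by (simp add: restr_def)

lemma coef_restr: "coef (restr B x) b = (if b \<in> B then coef x b else 0)"
proof -
  have "coef (restr B x) b = (\<Sum>a\<in>supp x. if a = b then (if b \<in> B then coef x b else 0) else 0)"
    unfolding restr_def lext_def lookup_sum
    by (rule sum.cong) (auto simp: lookup_single when_def)
  also have "\<dots> = (if b \<in> B then coef x b else 0)" by (auto simp: in_keys_iff)
  finally show ?thesis .
qed

lemma supp_restr: "supp (restr B x) = supp x \<inter> B"
  by (auto simp: in_keys_iff coef_restr split: if_splits)

lemma restr_on [simp]: "restr B x \<in> on B"
  by (simp add: on_def supp_restr)

lemma restr_restr: "restr A (restr B x) = restr (A \<inter> B) x"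
  by (rule poly_mapping_eqI) (auto simp: coef_restr)

lemma restr_single: "restr {b} x = sing b (coef x b)"
  by (rule poly_mapping_eqI) (auto simp: coef_restr lookup_single when_def)

lemma minus_restr: "x - restr B x = restr (- B) x"
  by (rule poly_mapping_eqI) (auto simp: coef_restr lookup_minus)

lemma restr_ident: "x \<in> on B \<Longrightarrow> restr B x = x"
  by (rule poly_mapping_eqI) (auto simp: coef_restr on_def in_keys_iff)

lemma restr_disjoint: "x \<in> on A \<Longrightarrow> A \<inter> B = {} \<Longrightarrow> restr B x = 0"
  by (rule poly_mapping_eqI) (auto simp: coef_restr on_def in_keys_iff)

section \<open>Algebras over a field\<close>

locale kalg = ring A for A :: "('a, 'k::field) kalgebra" (structure) +
  assumes scal_closed [simp, intro]: "scal A c \<in> carrier A"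
    and scal_add: "scal A (c + d) = scal A c \<oplus> scal A d"
    and scal_mult: "scal A (c * d) = scal A c \<otimes> scal A d"
    and scal_one [simp]: "scal A 1 = \<one>"
    and scal_central: "x \<in> carrier A \<Longrightarrow> x \<otimes> scal A c = scal A c \<otimes> x"
begin

lemma scal_zero [simp]: "scal A 0 = \<zero>"
  using scal_add[of 0 0] scal_closed[of 0] by (simp add: add.l_cancel_one)

lemma scal_uminus: "scal A (- c) = \<ominus> scal A c"
  using scal_add[of "- c" c] minus_equality[of "scal A (- c)" "scal A c"] by simp

lemma scal_left_commute:
  "x \<in> carrier A \<Longrightarrow> y \<in> carrier A \<Longrightarrow> x \<otimes> (scal A c \<otimes> y) = scal A c \<otimes> (x \<otimes> y)"
  by (simp add: m_assoc[symmetric] scal_central)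

lemma scal_scal: "x \<in> carrier A \<Longrightarrow> scal A c \<otimes> (scal A d \<otimes> x) = scal A (c * d) \<otimes> x"
  by (simp add: scal_mult m_assoc)

lemma scal_uminus_mult: "x \<in> carrier A \<Longrightarrow> scal A (- 1) \<otimes> x = \<ominus> x"
  by (simp add: scal_uminus l_minus)

definition vsub :: "'a set \<Rightarrow> bool" where
  "vsub V \<longleftrightarrow> V \<subseteq> carrier A \<and> \<zero> \<in> V \<and> (\<forall>x\<in>V. \<forall>y\<in>V. x \<oplus> y \<in> V) \<and>
     (\<forall>c. \<forall>x\<in>V. scal A c \<otimes> x \<in> V)"

lemma vsub_carrier: "vsub V \<Longrightarrow> x \<in> V \<Longrightarrow> x \<in> carrier A"
  and vsub_zero: "vsub V \<Longrightarrow> \<zero> \<in> V"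
  and vsub_add: "vsub V \<Longrightarrow> x \<in> V \<Longrightarrow> y \<in> V \<Longrightarrow> x \<oplus> y \<in> V"
  and vsub_scal: "vsub V \<Longrightarrow> x \<in> V \<Longrightarrow> scal A c \<otimes> x \<in> V"
  by (auto simp: vsub_def)

lemma vsub_a_inv: "vsub V \<Longrightarrow> x \<in> V \<Longrightarrow> \<ominus> x \<in> V"
  using vsub_scal[of V x "- 1"] by (simp add: scal_uminus_mult vsub_carrier)

lemma vsub_minus: "vsub V \<Longrightarrow> x \<in> V \<Longrightarrow> y \<in> V \<Longrightarrow> x \<ominus> y \<in> V"
  by (simp add: a_minus_def vsub_add vsub_a_inv)

lemma vsub_finsum: "vsub V \<Longrightarrow> (\<And>x. x \<in> S \<Longrightarrow> f x \<in> V) \<Longrightarrow> finsum A f S \<in> V"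
proof (induction S rule: infinite_finite_induct)
  case (insert x F)
  then show ?case
    by (subst finsum_insert) (auto simp: vsub_add Pi_def vsub_carrier)
qed (auto simp: vsub_zero)

lemma lin_span_base: "s \<in> S \<Longrightarrow> s \<in> carrier A \<Longrightarrow> s \<in> lin_span A S"
  unfolding lin_span_def set_mult_def
  by (rule generate.incl) (use scal_one in \<open>force intro: exI[of _ 1]\<close>)

lemma set_mult_carrier: "S \<subseteq> carrier A \<Longrightarrow> T \<subseteq> carrier A \<Longrightarrow> S <#> T \<subseteq> carrier A"
  unfolding set_mult_def by auto

text \<open>\<open>lin_span\<close> is by definition only an additive group, generated by the
  products c s. Stability under scalars is proved along the generation; the inverse of d s is
  absorbed into the scalar.\<close>

lemma vsub_lin_span:
  assumes "S \<subseteq> carrier A" shows "vsub (lin_span A S)"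
proof -
  let ?G = "range (scal A) <#> S"
  have G: "?G \<subseteq> carrier A" using assms by (intro set_mult_carrier) auto
  have car: "x \<in> lin_span A S \<Longrightarrow> x \<in> carrier A" for x
    unfolding lin_span_def using add.generate_in_carrier[OF _] G by auto
  have sc: "scal A c \<otimes> x \<in> lin_span A S" if "x \<in> lin_span A S" for c x
    using that unfolding lin_span_def
  proof (induction rule: generate.induct)
    case one
    then show ?case using generate.one[of "add_monoid A" ?G] by simp
  next
    case (incl h)
    then obtain d s where "h = scal A d \<otimes> s" "s \<in> S" by (auto simp: set_mult_def)
    then have "scal A c \<otimes> h \<in> ?G" using assms by (force simp: set_mult_def scal_scal)
    then show ?case by (rule generate.incl)
  next
    case (inv h)
    then obtain d s where h: "h = scal A d \<otimes> s" "s \<in> S" by (auto simp: set_mult_def)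
    then have "scal A (- c * d) \<otimes> s \<in> ?G" by (auto simp: set_mult_def)
    moreover have "scal A (- c * d) \<otimes> s = scal A c \<otimes> (\<ominus> h)" using h assms
      by (simp add: subset_iff scal_scal[symmetric] r_minus l_minus scal_uminus)
    ultimately show ?case by (simp add: generate.incl a_inv_def)
  next
    case (eng h1 h2)
    then show ?case
      using G generate.eng[OF eng.IH] add.generate_in_carrier[OF G] by (simp add: r_distr)
  qed
  show ?thesis unfolding vsub_def
    using car sc generate.one[of "add_monoid A" ?G] generate.eng[of _ "add_monoid A" ?G]
    by (auto simp: lin_span_def)
qed

lemma lin_span_minimal:
  assumes "vsub V" "S \<subseteq> V" shows "lin_span A S \<subseteq> V"
proof
  fix x assume "x \<in> lin_span A S"
  then show "x \<in> V" unfolding lin_span_def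
  proof (induction rule: generate.induct)
    case (incl h) then show ?case using assms by (auto simp: set_mult_def vsub_scal)
  next
    case (inv h) then have "h \<in> V" using assms by (auto simp: set_mult_def vsub_scal)
    then show ?case using vsub_a_inv[OF assms(1)] by (simp add: a_inv_def)
  qed (use assms in \<open>auto simp: vsub_zero vsub_add\<close>)
qed

lemma lin_span_mono: "S \<subseteq> lin_span A T \<Longrightarrow> T \<subseteq> carrier A \<Longrightarrow> lin_span A S \<subseteq> lin_span A T"
  by (rule lin_span_minimal) (auto intro: vsub_lin_span)

lemma gen_subalgebra_base: "s \<in> S \<Longrightarrow> s \<in> gen_subalgebra A S"
  unfolding gen_subalgebra_def by (rule generate_ring.incl) auto

lemma gen_subalgebra_props:
  assumes "S \<subseteq> carrier A"
  shows gen_subalgebra_vsub: "vsub (gen_subalgebra A S)"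
    and gen_subalgebra_one: "\<one> \<in> gen_subalgebra A S"
    and gen_subalgebra_mult: "\<And>x y. x \<in> gen_subalgebra A S \<Longrightarrow> y \<in> gen_subalgebra A S \<Longrightarrow>
      x \<otimes> y \<in> gen_subalgebra A S"
    and gen_subalgebra_subring: "subring (gen_subalgebra A S) A"
    and gen_subalgebra_scal: "\<And>c. scal A c \<in> gen_subalgebra A S"
proof -
  show sr: "subring (gen_subalgebra A S) A"
    unfolding gen_subalgebra_def using assms by (intro generate_ring_is_subring) auto
  show 1: "\<And>c. scal A c \<in> gen_subalgebra A S"
    unfolding gen_subalgebra_def by (rule generate_ring.incl) auto
  show 2: "\<And>x y. x \<in> gen_subalgebra A S \<Longrightarrow> y \<in> gen_subalgebra A S \<Longrightarrow>
      x \<otimes> y \<in> gen_subalgebra A S"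
    unfolding gen_subalgebra_def by (rule generate_ring.eng_mult)
  show "vsub (gen_subalgebra A S)" unfolding vsub_def
    using subringE[OF sr] 1 2 by auto
  show "\<one> \<in> gen_subalgebra A S" using subringE[OF sr] by auto
qed

lemma gen_subalgebra_minimal:
  assumes "vsub V" "\<one> \<in> V" "\<And>x y. x \<in> V \<Longrightarrow> y \<in> V \<Longrightarrow> x \<otimes> y \<in> V" "S \<subseteq> V"
  shows "gen_subalgebra A S \<subseteq> V"
proof
  have sc: "scal A c \<in> V" for c using vsub_scal[OF assms(1,2), of c] by simp
  fix x assume "x \<in> gen_subalgebra A S"
  then show "x \<in> V" unfolding gen_subalgebra_def
    by (induction rule: generate_ring.induct)
      (use assms sc in \<open>auto simp: vsub_a_inv vsub_add\<close>)
qed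

lemma lin_comb_superset:
  assumes "\<And>x. v x \<in> carrier A" "finite S" "supp a \<subseteq> S"
  shows "lin_comb A v a = (\<Oplus>x\<in>S. scal A (coef a x) \<otimes> v x)"
  unfolding lin_comb_def
  using assms by (intro add.finprod_mono_neutral_cong_left) (auto simp: in_keys_iff)

section \<open>Linear maps into an algebra and evaluation of noncommutative polynomials\<close>

definition linto :: "(('b \<Rightarrow>\<^sub>0 'k) \<Rightarrow> 'a) \<Rightarrow> bool" where
  "linto f \<longleftrightarrow> (\<forall>x. f x \<in> carrier A) \<and> (\<forall>x y. f (x + y) = f x \<oplus> f y) \<and>
     (\<forall>c x. f (c \<cdot> x) = scal A c \<otimes> f x)"

lemma linto_closed: "linto f \<Longrightarrow> f x \<in> carrier A"
  and linto_add: "linto f \<Longrightarrow> f (x + y) = f x \<oplus> f y"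
  and linto_scale: "linto f \<Longrightarrow> f (c \<cdot> x) = scal A c \<otimes> f x"
  by (simp_all add: linto_def)

lemma linto_zero: "linto f \<Longrightarrow> f 0 = \<zero>"
  using linto_scale[of f 0 0] linto_closed[of f 0] by simp

lemma linto_uminus: "linto f \<Longrightarrow> f (- x) = \<ominus> f x"
  using linto_scale[of f "- 1" x] by (simp add: pm.scale_minus_left scal_uminus_mult linto_closed)

lemma linto_diff: "linto f \<Longrightarrow> f (x - y) = f x \<ominus> f y"
  using linto_add[of f x "- y"] by (simp add: linto_uminus a_minus_def)

lemma linto_compose: "linto f \<Longrightarrow> lin g \<Longrightarrow> linto (\<lambda>x. f (g x))"
  by (simp add: linto_def lin_add lin_scale)

lemma linto_mult_left: "linto f \<Longrightarrow> y \<in> carrier A \<Longrightarrow> linto (\<lambda>x. y \<otimes> f x)"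
  by (simp add: linto_def r_distr scal_left_commute)

lemma linto_mult_right: "linto f \<Longrightarrow> y \<in> carrier A \<Longrightarrow> linto (\<lambda>x. f x \<otimes> y)"
  by (simp add: linto_def l_distr m_assoc)

lemma linto_sum: "finite S \<Longrightarrow> linto f \<Longrightarrow> f (\<Sum>s\<in>S. g s) = (\<Oplus>s\<in>S. f (g s))"
proof (induction S rule: finite_induct)
  case empty then show ?case by (simp add: linto_zero)
next
  case (insert s S)
  then show ?case by (subst finsum_insert) (auto simp: linto_add linto_closed)
qed

lemma linto_lin_comb:
  assumes "\<And>x. v x \<in> carrier A"
  shows "linto (lin_comb A v)"
proof -
  have cl: "lin_comb A v x \<in> carrier A" for x
    unfolding lin_comb_def using assms by (intro finsum_closed) auto
  have add: "lin_comb A v (x + y) = lin_comb A v x \<oplus> lin_comb A v y" for x y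
  proof -
    let ?S = "supp x \<union> supp y"
    have S: "supp (x + y) \<subseteq> ?S" by (rule Poly_Mapping.keys_add)
    have "lin_comb A v (x + y) = (\<Oplus>b\<in>?S. scal A (coef x b) \<otimes> v b \<oplus> scal A (coef y b) \<otimes> v b)"
      using lin_comb_superset[of v ?S "x + y"] S assms by (simp add: lookup_add scal_add l_distr)
    also have "\<dots> = (\<Oplus>b\<in>?S. scal A (coef x b) \<otimes> v b) \<oplus> (\<Oplus>b\<in>?S. scal A (coef y b) \<otimes> v b)"
      using assms by (intro finsum_addf) auto
    also have "\<dots> = lin_comb A v x \<oplus> lin_comb A v y"
      using lin_comb_superset[of v ?S x] lin_comb_superset[of v ?S y] assms by simp
    finally show ?thesis .
  qed
  have "lin_comb A v (c \<cdot> x) = scal A c \<otimes> lin_comb A v x" for c x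
  proof -
    have "supp (c \<cdot> x) \<subseteq> supp x" by (auto simp: in_keys_iff)
    then have "lin_comb A v (c \<cdot> x) = (\<Oplus>b\<in>supp x. scal A c \<otimes> (scal A (coef x b) \<otimes> v b))"
      using lin_comb_superset[of v "supp x" "c \<cdot> x"] assms by (simp add: scal_scal)
    also have "\<dots> = scal A c \<otimes> (\<Oplus>b\<in>supp x. scal A (coef x b) \<otimes> v b)"
      using assms by (intro finsum_rdistr[symmetric]) auto
    finally show ?thesis by (simp add: lin_comb_def)
  qed
  with cl add show ?thesis by (simp add: linto_def)
qed

lemma lin_comb_sing:
  assumes "v x \<in> carrier A" shows "lin_comb A v (sing x c) = scal A c \<otimes> v x"
  using assms by (cases "c = 0") (simp_all add: lin_comb_def)

lemma linto_eq_lin_comb: "linto f \<Longrightarrow> f x = lin_comb A (\<lambda>b. f (sing b 1)) x"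
proof -
  assume f: "linto f"
  have "f x = f (\<Sum>b\<in>supp x. coef x b \<cdot> sing b 1)"
    using lext_expand[of x] by (simp add: lext_def)
  also have "\<dots> = (\<Oplus>b\<in>supp x. f (coef x b \<cdot> sing b 1))" by (rule linto_sum[OF _ f]) simp
  also have "\<dots> = (\<Oplus>b\<in>supp x. scal A (coef x b) \<otimes> f (sing b 1))"
    by (simp only: linto_scale[OF f])
  finally show ?thesis by (simp add: lin_comb_def)
qed

lemma linto_eqI:
  "linto f \<Longrightarrow> linto g \<Longrightarrow> (\<And>b. f (sing b 1) = g (sing b 1)) \<Longrightarrow> f x = g x"
  using linto_eq_lin_comb[of f x] linto_eq_lin_comb[of g x] by simp

lemma vsub_image: "linto f \<Longrightarrow> pm.subspace S \<Longrightarrow> vsub (f ` S)"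
  unfolding vsub_def using linto_closed[of f] linto_zero[of f]
  by (auto simp: pm.subspace_def image_iff simp flip: linto_add linto_scale) metis

lemma linto_into:
  assumes "linto f" "vsub V" "x \<in> on B" "\<And>b. b \<in> B \<Longrightarrow> f (sing b 1) \<in> V"
  shows "f x \<in> V"
  unfolding linto_eq_lin_comb[OF assms(1), of x] lin_comb_def
  using assms by (intro vsub_finsum vsub_scal) (auto simp: on_def)

lemma list_prod_closed: "set xs \<subseteq> carrier A \<Longrightarrow> list_prod A xs \<in> carrier A"
  by (induction xs) (auto simp: list_prod_def)

lemma list_prod_Nil [simp]: "list_prod A [] = \<one>"
  and list_prod_Cons [simp]: "list_prod A (x # xs) = x \<otimes> list_prod A xs"
  by (simp_all add: list_prod_def)

lemma list_prod_append: "set xs \<subseteq> carrier A \<Longrightarrow> set ys \<subseteq> carrier A \<Longrightarrow>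
    list_prod A (xs @ ys) = list_prod A xs \<otimes> list_prod A ys"
  by (induction xs) (auto simp: list_prod_closed m_assoc)

context
  fixes v :: "'g \<Rightarrow> 'a"
  assumes v: "\<And>g. v g \<in> carrier A"
begin

lemma word_prod_closed: "list_prod A (map v gs) \<in> carrier A"
  by (rule list_prod_closed) (use v in auto)

lemma linto_nc_eval: "linto (nc_eval A v)"
  unfolding nc_eval_def by (rule linto_lin_comb) (rule word_prod_closed)

lemma nc_eval_sing: "nc_eval A v (sing w c) = scal A c \<otimes> list_prod A (map v (letters w))"
  unfolding nc_eval_def by (rule lin_comb_sing) (rule word_prod_closed)

lemma nc_eval_closed: "nc_eval A v p \<in> carrier A"
  by (rule linto_closed[OF linto_nc_eval])

lemma nc_eval_letter: "nc_eval A v (letter g) = v g"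
  by (simp add: letter_def nc_eval_sing v)

lemma nc_eval_scal: "nc_eval A v (sing 0 c) = scal A c"
  by (simp add: nc_eval_sing zero_word_def)

lemma nc_eval_one: "nc_eval A v 1 = \<one>"
  using nc_eval_scal[of 1] by simp

text \<open>Both sides are linear in each factor, so only products of two words matter, and these
  are concatenations; the two factors are reduced one after the other.\<close>

lemma nc_eval_mult: "nc_eval A v (p * q) = nc_eval A v p \<otimes> nc_eval A v q"
proof -
  have "nc_eval A v (sing a 1 * sing b 1) = nc_eval A v (sing a 1) \<otimes> nc_eval A v (sing b 1)" for a b
    by (simp add: mult_single nc_eval_sing word_prod_closed plus_word_def list_prod_append v image_subset_iff)
  then have "nc_eval A v (sing a 1 * q) = nc_eval A v (sing a 1) \<otimes> nc_eval A v q" for a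
    by (rule linto_eqI[OF linto_compose[OF linto_nc_eval lin_mult_left]
        linto_mult_left[OF linto_nc_eval nc_eval_closed]])
  then show ?thesis
    by (rule linto_eqI[OF linto_compose[OF linto_nc_eval lin_mult_right]
        linto_mult_right[OF linto_nc_eval nc_eval_closed]])
qed

text \<open>Gives every element of a generated subalgebra a preimage in a free algebra; this is how
  \<open>U_plus\<close> and \<open>G_minus\<close> become explicit.\<close>

lemma gen_subalgebra_range: "gen_subalgebra A (range v) = range (nc_eval A v)"
proof
  show "gen_subalgebra A (range v) \<subseteq> range (nc_eval A v)"
  proof (rule gen_subalgebra_minimal)
    show "vsub (range (nc_eval A v))"
      using vsub_image[OF linto_nc_eval, of UNIV] by (simp add: pm.subspace_UNIV)
    show "\<one> \<in> range (nc_eval A v)" using nc_eval_one by (metis rangeI)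
    show "x \<otimes> y \<in> range (nc_eval A v)"
      if "x \<in> range (nc_eval A v)" "y \<in> range (nc_eval A v)" for x y
      using that by (auto simp flip: nc_eval_mult)
    show "range v \<subseteq> range (nc_eval A v)" using nc_eval_letter by (metis image_subsetI rangeI)
  qed
  have c: "range v \<subseteq> carrier A" using v by auto
  have "nc_eval A v p \<in> gen_subalgebra A (range v)" for p
  proof (rule linto_into[OF linto_nc_eval gen_subalgebra_vsub[OF c], of _ UNIV])
    fix w
    have "list_prod A (map v gs) \<in> gen_subalgebra A (range v)" for gs
      by (induction gs) (auto simp: gen_subalgebra_one gen_subalgebra_mult gen_subalgebra_base c)
    then show "nc_eval A v (sing w 1) \<in> gen_subalgebra A (range v)"
      by (simp add: nc_eval_sing word_prod_closed)
  qed (simp add: on_def)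
  then show "range (nc_eval A v) \<subseteq> gen_subalgebra A (range v)" by auto
qed

end

text \<open>Two candidates differ by an element of V, and also by an element of W since both are
  congruent to x modulo W. So the description is unique once V and W meet in zero.\<close>

lemma proj_along_eq:
  assumes "vsub V" "vsub W" "V \<inter> W \<subseteq> {\<zero>}" "x \<in> carrier A" "y \<in> V" "x \<ominus> y \<in> W"
  shows "proj_along A V W x = y"
  unfolding proj_along_def
proof (rule the_equality)
  show "y \<in> V \<and> x \<ominus> y \<in> W" using assms by simp
next
  fix z assume z: "z \<in> V \<and> x \<ominus> z \<in> W"
  have cz: "z \<in> carrier A" and cy: "y \<in> carrier A" using z assms vsub_carrier by auto
  have "(x \<ominus> y) \<ominus> (x \<ominus> z) = z \<ominus> y" using assms(4) cz cy
    by (simp add: a_minus_def minus_add a_ac a_lcomm[of x z] r_neg2)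
  then have "z \<ominus> y \<in> V \<inter> W" using z assms vsub_minus by (metis IntI)
  then have "z \<ominus> y = \<zero>" using assms(3) by auto
  then show "z = y" using cz cy by (simp add: r_right_minus_eq)
qed

end

lemma nc_eval_hom:
  assumes "kalg A" "kalg B" "h \<in> ring_hom A B" "\<And>c. h (scal A c) = scal B c"
    and v: "\<And>g. v g \<in> carrier A"
  shows "h (nc_eval A v p) = nc_eval B (\<lambda>g. h (v g)) p"
proof -
  interpret A: kalg A by fact
  interpret B: kalg B by fact
  have hv: "h (v g) \<in> carrier B" for g using ring_hom_closed[OF assms(3)] v by auto
  have "B.linto (\<lambda>p. h (nc_eval A v p))"
    unfolding B.linto_def using A.linto_nc_eval[of v, OF v] assms A.nc_eval_closed[of v, OF v]
    by (auto simp: A.linto_add A.linto_scale ring_hom_add ring_hom_mult ring_hom_closed)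
  moreover
  have "h (list_prod A (map v gs)) = list_prod B (map (\<lambda>g. h (v g)) gs)" for gs
    by (induction gs) (use assms v in \<open>auto simp: ring_hom_one ring_hom_mult A.word_prod_closed\<close>)
  then have "h (nc_eval A v (sing w 1)) = nc_eval B (\<lambda>g. h (v g)) (sing w 1)" for w
    using assms A.nc_eval_sing[of v, OF v] B.nc_eval_sing[of "\<lambda>g. h (v g)", OF hv]
      A.word_prod_closed[of v, OF v] B.word_prod_closed[of "\<lambda>g. h (v g)", OF hv] by simp
  ultimately show ?thesis
    using B.linto_eqI[OF _ B.linto_nc_eval[of "\<lambda>g. h (v g)", OF hv]] by blast
qed

lemma free_algebra_simps [simp]:
  "carrier free_algebra = UNIV" "mult free_algebra = (*)" "one free_algebra = 1"
  "zero free_algebra = 0" "add free_algebra = (+)" "scal free_algebra = (\<lambda>c. sing 0 c)"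
  by (simp_all add: free_algebra_def)

lemma kalg_free: "kalg (free_algebra :: (('g, 'k::field) nc_poly, 'k) kalgebra)"
proof -
  have inv: "\<exists>y. x + y = 0" for x :: "('g, 'k) nc_poly"
    by (rule exI[of _ "- x"]) simp
  have "ring (free_algebra :: (('g, 'k) nc_poly, 'k) kalgebra)"
    by (intro ringI abelian_groupI monoidI)
      (simp_all add: inv mult.assoc add.assoc add.commute distrib_left distrib_right)
  then interpret ring "free_algebra :: (('g, 'k) nc_poly, 'k) kalgebra" .
  show ?thesis
    by unfold_locales (simp_all add: single_add mult_single, rule sing_zero_central)
qed

lemma free_a_inv [simp]: "a_inv free_algebra x = - x"
proof -
  interpret kalg "free_algebra :: (('g, 'k::field) nc_poly, 'k) kalgebra" by (rule kalg_free)
  show ?thesis using minus_equality[of "- x" x] by simp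
qed

lemma free_linto: "kalg.linto free_algebra f \<longleftrightarrow> lin f"
  by (simp add: kalg.linto_def[OF kalg_free] lin_def pscale_mult)

lemma nc_eval_free_lin: "lin (nc_eval free_algebra v)"
  using kalg.linto_nc_eval[OF kalg_free, of v] by (simp add: free_linto)

lemma nc_eval_free_mult: "nc_eval free_algebra v (p * q) = nc_eval free_algebra v p * nc_eval free_algebra v q"
  using kalg.nc_eval_mult[OF kalg_free, of v] by simp

lemma nc_eval_free_one: "nc_eval free_algebra v 1 = 1"
  using kalg.nc_eval_one[OF kalg_free, of v] by simp

lemma nc_eval_free_letter: "nc_eval free_algebra v (letter g) = v g"
  using kalg.nc_eval_letter[OF kalg_free, of v] by simp

lemma alg_quot_simps:
  "carrier (alg_quot A J) = carrier (A Quot J)" "mult (alg_quot A J) = mult (A Quot J)"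
  "one (alg_quot A J) = one (A Quot J)" "zero (alg_quot A J) = zero (A Quot J)"
  "add (alg_quot A J) = add (A Quot J)" "scal (alg_quot A J) = (\<lambda>c. J +>\<^bsub>A\<^esub> scal A c)"
  by (simp_all add: alg_quot_def ring.extend_def kalgebra.fields_def)

lemma alg_quot_ring_hom:
  "ideal J A \<Longrightarrow> (+>\<^bsub>A\<^esub>) J \<in> ring_hom A (alg_quot A J)"
  using ideal.rcos_ring_hom[of J A] by (simp add: ring_hom_def alg_quot_simps)

text \<open>\<open>ring.extend\<close> makes the quotient a different record from
  \<open>A Quot J\<close>, so the ring axioms are carried over field by field; centrality of scalars
  is lifted to representatives.\<close>

lemma kalg_alg_quot:
  assumes "kalg A" "ideal J A" shows "kalg (alg_quot A J)"
proof -
  interpret A: kalg A by fact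
  interpret J: ideal J A by fact
  interpret Q: ring "A Quot J" by (rule J.quotient_is_ring)
  have "ring (alg_quot A J)"
  proof (rule ringI)
    show "abelian_group (alg_quot A J)"
    proof (rule abelian_groupI)
      fix x assume "x \<in> carrier (alg_quot A J)"
      then show "\<exists>y\<in>carrier (alg_quot A J). y \<oplus>\<^bsub>alg_quot A J\<^esub> x = \<zero>\<^bsub>alg_quot A J\<^esub>"
        by (intro bexI[of _ "\<ominus>\<^bsub>A Quot J\<^esub> x"]) (simp_all add: alg_quot_simps Q.l_neg)
    qed (simp_all add: alg_quot_simps Q.a_ac)
    show "Group.monoid (alg_quot A J)"
      by (rule monoidI) (auto simp: alg_quot_simps Q.m_assoc)
  qed (auto simp: alg_quot_simps Q.l_distr Q.r_distr)
  then interpret R: ring "alg_quot A J" .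
  note h = alg_quot_ring_hom[OF assms(2)]
  have sc: "scal (alg_quot A J) c = J +>\<^bsub>A\<^esub> scal A c" for c by (simp add: alg_quot_simps)
  show ?thesis
  proof unfold_locales
    fix x c assume "x \<in> carrier (alg_quot A J)"
    then obtain y where y: "y \<in> carrier A" "x = J +>\<^bsub>A\<^esub> y"
      by (auto simp: alg_quot_simps FactRing_simps)
    show "x \<otimes>\<^bsub>alg_quot A J\<^esub> scal (alg_quot A J) c = scal (alg_quot A J) c \<otimes>\<^bsub>alg_quot A J\<^esub> x"
      unfolding sc y(2) using y(1) by (simp add: ring_hom_mult[OF h, symmetric] A.scal_central)
  qed (simp_all add: sc ring_hom_closed[OF h] ring_hom_add[OF h] ring_hom_mult[OF h] ring_hom_one[OF h]
      A.scal_add A.scal_mult)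
qed

section \<open>The associated graded algebra of a filtered algebra\<close>

context kalg
begin

lemma vsub_abelian_subgroup: "vsub V \<Longrightarrow> abelian_subgroup V A"
  using vsub_a_inv[of V]
  by (intro abelian_subgroupI3 additive_subgroupI add.subgroupI abelian_group_axioms)
    (auto simp: vsub_def a_inv_def)

lemma coset_mem: "vsub V \<Longrightarrow> x \<in> carrier A \<Longrightarrow> z \<in> V +> x \<longleftrightarrow> z \<in> carrier A \<and> z \<ominus> x \<in> V"
  by (metis vsub_abelian_subgroup abelian_subgroup.a_rcos_module_minus
      abelian_subgroup.a_elemrcos_carrier ring_axioms)

lemma coset_eq:
  "vsub V \<Longrightarrow> x \<in> carrier A \<Longrightarrow> y \<in> carrier A \<Longrightarrow> V +> x = V +> y \<longleftrightarrow> x \<ominus> y \<in> V"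
  by (metis vsub_abelian_subgroup abelian_subgroup.a_repr_independence'
      abelian_subgroup.a_repr_independenceD coset_mem)

lemma coset_zero: "vsub V \<Longrightarrow> V +> \<zero> = V"
  by (simp add: abelian_subgroup.a_rcos_const vsub_abelian_subgroup vsub_zero)

lemma coset_self: "vsub V \<Longrightarrow> x \<in> carrier A \<Longrightarrow> x \<in> V +> x"
  by (simp add: coset_mem vsub_zero r_neg a_minus_def)

lemma coset_plus: "vsub V \<Longrightarrow> x \<in> carrier A \<Longrightarrow> y \<in> carrier A \<Longrightarrow>
    (V +> x) <+> (V +> y) = V +> (x \<oplus> y)"
  by (simp add: abelian_subgroup.a_rcos_sum vsub_abelian_subgroup)

lemma coset_eq_self: "vsub V \<Longrightarrow> x \<in> carrier A \<Longrightarrow> V +> x = V \<longleftrightarrow> x \<in> V"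
  using coset_eq[of V x \<zero>] by (simp add: coset_zero a_minus_def)

lemma convolution_assoc:
  assumes "\<And>i. a i \<in> carrier A" "\<And>i. b i \<in> carrier A" "\<And>i. c i \<in> carrier A"
  shows "(\<Oplus>j\<in>{..n::nat}. (\<Oplus>i\<in>{..j}. a i \<otimes> b (j - i)) \<otimes> c (n - j)) =
         (\<Oplus>j\<in>{..n}. a j \<otimes> (\<Oplus>i\<in>{..n - j}. b i \<otimes> c (n - j - i)))"
proof -
  \<comment> \<open>Truncated at \<open>n\<close>, the three sequences are polynomials over \<open>A\<close>, whose product is associative.\<close>
  interpret U: UP_ring A "UP A" by unfold_locales
  define t where "t = (\<lambda>f i. if i \<le> n then f i else \<zero>)"
  have up: "t f \<in> up A" if "\<And>i. f i \<in> carrier A" for f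
    using that by (intro mem_upI exI[of _ n]) (auto simp: t_def bound_def)
  note ups = up[of a, OF assms(1)] up[of b, OF assms(2)] up[of c, OF assms(3)]
  have tc: "t f i \<in> carrier A" if "\<And>i. f i \<in> carrier A" for f i
    using that by (auto simp: t_def)
  note tcs = tc[of a, OF assms(1)] tc[of b, OF assms(2)] tc[of c, OF assms(3)]
  have m: "p \<otimes>\<^bsub>UP A\<^esub> q = (\<lambda>n. \<Oplus>i\<in>{..n}. p i \<otimes> q (n - i))" if "p \<in> up A" "q \<in> up A" for p q
    using that by (simp add: UP_def)
  have cl: "p \<otimes>\<^bsub>UP A\<^esub> q \<in> up A" if "p \<in> up A" "q \<in> up A" for p q
    using U.m_closed[of p q] that by (simp add: UP_def)
  have "(t a \<otimes>\<^bsub>UP A\<^esub> t b) \<otimes>\<^bsub>UP A\<^esub> t c = t a \<otimes>\<^bsub>UP A\<^esub> (t b \<otimes>\<^bsub>UP A\<^esub> t c)"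
    using U.UP_m_assoc[of "t a" "t b" "t c"] ups by (simp add: UP_def)
  then have "((t a \<otimes>\<^bsub>UP A\<^esub> t b) \<otimes>\<^bsub>UP A\<^esub> t c) n = (t a \<otimes>\<^bsub>UP A\<^esub> (t b \<otimes>\<^bsub>UP A\<^esub> t c)) n"
    by simp
  then have "(\<Oplus>j\<in>{..n}. (t a \<otimes>\<^bsub>UP A\<^esub> t b) j \<otimes> t c (n - j)) =
      (\<Oplus>j\<in>{..n}. t a j \<otimes> (t b \<otimes>\<^bsub>UP A\<^esub> t c) (n - j))"
    unfolding m[OF cl[OF ups(1,2)] ups(3)] m[OF ups(1) cl[OF ups(2,3)]] .
  then have "(\<Oplus>j\<in>{..n}. (\<Oplus>i\<in>{..j}. t a i \<otimes> t b (j - i)) \<otimes> t c (n - j)) =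
         (\<Oplus>j\<in>{..n}. t a j \<otimes> (\<Oplus>i\<in>{..n - j}. t b i \<otimes> t c (n - j - i)))"
    unfolding m[OF ups(1,2)] m[OF ups(2,3)] .
  moreover have "(\<Oplus>j\<in>{..n}. (\<Oplus>i\<in>{..j}. t a i \<otimes> t b (j - i)) \<otimes> t c (n - j)) =
      (\<Oplus>j\<in>{..n::nat}. (\<Oplus>i\<in>{..j}. a i \<otimes> b (j - i)) \<otimes> c (n - j))"
  proof (rule finsum_cong')
    fix j assume j: "j \<in> {..n}"
    then have "(\<Oplus>i\<in>{..j}. t a i \<otimes> t b (j - i)) = (\<Oplus>i\<in>{..j}. a i \<otimes> b (j - i))"
      using assms by (intro finsum_cong') (auto simp: t_def)
    then show "(\<Oplus>i\<in>{..j}. t a i \<otimes> t b (j - i)) \<otimes> t c (n - j) =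
        (\<Oplus>i\<in>{..j}. a i \<otimes> b (j - i)) \<otimes> c (n - j)" using j by (simp add: t_def)
  qed (use assms in auto)
  moreover have "(\<Oplus>j\<in>{..n}. t a j \<otimes> (\<Oplus>i\<in>{..n - j}. t b i \<otimes> t c (n - j - i))) =
      (\<Oplus>j\<in>{..n}. a j \<otimes> (\<Oplus>i\<in>{..n - j}. b i \<otimes> c (n - j - i)))"
  proof (rule finsum_cong')
    fix j assume j: "j \<in> {..n}"
    then have "(\<Oplus>i\<in>{..n - j}. t b i \<otimes> t c (n - j - i)) = (\<Oplus>i\<in>{..n - j}. b i \<otimes> c (n - j - i))"
      using assms by (intro finsum_cong') (auto simp: t_def)
    then show "t a j \<otimes> (\<Oplus>i\<in>{..n - j}. t b i \<otimes> t c (n - j - i)) =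
        a j \<otimes> (\<Oplus>i\<in>{..n - j}. b i \<otimes> c (n - j - i))" using j by (simp add: t_def)
  qed (use assms in auto)
  ultimately show ?thesis by simp
qed

end

locale filtered = kalg A for A :: "('a, 'k::field) kalgebra" (structure) +
  fixes Fl :: "nat \<Rightarrow> 'a set"
  assumes Fl_vsub: "vsub (Fl m)"
    and Fl_mono: "Fl m \<subseteq> Fl (Suc m)"
    and Fl_mult: "x \<in> Fl i \<Longrightarrow> y \<in> Fl j \<Longrightarrow> x \<otimes> y \<in> Fl (i + j)"
    and Fl_one: "\<one> \<in> Fl 0"
begin

abbreviation "P \<equiv> prev_step A Fl"
abbreviation "Gr \<equiv> assoc_graded A Fl"
abbreviation "gr \<equiv> gr_class A Fl"

lemma vsub_P: "vsub (P m)"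
  by (auto simp: prev_step_def Fl_vsub) (simp add: vsub_def)

lemma P_Fl: "x \<in> P m \<Longrightarrow> x \<in> Fl m"
  using Fl_mono[of "m - 1"] vsub_zero[OF Fl_vsub] by (auto simp: prev_step_def split: if_splits)

lemma Fl_carrier: "x \<in> Fl m \<Longrightarrow> x \<in> carrier A"
  using vsub_carrier[OF Fl_vsub] .

lemma P_carrier: "x \<in> P m \<Longrightarrow> x \<in> carrier A"
  using vsub_carrier[OF vsub_P] .

text \<open>The case of degree zero is separate, because there \<open>P\<close> is the zero space
  and not a step of the filtration.\<close>

lemma P_mult_left: "x \<in> P i \<Longrightarrow> y \<in> Fl j \<Longrightarrow> x \<otimes> y \<in> P (i + j)"
  using Fl_mult[of x "i - 1" y j] vsub_zero[OF vsub_P] Fl_carrier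
  by (cases i) (auto simp: prev_step_def)

lemma P_mult_right: "x \<in> Fl i \<Longrightarrow> y \<in> P j \<Longrightarrow> x \<otimes> y \<in> P (i + j)"
  using Fl_mult[of x i y "j - 1"] vsub_zero[OF vsub_P] Fl_carrier
  by (cases j) (auto simp: prev_step_def)

lemma Gr_simps:
  "carrier Gr = {f. (\<forall>m. \<exists>x\<in>Fl m. f m = P m +> x) \<and> finite {m. f m \<noteq> P m}}"
  "zero Gr = P" "one Gr = gr 0 \<one>" "add Gr = (\<lambda>f g m. f m <+> g m)"
  "mult Gr = (\<lambda>f g m. \<Union>a\<in>Pi UNIV f. \<Union>b\<in>Pi UNIV g. P m +> (\<Oplus>i\<in>{..m}. a i \<otimes> b (m - i)))"
  "scal Gr c = gr 0 (scal A c)"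
  by (simp_all add: assoc_graded_def)

definition rep :: "(nat \<Rightarrow> 'a set) \<Rightarrow> nat \<Rightarrow> 'a" where
  "rep f m = (SOME x. x \<in> Fl m \<and> f m = P m +> x)"

lemma rep:
  assumes "f \<in> carrier Gr"
  shows rep_Fl: "rep f m \<in> Fl m" and rep_coset: "f m = P m +> rep f m"
    and rep_carrier: "rep f m \<in> carrier A" and rep_mem: "rep f m \<in> f m"
proof -
  have "\<exists>x. x \<in> Fl m \<and> f m = P m +> x" using assms by (auto simp: Gr_simps)
  from someI_ex[OF this] show *: "rep f m \<in> Fl m" "f m = P m +> rep f m"
    by (auto simp: rep_def)
  then show c: "rep f m \<in> carrier A" using Fl_carrier by auto
  show "rep f m \<in> f m" by (subst *(2)) (rule coset_self[OF vsub_P c])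
qed

lemma mem_Fl:
  assumes "f \<in> carrier Gr" "x \<in> f m" shows "x \<in> Fl m"
proof -
  have c: "rep f m \<in> carrier A" using assms(1) by (rule rep_carrier)
  have x: "x \<in> carrier A" "x \<ominus> rep f m \<in> P m"
    using assms(2) coset_mem[OF vsub_P c] rep_coset[OF assms(1), of m] by auto
  then have "(x \<ominus> rep f m) \<oplus> rep f m \<in> Fl m"
    using P_Fl rep_Fl[OF assms(1)] vsub_add[OF Fl_vsub] by blast
  then show ?thesis using x c by (simp add: a_minus_def a_assoc l_neg)
qed

lemma mem_coset:
  assumes "f \<in> carrier Gr" "x \<in> f m" shows "f m = P m +> x"
proof -
  have c: "rep f m \<in> carrier A" using assms(1) by (rule rep_carrier)
  have x: "x \<in> P m +> rep f m" using assms(2) rep_coset[OF assms(1), of m] by auto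
  show ?thesis using abelian_subgroup.a_repr_independence'[OF vsub_abelian_subgroup[OF vsub_P] x c]
      rep_coset[OF assms(1), of m] by simp
qed

lemma Gr_memI:
  assumes "\<And>m. x m \<in> Fl m" "\<And>m. f m = P m +> x m" "\<And>m. m > M \<Longrightarrow> x m \<in> P m"
  shows "f \<in> carrier Gr"
proof -
  have "{m. f m \<noteq> P m} \<subseteq> {..M}"
  proof
    fix m assume "m \<in> {m. f m \<noteq> P m}"
    then have "x m \<notin> P m"
      using assms(2)[of m] coset_eq_self[OF vsub_P P_carrier, of "x m" m m] by auto
    then show "m \<in> {..M}" using assms(3)[of m] by (simp add: not_less[symmetric]) blast
  qed
  then have "finite {m. f m \<noteq> P m}" by (rule finite_subset) simp
  moreover have "\<exists>y\<in>Fl m. f m = P m +> y" for m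
    using assms(1,2) by blast
  ultimately show ?thesis by (simp add: Gr_simps)
qed

lemma Gr_bound:
  assumes "f \<in> carrier Gr" obtains M where "\<And>m x. m > M \<Longrightarrow> x \<in> f m \<Longrightarrow> x \<in> P m"
proof -
  have fin: "finite {m. f m \<noteq> P m}" using assms by (simp add: Gr_simps)
  then obtain M where M: "\<And>m. m \<in> {m. f m \<noteq> P m} \<Longrightarrow> m \<le> M"
    by (meson finite_nat_set_iff_bounded_le)
  show ?thesis by (rule that[of M]) (use M in force)
qed

text \<open>Cosets of one subgroup that share an element coincide. Identities in \<open>Gr\<close>
  are proved by exhibiting a common representative in each degree, which reduces them to identities
  in the filtered algebra.\<close>

lemma Gr_eqI: "f \<in> carrier Gr \<Longrightarrow> g \<in> carrier Gr \<Longrightarrow> (\<And>m. \<exists>x. x \<in> f m \<and> x \<in> g m) \<Longrightarrow> f = g"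
  by (rule ext) (metis mem_coset)

lemma gr_mem: "x \<in> Fl m \<Longrightarrow> (if l = m then x else \<zero>) \<in> gr m x l"
  by (auto simp: gr_class_def coset_self[OF vsub_P] Fl_carrier vsub_zero[OF vsub_P])

lemma gr_closed: "x \<in> Fl m \<Longrightarrow> gr m x \<in> carrier Gr"
  by (rule Gr_memI[where x = "\<lambda>l. if l = m then x else \<zero>" and M = m])
    (auto simp: gr_class_def coset_zero[OF vsub_P] vsub_zero[OF Fl_vsub] vsub_zero[OF vsub_P])

lemma zero_Gr_closed: "zero Gr \<in> carrier Gr"
  by (rule Gr_memI[where x = "\<lambda>_. \<zero>" and M = 0])
    (auto simp: Gr_simps coset_zero[OF vsub_P] vsub_zero[OF vsub_P] vsub_zero[OF Fl_vsub])

lemma gr_zero: "x \<in> P m \<Longrightarrow> gr m x = zero Gr"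
  by (rule ext) (auto simp: gr_class_def Gr_simps coset_eq_self[OF vsub_P] P_carrier)

lemma add_coset:
  assumes "f \<in> carrier Gr" "g \<in> carrier Gr" "x \<in> f m" "y \<in> g m"
  shows "add Gr f g m = P m +> (x \<oplus> y)" "x \<oplus> y \<in> add Gr f g m"
proof -
  have c: "x \<in> carrier A" "y \<in> carrier A" using assms mem_Fl Fl_carrier by blast+
  show "add Gr f g m = P m +> (x \<oplus> y)"
    using mem_coset[OF assms(1,3)] mem_coset[OF assms(2,4)] coset_plus[OF vsub_P c]
    by (simp add: Gr_simps)
  then show "x \<oplus> y \<in> add Gr f g m" using c coset_self[OF vsub_P] by simp
qed

lemma add_Gr_closed: "f \<in> carrier Gr \<Longrightarrow> g \<in> carrier Gr \<Longrightarrow> add Gr f g \<in> carrier Gr"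
proof -
  assume f: "f \<in> carrier Gr" and g: "g \<in> carrier Gr"
  obtain M N where M: "\<And>m x. m > M \<Longrightarrow> x \<in> f m \<Longrightarrow> x \<in> P m" and N: "\<And>m x. m > N \<Longrightarrow> x \<in> g m \<Longrightarrow> x \<in> P m"
    using Gr_bound[OF f] Gr_bound[OF g] by metis
  show ?thesis
    by (rule Gr_memI[where x = "\<lambda>m. rep f m \<oplus> rep g m" and M = "max M N"])
      (use f g M N in \<open>auto simp: vsub_add[OF Fl_vsub] vsub_add[OF vsub_P] rep_Fl rep_mem
        add_coset(1)[OF f g rep_mem[OF f] rep_mem[OF g]]\<close>)
qed

context
  fixes f g assumes f: "f \<in> carrier Gr" and g: "g \<in> carrier Gr"
begin

lemma convolution_Fl:
  assumes "\<And>i. a i \<in> f i" "\<And>i. b i \<in> g i"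
  shows "(\<Oplus>i\<in>{..m}. a i \<otimes> b (m - i)) \<in> Fl m"
proof (rule vsub_finsum[OF Fl_vsub])
  fix i assume "i \<in> {..m}"
  then show "a i \<otimes> b (m - i) \<in> Fl m"
    using Fl_mult[of "a i" i "b (m - i)" "m - i"] mem_Fl f g assms by auto
qed

text \<open>Each difference of products equals (a - a') b + a' (b - b') and so falls one step lower.
  This is what makes the union over all representatives in the product of \<open>Gr\<close> a single
  coset.\<close>

lemma convolution_cong:
  assumes "\<And>i. a i \<in> f i" "\<And>i. b i \<in> g i" "\<And>i. a' i \<in> f i" "\<And>i. b' i \<in> g i"
  shows "(\<Oplus>i\<in>{..m}. a i \<otimes> b (m - i)) \<ominus> (\<Oplus>i\<in>{..m}. a' i \<otimes> b' (m - i)) \<in> P m"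
proof -
  have fl: "a i \<in> Fl i" "a' i \<in> Fl i" "b i \<in> Fl i" "b' i \<in> Fl i" for i
    using assms f g mem_Fl by blast+
  note c = fl[THEN Fl_carrier]
  have d: "a i \<otimes> b j \<ominus> a' i \<otimes> b' j \<in> P (i + j)" for i j
  proof -
    have "a i \<ominus> a' i \<in> P i" "b j \<ominus> b' j \<in> P j"
      using assms mem_coset[OF f] mem_coset[OF g] coset_eq[OF vsub_P] c by metis+
    then have "(a i \<ominus> a' i) \<otimes> b j \<oplus> a' i \<otimes> (b j \<ominus> b' j) \<in> P (i + j)"
      by (intro vsub_add[OF vsub_P] P_mult_left P_mult_right fl)
    moreover have "(a i \<ominus> a' i) \<otimes> b j \<oplus> a' i \<otimes> (b j \<ominus> b' j) = a i \<otimes> b j \<ominus> a' i \<otimes> b' j"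
      using c by (simp add: a_minus_def l_distr r_distr l_minus r_minus a_assoc r_neg1)
    ultimately show ?thesis by simp
  qed
  have "(\<Oplus>i\<in>{..m}. a i \<otimes> b (m - i) \<ominus> a' i \<otimes> b' (m - i)) \<in> P m"
  proof (rule vsub_finsum[OF vsub_P])
    fix i assume "i \<in> {..m}"
    then show "a i \<otimes> b (m - i) \<ominus> a' i \<otimes> b' (m - i) \<in> P m" using d[of i "m - i"] by simp
  qed
  moreover have "(\<Oplus>i\<in>{..m}. a i \<otimes> b (m - i) \<ominus> a' i \<otimes> b' (m - i)) =
      (\<Oplus>i\<in>{..m}. a i \<otimes> b (m - i)) \<ominus> (\<Oplus>i\<in>{..m}. a' i \<otimes> b' (m - i))" (is "?L = ?R")
  proof -
    have "?L \<oplus> (\<Oplus>i\<in>{..m}. a' i \<otimes> b' (m - i)) =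
        (\<Oplus>i\<in>{..m}. a i \<otimes> b (m - i) \<ominus> a' i \<otimes> b' (m - i) \<oplus> a' i \<otimes> b' (m - i))"
      using c by (intro finsum_addf[symmetric]) auto
    also have "\<dots> = (\<Oplus>i\<in>{..m}. a i \<otimes> b (m - i))"
      using c by (intro finsum_cong') (auto simp: a_minus_def a_assoc l_neg)
    finally have e: "(\<Oplus>i\<in>{..m}. a i \<otimes> b (m - i)) = ?L \<oplus> (\<Oplus>i\<in>{..m}. a' i \<otimes> b' (m - i))" by simp
    have "?L \<in> carrier A" "(\<Oplus>i\<in>{..m}. a' i \<otimes> b' (m - i)) \<in> carrier A"
      using c by (auto intro!: finsum_closed)
    then show ?thesis unfolding e by (simp add: a_minus_def a_assoc r_neg)
  qed
  ultimately show ?thesis by simp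
qed

lemma mult_coset:
  assumes "\<And>i. a i \<in> f i" "\<And>i. b i \<in> g i"
  shows "mult Gr f g m = P m +> (\<Oplus>i\<in>{..m}. a i \<otimes> b (m - i))"
    and "(\<Oplus>i\<in>{..m}. a i \<otimes> b (m - i)) \<in> mult Gr f g m"
proof -
  let ?s = "\<lambda>a b. \<Oplus>i\<in>{..m}. a i \<otimes> b (m - i)"
  have "P m +> ?s a' b' = P m +> ?s a b" if "a' \<in> Pi UNIV f" "b' \<in> Pi UNIV g" for a' b'
  proof -
    have ab: "\<And>i. a' i \<in> f i" "\<And>i. b' i \<in> g i" using that by auto
    show ?thesis
      using coset_eq[OF vsub_P] convolution_cong[OF ab assms, of m]
        convolution_Fl[OF ab, of m] convolution_Fl[OF assms, of m] Fl_carrier by blast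
  qed
  moreover have "a \<in> Pi UNIV f" "b \<in> Pi UNIV g" using assms by auto
  ultimately show *: "mult Gr f g m = P m +> ?s a b"
    unfolding Gr_simps by blast
  show "?s a b \<in> mult Gr f g m"
    unfolding * by (rule coset_self[OF vsub_P Fl_carrier[OF convolution_Fl[OF assms]]])
qed

lemma mult_Gr_closed: "mult Gr f g \<in> carrier Gr"
proof -
  obtain M N where M: "\<And>m x. m > M \<Longrightarrow> x \<in> f m \<Longrightarrow> x \<in> P m" and N: "\<And>m x. m > N \<Longrightarrow> x \<in> g m \<Longrightarrow> x \<in> P m"
    using Gr_bound[OF f] Gr_bound[OF g] by metis
  show ?thesis
  proof (rule Gr_memI[where x = "\<lambda>m. \<Oplus>i\<in>{..m}. rep f i \<otimes> rep g (m - i)" and M = "M + N"])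
    fix m
    show "(\<Oplus>i\<in>{..m}. rep f i \<otimes> rep g (m - i)) \<in> Fl m"
      by (rule convolution_Fl) (simp_all add: rep_mem f g)
    show "mult Gr f g m = P m +> (\<Oplus>i\<in>{..m}. rep f i \<otimes> rep g (m - i))"
      by (rule mult_coset) (simp_all add: rep_mem f g)
    assume m: "M + N < m"
    show "(\<Oplus>i\<in>{..m}. rep f i \<otimes> rep g (m - i)) \<in> P m"
    proof (rule vsub_finsum[OF vsub_P])
      fix i assume i: "i \<in> {..m}"
      \<comment> \<open>The two indices add up to m > M + N, so one of them exceeds its bound and
        the corresponding factor lies a step lower.\<close>
      then consider "i > M" | "m - i > N" using m by force
      then show "rep f i \<otimes> rep g (m - i) \<in> P m"
      proof cases
        case 1 then show ?thesis using i P_mult_left[OF M[OF _ rep_mem[OF f]] rep_Fl[OF g], of i "m - i"] by simp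
      next
        case 2 then show ?thesis using i P_mult_right[OF rep_Fl[OF f] N[OF _ rep_mem[OF g]], of "m - i" i] by simp
      qed
    qed
  qed
qed

end

text \<open>Against a class concentrated in degree k the convolution has at most one nonzero term.
  For k > m the truncated difference m - k is 0 and there is no such term, hence the case
  distinction.\<close>

lemma gr_mult_coset:
  assumes x: "x \<in> Fl k" and f: "f \<in> carrier Gr" and y: "y \<in> f (m - k)"
  shows "(if k \<le> m then x \<otimes> y else \<zero>) \<in> mult Gr (gr k x) f m"
    and "(if k \<le> m then y \<otimes> x else \<zero>) \<in> mult Gr f (gr k x) m"
proof -
  let ?b = "\<lambda>i. if i = m - k then y else rep f i"
  have b: "?b i \<in> f i" for i using y rep_mem[OF f] by auto
  have bc: "?b i \<in> carrier A" for i using b mem_Fl[OF f] Fl_carrier by blast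
  have rc: "rep f i \<in> carrier A" for i using f by (rule rep_carrier)
  have c: "x \<in> carrier A" "y \<in> carrier A" using x y mem_Fl[OF f] Fl_carrier by blast+
  have "(\<Oplus>i\<in>{..m}. (if i = k then x else \<zero>) \<otimes> ?b (m - i)) =
      (\<Oplus>i\<in>{..m}. if i = k then x \<otimes> y else \<zero>)"
    using bc c rc by (intro finsum_cong') auto
  also have "\<dots> = (if k \<le> m then x \<otimes> y else \<zero>)"
    using add.finprod_singleton_swap[of k "{..m}" "\<lambda>_. x \<otimes> y"] c
      add.finprod_one_eqI[of "{..m}" "\<lambda>i. if i = k then x \<otimes> y else \<zero>"] by auto
  finally show "(if k \<le> m then x \<otimes> y else \<zero>) \<in> mult Gr (gr k x) f m"
    using mult_coset(2)[OF gr_closed[OF x] f gr_mem[OF x] b, of m] by simp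
  have "(\<Oplus>i\<in>{..m}. ?b i \<otimes> (if m - i = k then x else \<zero>)) =
      (\<Oplus>i\<in>{..m}. if i = m - k then if k \<le> m then y \<otimes> x else \<zero> else \<zero>)"
    using bc c rc by (intro finsum_cong') auto
  also have "\<dots> = (if k \<le> m then y \<otimes> x else \<zero>)"
    using add.finprod_singleton_swap[of "m - k" "{..m}" "\<lambda>_. if k \<le> m then y \<otimes> x else \<zero>"] c by auto
  finally show "(if k \<le> m then y \<otimes> x else \<zero>) \<in> mult Gr f (gr k x) m"
    using mult_coset(2)[OF f gr_closed[OF x] b gr_mem[OF x], of m] by simp
qed

lemma gr_mult: "x \<in> Fl i \<Longrightarrow> y \<in> Fl j \<Longrightarrow> mult Gr (gr i x) (gr j y) = gr (i + j) (x \<otimes> y)"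
proof (rule Gr_eqI)
  assume x: "x \<in> Fl i" and y: "y \<in> Fl j"
  then show "mult Gr (gr i x) (gr j y) \<in> carrier Gr" "gr (i + j) (x \<otimes> y) \<in> carrier Gr"
    by (simp_all add: mult_Gr_closed gr_closed Fl_mult)
  fix m
  have "(if i \<le> m then x \<otimes> (if m - i = j then y else \<zero>) else \<zero>) \<in> mult Gr (gr i x) (gr j y) m"
    by (rule gr_mult_coset(1)[OF x gr_closed[OF y] gr_mem[OF y]])
  moreover have "(if i \<le> m then x \<otimes> (if m - i = j then y else \<zero>) else \<zero>) =
      (if m = i + j then x \<otimes> y else \<zero>)" using x Fl_carrier by auto
  ultimately show "\<exists>z. z \<in> mult Gr (gr i x) (gr j y) m \<and> z \<in> gr (i + j) (x \<otimes> y) m"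
    using gr_mem[OF Fl_mult[OF x y], of m] by metis
qed

lemma gr_add: "x \<in> Fl i \<Longrightarrow> y \<in> Fl i \<Longrightarrow> add Gr (gr i x) (gr i y) = gr i (x \<oplus> y)"
proof (rule Gr_eqI)
  assume x: "x \<in> Fl i" and y: "y \<in> Fl i"
  then show "add Gr (gr i x) (gr i y) \<in> carrier Gr" "gr i (x \<oplus> y) \<in> carrier Gr"
    by (simp_all add: add_Gr_closed gr_closed vsub_add[OF Fl_vsub])
  fix m
  show "\<exists>z. z \<in> add Gr (gr i x) (gr i y) m \<and> z \<in> gr i (x \<oplus> y) m"
    using add_coset(2)[OF gr_closed[OF x] gr_closed[OF y] gr_mem[OF x] gr_mem[OF y], of m]
      gr_mem[OF vsub_add[OF Fl_vsub x y], of m]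
    by (cases "m = i") auto
qed

lemma scal_Fl: "scal A c \<in> Fl 0"
  using vsub_scal[OF Fl_vsub Fl_one, of c] by simp

lemma kalg_Gr: "kalg Gr"
proof -
  have ag: "abelian_group Gr"
  proof (rule abelian_groupI)
    fix f g h assume f: "f \<in> carrier Gr" and g: "g \<in> carrier Gr" and h: "h \<in> carrier Gr"
    show "add Gr f g \<in> carrier Gr" using f g by (rule add_Gr_closed)
    show "add Gr (add Gr f g) h = add Gr f (add Gr g h)"
    proof (rule Gr_eqI)
      fix m
      show "\<exists>x. x \<in> add Gr (add Gr f g) h m \<and> x \<in> add Gr f (add Gr g h) m"
        using add_coset(2)[OF add_Gr_closed[OF f g] h add_coset(2)[OF f g rep_mem[OF f] rep_mem[OF g]] rep_mem[OF h], of m]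
          add_coset(2)[OF f add_Gr_closed[OF g h] rep_mem[OF f] add_coset(2)[OF g h rep_mem[OF g] rep_mem[OF h]], of m]
          rep_carrier f g h by (auto simp: a_assoc)
    qed (simp_all add: add_Gr_closed f g h)
    show "add Gr f g = add Gr g f"
    proof (rule Gr_eqI)
      fix m
      show "\<exists>x. x \<in> add Gr f g m \<and> x \<in> add Gr g f m"
        using add_coset(2)[OF f g rep_mem[OF f] rep_mem[OF g], of m]
          add_coset(2)[OF g f rep_mem[OF g] rep_mem[OF f], of m] rep_carrier f g by (auto simp: a_comm)
    qed (simp_all add: add_Gr_closed f g)
  next
    fix f assume f: "f \<in> carrier Gr"
    have z: "\<zero> \<in> zero Gr m" for m by (simp add: Gr_simps vsub_zero[OF vsub_P])
    show "add Gr (zero Gr) f = f"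
    proof (rule Gr_eqI)
      fix m
      show "\<exists>x. x \<in> add Gr (zero Gr) f m \<and> x \<in> f m"
        using add_coset(2)[OF zero_Gr_closed f z rep_mem[OF f], of m] rep_mem[OF f, of m]
          rep_carrier[OF f, of m] by auto
    qed (simp_all add: add_Gr_closed f zero_Gr_closed)
    obtain M where M: "\<And>m x. m > M \<Longrightarrow> x \<in> f m \<Longrightarrow> x \<in> P m" using Gr_bound[OF f] by metis
    let ?n = "\<lambda>m. P m +> (\<ominus> rep f m)"
    have n: "?n \<in> carrier Gr"
      by (rule Gr_memI[where x = "\<lambda>m. \<ominus> rep f m" and M = M])
        (auto intro!: vsub_a_inv[OF Fl_vsub] vsub_a_inv[OF vsub_P] rep_Fl[OF f] M rep_mem[OF f])
    have nm: "\<ominus> rep f m \<in> ?n m" for m by (simp add: coset_self[OF vsub_P] rep_carrier[OF f])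
    have "add Gr ?n f = zero Gr"
    proof (rule Gr_eqI)
      fix m
      show "\<exists>x. x \<in> add Gr ?n f m \<and> x \<in> zero Gr m"
        using add_coset(2)[OF n f nm rep_mem[OF f], of m] z[of m] rep_carrier[OF f, of m]
        by (auto simp: l_neg)
    qed (simp_all add: add_Gr_closed f n zero_Gr_closed)
    then show "\<exists>y\<in>carrier Gr. add Gr y f = zero Gr" using n by blast
  qed (rule zero_Gr_closed)
  have one: "one Gr \<in> carrier Gr" using gr_closed[OF Fl_one] by (simp only: Gr_simps(3))
  have unit: "mult Gr (one Gr) f = f \<and> mult Gr f (one Gr) = f" if f: "f \<in> carrier Gr" for f
  proof
    have *: "\<one> \<otimes> rep f m \<in> mult Gr (one Gr) f m" "rep f m \<otimes> \<one> \<in> mult Gr f (one Gr) m" for m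
      using gr_mult_coset[OF Fl_one f, of "rep f m" m] rep_mem[OF f, of m] by (simp_all add: Gr_simps(3,6))
    show "mult Gr (one Gr) f = f"
      by (rule Gr_eqI[OF mult_Gr_closed[OF one f] f])
        (use * rep_mem[OF f] rep_carrier[OF f] l_one in metis)
    show "mult Gr f (one Gr) = f"
      by (rule Gr_eqI[OF mult_Gr_closed[OF f one] f])
        (use * rep_mem[OF f] rep_carrier[OF f] r_one in metis)
  qed
  have mon: "Group.monoid Gr"
  proof (rule monoidI)
    fix f g h assume f: "f \<in> carrier Gr" and g: "g \<in> carrier Gr" and h: "h \<in> carrier Gr"
    show "mult Gr (mult Gr f g) h = mult Gr f (mult Gr g h)"
    proof (rule Gr_eqI)
      fix m
      note fg = mult_coset(2)[OF f g rep_mem[OF f] rep_mem[OF g]]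
      note gh = mult_coset(2)[OF g h rep_mem[OF g] rep_mem[OF h]]
      show "\<exists>x. x \<in> mult Gr (mult Gr f g) h m \<and> x \<in> mult Gr f (mult Gr g h) m"
        using mult_coset(2)[OF mult_Gr_closed[OF f g] h fg rep_mem[OF h], of m]
          mult_coset(2)[OF f mult_Gr_closed[OF g h] rep_mem[OF f] gh, of m]
          convolution_assoc[of "rep f" "rep g" "rep h" m] rep_carrier f g h by auto
    qed (simp_all add: mult_Gr_closed f g h)
  qed (simp_all add: mult_Gr_closed one unit)
  have dist: "mult Gr (add Gr f g) h = add Gr (mult Gr f h) (mult Gr g h)"
    "mult Gr h (add Gr f g) = add Gr (mult Gr h f) (mult Gr h g)"
    if f: "f \<in> carrier Gr" and g: "g \<in> carrier Gr" and h: "h \<in> carrier Gr" for f g h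
  proof -
    note fg = add_coset(2)[OF f g rep_mem[OF f] rep_mem[OF g]]
    note c = rep_carrier[OF f] rep_carrier[OF g] rep_carrier[OF h]
    show "mult Gr (add Gr f g) h = add Gr (mult Gr f h) (mult Gr g h)"
    proof (rule Gr_eqI)
      fix m
      have "(\<Oplus>i\<in>{..m}. (rep f i \<oplus> rep g i) \<otimes> rep h (m - i)) =
          (\<Oplus>i\<in>{..m}. rep f i \<otimes> rep h (m - i)) \<oplus> (\<Oplus>i\<in>{..m}. rep g i \<otimes> rep h (m - i))"
        using c by (simp add: l_distr finsum_addf Pi_def)
      then show "\<exists>x. x \<in> mult Gr (add Gr f g) h m \<and> x \<in> add Gr (mult Gr f h) (mult Gr g h) m"
        using mult_coset(2)[OF add_Gr_closed[OF f g] h fg rep_mem[OF h], of m]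
          add_coset(2)[OF mult_Gr_closed[OF f h] mult_Gr_closed[OF g h]
            mult_coset(2)[OF f h rep_mem[OF f] rep_mem[OF h]]
            mult_coset(2)[OF g h rep_mem[OF g] rep_mem[OF h]], of m] by auto
    qed (simp_all add: mult_Gr_closed add_Gr_closed f g h)
    show "mult Gr h (add Gr f g) = add Gr (mult Gr h f) (mult Gr h g)"
    proof (rule Gr_eqI)
      fix m
      have "(\<Oplus>i\<in>{..m}. rep h i \<otimes> (rep f (m - i) \<oplus> rep g (m - i))) =
          (\<Oplus>i\<in>{..m}. rep h i \<otimes> rep f (m - i)) \<oplus> (\<Oplus>i\<in>{..m}. rep h i \<otimes> rep g (m - i))"
        using c by (simp add: r_distr finsum_addf Pi_def)
      then show "\<exists>x. x \<in> mult Gr h (add Gr f g) m \<and> x \<in> add Gr (mult Gr h f) (mult Gr h g) m"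
        using mult_coset(2)[OF h add_Gr_closed[OF f g] rep_mem[OF h] fg, of m]
          add_coset(2)[OF mult_Gr_closed[OF h f] mult_Gr_closed[OF h g]
            mult_coset(2)[OF h f rep_mem[OF h] rep_mem[OF f]]
            mult_coset(2)[OF h g rep_mem[OF h] rep_mem[OF g]], of m] by auto
    qed (simp_all add: mult_Gr_closed add_Gr_closed f g h)
  qed
  interpret G: ring Gr by (rule ringI[OF ag mon]) (simp_all add: dist)
  show ?thesis
  proof unfold_locales
    fix f c assume f: "f \<in> carrier Gr"
    have *: "scal A c \<otimes> rep f m \<in> mult Gr (scal Gr c) f m" "rep f m \<otimes> scal A c \<in> mult Gr f (scal Gr c) m" for m
      using gr_mult_coset[OF scal_Fl f, of "rep f m" m c] rep_mem[OF f, of m] by (simp_all add: Gr_simps(3,6))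
    have sc: "scal Gr c \<in> carrier Gr" using gr_closed[OF scal_Fl] by (simp only: Gr_simps(6))
    show "mult Gr f (scal Gr c) = mult Gr (scal Gr c) f"
      by (rule Gr_eqI[OF mult_Gr_closed[OF f sc] mult_Gr_closed[OF sc f]])
        (use * scal_central rep_carrier[OF f] in metis)
  qed (simp_all add: Gr_simps(3,6) gr_closed scal_Fl gr_add gr_mult scal_add scal_mult)
qed

lemma gr_scal: "x \<in> Fl m \<Longrightarrow> mult Gr (scal Gr c) (gr m x) = gr m (scal A c \<otimes> x)"
  using gr_mult[OF scal_Fl, of x m c] by (simp add: Gr_simps)

text \<open>A choice of subspaces of the filtered algebra, one for each degree, cuts out a subspace
  of \<open>Gr\<close>. Spans of torus classes and of augmentation ideals will be bounded by such
  subspaces, so that no basis of \<open>Gr\<close> has to be described.\<close>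

lemma vsub_componentwise:
  assumes "\<And>m. vsub (Q m)"
  shows "kalg.vsub Gr {f \<in> carrier Gr. \<forall>m. \<exists>x\<in>f m. x \<in> Q m}" (is "kalg.vsub Gr ?Z")
proof -
  interpret G: kalg Gr by (rule kalg_Gr)
  have "f \<oplus>\<^bsub>Gr\<^esub> g \<in> ?Z" if "f \<in> ?Z" "g \<in> ?Z" for f g
    using that add_coset(2)[of f g] vsub_add[OF assms] G.a_closed[of f g] by fastforce
  moreover have "scal Gr c \<otimes>\<^bsub>Gr\<^esub> f \<in> ?Z" if f: "f \<in> ?Z" for f c
  proof -
    have "\<exists>x\<in>mult Gr (scal Gr c) f m. x \<in> Q m" for m
    proof -
      obtain x where "x \<in> f m" "x \<in> Q m" using f by auto
      then show ?thesis using gr_mult_coset(1)[OF scal_Fl, of f x m c] f vsub_scal[OF assms]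
        by (auto simp: Gr_simps(6))
    qed
    then show ?thesis using f by auto
  qed
  moreover have "\<zero>\<^bsub>Gr\<^esub> \<in> ?Z"
    using G.zero_closed vsub_zero[OF vsub_P] vsub_zero[OF assms] by (auto simp: Gr_simps(2))
  ultimately show ?thesis unfolding G.vsub_def by blast
qed

end

section \<open>Skew derivations of the tensor algebra\<close>

lemma lin_fun_eqI:
  "lin f \<Longrightarrow> lin g \<Longrightarrow> (\<And>b. f (sing b 1) = g (sing b 1)) \<Longrightarrow> f = g"
  by (rule ext) (rule lin_eqI)

lemma lin_if: "lin f \<Longrightarrow> lin g \<Longrightarrow> lin (\<lambda>x. if b then f x else g x)"
  by (cases b) simp_all

lemmas lin_intros = lin_id lin_const_zero lin_plus lin_minus lin_scaled lin_if
  lin_compose[OF lin_lext] lin_compose[OF lin_mult_left] lin_compose[OF lin_mult_right]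

lemma letters_zero [simp]: "letters 0 = []" and Word_Nil: "Word [] = 0"
  by (simp_all add: zero_word_def)

lemma letters_plus [simp]: "letters (u + v) = letters u @ letters v"
  by (simp add: plus_word_def)

lemma letters_inject [simp]: "letters u = letters v \<longleftrightarrow> u = v"
  by (cases u; cases v) simp

lemma Word_letters [simp]: "Word (letters u) = u" by (cases u) simp

lemma Word_Cons: "Word (x # xs) = Word [x] + Word xs" by (simp add: plus_word_def)

lemma Word_neq_zero [simp]: "Word (x # xs) \<noteq> 0" "0 \<noteq> Word (x # xs)"
  by (simp_all add: zero_word_def)

lemma word_plus_eq_zero [simp]: "u + v = 0 \<longleftrightarrow> u = 0 \<and> v = (0 :: 'g word)"
  by (cases u; cases v) (simp add: plus_word_def zero_word_def)

lemma single_plus_eq [simp]: "Word [j] + u = Word [i] \<longleftrightarrow> j = i \<and> u = 0"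
  by (cases u) (simp add: plus_word_def zero_word_def)

declare Word_Nil [simp]

lemma word_induct [case_names zero letter]:
  assumes "P 0" "\<And>x w. P w \<Longrightarrow> P (Word [x] + w)" shows "P w"
proof -
  have "P (Word xs)" for xs
  proof (induction xs)
    case (Cons a xs) then show ?case by (subst Word_Cons) (rule assms(2))
  qed (use assms in simp)
  from this[of "letters w"] show ?thesis by simp
qed

lemma word_degree_zero [simp]: "word_degree 0 = 0"
  and word_degree_letter [simp]: "word_degree (Word [i]) = alpha i"
  and word_degree_plus [simp]: "word_degree (u + v) = word_degree u + word_degree v"
  by (simp_all add: word_degree_def)

definition mchar :: "('i::finite zn \<Rightarrow> 'k::field) \<Rightarrow> bool" where
  "mchar f \<longleftrightarrow> (\<forall>a b. f (a + b) = f a * f b) \<and> (\<forall>a. f a \<noteq> 0)"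

lemma mchar_add: "mchar f \<Longrightarrow> f (a + b) = f a * f b"
  and mchar_nz: "mchar f \<Longrightarrow> f a \<noteq> 0" by (auto simp: mchar_def)

lemma mchar_zero: "mchar f \<Longrightarrow> f 0 = 1"
  using mchar_add[of f 0 0] mchar_nz[of f 0] by simp

lemma mchar_uminus: "mchar f \<Longrightarrow> f (- a) = inverse (f a)"
  using mchar_add[of f a "- a"] mchar_zero[of f] mchar_nz[of f a]
  by (metis add.right_inverse inverse_unique)

lemma mchar_diff: "mchar f \<Longrightarrow> f (a - b) = f a * inverse (f b)"
  using mchar_add[of f a "- b"] by (simp add: mchar_uminus)

lemma mchar_inverse: "mchar f \<Longrightarrow> mchar (\<lambda>a. inverse (f a))"
  by (simp add: mchar_def)

text \<open>For f = \<chi>(m, -) this is the action of K_m on the tensor algebra; for an indicator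
  function it is the projection to a set of degrees. Therefore f is an arbitrary function of the
  degree.\<close>

definition tw :: "('i::finite zn \<Rightarrow> 'k::field) \<Rightarrow> ('i, 'k) nc_poly \<Rightarrow> ('i, 'k) nc_poly" where
  "tw f = lext (\<lambda>u. sing u (f (word_degree u)))"

lemma lin_tw [simp]: "lin (tw f)" by (simp add: tw_def)

lemma tw_sing [simp]: "tw f (sing u c) = sing u (c * f (word_degree u))" by (simp add: tw_def)

lemma tw_one [simp]: "tw f 1 = sing 0 (f 0)"
  using tw_sing[of f 0 1] by simp

lemma coef_tw: "coef (tw f x) w = f (word_degree w) * coef x w"
proof -
  have "tw f x = (\<Sum>b\<in>supp x. sing b (coef x b * f (word_degree b)))"
    by (simp add: tw_def lext_def)
  then have "coef (tw f x) w = (\<Sum>b\<in>supp x. if b = w then coef x b * f (word_degree b) else 0)"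
    by (simp add: lookup_sum lookup_single when_def)
  then show ?thesis by (simp add: in_keys_iff)
qed

lemma tw_letter_mult:
  assumes "mchar f"
  shows "tw f (sing (Word [j]) 1 * x) = f (alpha j) \<cdot> (sing (Word [j]) 1 * tw f x)"
proof -
  have "(\<lambda>x. tw f (sing (Word [j]) 1 * x)) = (\<lambda>x. f (alpha j) \<cdot> (sing (Word [j]) 1 * tw f x))"
    by (rule lin_fun_eqI)
      (auto intro!: lin_intros lin_compose[OF lin_tw] simp: mult_single mchar_add[OF assms] mult.commute)
  then show ?thesis by (rule fun_cong)
qed

text \<open>Each occurrence of the letter i is deleted, with weight f of the degree of the letters
  to its right: the factor picked up when the K_i or K_i^{-1} of a commutator is moved to the right
  end of the word.\<close>

fun derw :: "('i::finite zn \<Rightarrow> 'k::field) \<Rightarrow> 'i \<Rightarrow> 'i list \<Rightarrow> ('i, 'k) nc_poly" where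
  "derw f i [] = 0"
| "derw f i (j # xs) = sing (Word [j]) 1 * derw f i xs
     + (if i = j then sing (Word xs) (f (word_degree (Word xs))) else 0)"

definition der :: "('i::finite zn \<Rightarrow> 'k::field) \<Rightarrow> 'i \<Rightarrow> ('i, 'k) nc_poly \<Rightarrow> ('i, 'k) nc_poly" where
  "der f i = lext (\<lambda>w. derw f i (letters w))"

lemma lin_der [simp]: "lin (der f i)" by (simp add: der_def)

lemma der_sing_zero [simp]: "der f i (sing 0 c) = 0" by (simp add: der_def)

lemma der_one [simp]: "der f i 1 = 0"
  using der_sing_zero[of f i 1] by simp

lemma der_letter:
  "der f i (sing (Word [j] + w) 1) = sing (Word [j]) 1 * der f i (sing w 1)
     + (if i = j then sing w (f (word_degree w)) else 0)"
  by (simp add: der_def)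

text \<open>The derivative has degree deg w - \<alpha>_j. The factor f(\<alpha>_j) stays on the left
  so that the induction runs without inverses.\<close>

lemma tw_derw:
  assumes "mchar f"
  shows "f (alpha j) \<cdot> tw f (der g j (sing w 1)) = f (word_degree w) \<cdot> der g j (sing w 1)"
proof (induction w rule: word_induct)
  case zero then show ?case by simp
next
  case (letter x w)
  have "f (alpha j) \<cdot> tw f (sing (Word [x]) 1 * der g j (sing w 1)) =
      f (alpha x) \<cdot> (sing (Word [x]) 1 * (f (alpha j) \<cdot> tw f (der g j (sing w 1))))"
    by (simp add: tw_letter_mult[OF assms] mult_pscale_right mult.commute)
  also have "\<dots> = f (alpha x + word_degree w) \<cdot> (sing (Word [x]) 1 * der g j (sing w 1))"
    by (simp add: letter mult_pscale_right mchar_add[OF assms])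
  finally show ?case
    by (simp add: der_letter lin_add[OF lin_tw] pm.scale_right_distrib mchar_add[OF assms])
      (simp add: ac_simps)
qed

lemma free_ideal_add: "ideal I free_algebra \<Longrightarrow> x \<in> I \<Longrightarrow> y \<in> I \<Longrightarrow> x + y \<in> I"
  and free_ideal_zero: "ideal I free_algebra \<Longrightarrow> 0 \<in> I"
  and free_ideal_mult_left: "ideal I free_algebra \<Longrightarrow> x \<in> I \<Longrightarrow> a * x \<in> I"
  and free_ideal_mult_right: "ideal I free_algebra \<Longrightarrow> x \<in> I \<Longrightarrow> x * a \<in> I"
  for I :: "('g, 'k::field) nc_poly set"
  using additive_subgroup.a_closed[OF ideal.axioms(1), of I free_algebra x y]
    additive_subgroup.zero_closed[OF ideal.axioms(1), of I free_algebra]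
    ideal.I_l_closed[of I free_algebra x a] ideal.I_r_closed[of I free_algebra x a]
  by simp_all

section \<open>Stability of the biideal under skew derivations\<close>

locale pre_nichols =
  fixes chi :: "'i::{finite,linorder} zn \<Rightarrow> 'i zn \<Rightarrow> 'k::field"
    and J :: "('i, 'k) nc_poly set"
  assumes bichar: "bicharacter chi"
    and q_sym: "\<And>i j. chi (alpha i) (alpha j) = chi (alpha j) (alpha i)"
    and biideal: "biideal chi J" and graded: "graded_subspace J"
    and length2: "J \<subseteq> length_at_least_two"
begin

lemma mchar_chi: "mchar (chi a)" and mchar_chi_left: "mchar (\<lambda>b. chi b a)"
  using bichar by (auto simp: bicharacter_def mchar_def)

lemmas chi_simps = mchar_add[OF mchar_chi] mchar_add[OF mchar_chi_left]
  mchar_diff[OF mchar_chi] mchar_diff[OF mchar_chi_left]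
  mchar_uminus[OF mchar_chi] mchar_uminus[OF mchar_chi_left]

lemma chi_zero [simp]: "chi a 0 = 1" "chi 0 a = 1"
  using mchar_zero[OF mchar_chi] mchar_zero[OF mchar_chi_left] by auto

lemma chi_nz [simp]: "chi a b \<noteq> 0" using mchar_nz[OF mchar_chi] .

lemma J_ideal: "ideal J free_algebra" using biideal by (simp add: biideal_def)

lemmas J_add = free_ideal_add[OF J_ideal] and J_zero = free_ideal_zero[OF J_ideal]
  and J_mult_left = free_ideal_mult_left[OF J_ideal] and J_mult_right = free_ideal_mult_right[OF J_ideal]

lemma J_subspace: "pm.subspace J"
  by (simp add: pm.subspace_def J_add J_zero J_mult_left pscale_mult)

lemma J_coef: "x \<in> J \<Longrightarrow> length (letters w) < 2 \<Longrightarrow> coef x w = 0"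
  using length2 by (force simp: length_at_least_two_def in_keys_iff)

text \<open>A graded subspace is stable under scaling its homogeneous components by arbitrary
  factors; the twist is such a scaling, as the sum over the degrees of x shows.\<close>

lemma J_tw: "x \<in> J \<Longrightarrow> tw f x \<in> J"
proof -
  assume x: "x \<in> J"
  let ?D = "word_degree ` supp x"
  have "tw f x = (\<Sum>l\<in>?D. f l \<cdot> homogeneous_part l x)"
  proof (rule poly_mapping_eqI)
    fix w
    have h: "coef (homogeneous_part l x) w = (if word_degree w = l then coef x w else 0)" for l
      unfolding homogeneous_part_def lookup_sum lookup_single when_def
      by (auto simp: sum.delta in_keys_iff)
    have "coef (\<Sum>l\<in>?D. f l \<cdot> homogeneous_part l x) w =
        (\<Sum>l\<in>?D. if word_degree w = l then f l * coef x w else 0)"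
      unfolding lookup_sum by (rule sum.cong) (auto simp: h)
    also have "\<dots> = f (word_degree w) * coef x w" by (auto simp: in_keys_iff)
    finally show "coef (tw f x) w = coef (\<Sum>l\<in>?D. f l \<cdot> homogeneous_part l x) w"
      by (simp add: coef_tw)
  qed
  also have "\<dots> \<in> J"
    using x graded by (intro pm.subspace_sum[OF J_subspace] pm.subspace_scale[OF J_subspace])
      (auto simp: graded_subspace_def)
  finally show ?thesis .
qed

text \<open>The skew derivations are the contractions of the braided coproduct with the coordinate functionals
  of the \<open>E\<^sub>i\<close>; these vanish on \<open>J\<close>, which starts in degree two, so that the biideal \<open>J\<close> is stable.\<close>

definition conR :: "'i word \<Rightarrow> ('i, 'k) nc_poly2 \<Rightarrow> ('i, 'k) nc_poly" where
  "conR w = lext (\<lambda>(u, v). if v = w then sing u 1 else 0)"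
definition conL :: "'i word \<Rightarrow> ('i, 'k) nc_poly2 \<Rightarrow> ('i, 'k) nc_poly" where
  "conL w = lext (\<lambda>(u, v). if u = w then sing v 1 else 0)"

lemma lin_con [simp]: "lin (conR w)" "lin (conL w)" by (simp_all add: conR_def conL_def)

lemma con_sing:
  "conR w (sing (u, v) c) = (if v = w then sing u c else 0)"
  "conL w (sing (u, v) c) = (if u = w then sing v c else 0)"
  by (simp_all add: conR_def conL_def)

lemma conR_tensor: "conR w (tensor x y) = coef y w \<cdot> x"
proof -
  have "conR w (tensor x y) = (\<Sum>u\<in>supp x. \<Sum>v\<in>supp y. if v = w then sing u (coef x u * coef y w) else 0)"
    unfolding tensor_def lin_sum[OF lin_con(1)] con_sing by (intro sum.cong) auto
  also have "\<dots> = (\<Sum>u\<in>supp x. coef y w \<cdot> (coef x u \<cdot> sing u 1))"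
    by (rule sum.cong) (auto simp: in_keys_iff mult.commute)
  also have "\<dots> = coef y w \<cdot> lext (\<lambda>u. sing u 1) x"
    by (simp add: lext_def pm.scale_sum_right)
  finally show ?thesis by (simp add: lext_expand)
qed

lemma conL_tensor: "conL w (tensor x y) = coef x w \<cdot> y"
proof -
  have "conL w (tensor x y) = (\<Sum>u\<in>supp x. if u = w then coef x u \<cdot> (\<Sum>v\<in>supp y. coef y v \<cdot> sing v 1) else 0)"
    unfolding tensor_def lin_sum[OF lin_con(2)] con_sing pm.scale_sum_right
    by (intro sum.cong) auto
  also have "\<dots> = coef x w \<cdot> lext (\<lambda>u. sing u 1) y"
    by (simp add: in_keys_iff lext_def)
  finally show ?thesis by (simp add: lext_expand)
qed

lemma tensor_letter:
  "tensor (letter i) 1 + tensor 1 (letter i) =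
     (sing (Word [i], 0) 1 + sing (0, Word [i]) 1 :: ('i, 'k) nc_poly2)"
  by (simp add: tensor_def letter_def)

lemma coproduct_word_zero: "coproduct_word chi 0 = sing (0, 0) 1"
  by (simp add: coproduct_word_def tensor_def)

text \<open>The coproduct of a letter has two terms, so multiplying by it is explicit on pairs of
  words. The braiding enters only when the letter passes the left factor u on its way to the right
  one.\<close>

lemma coproduct_word_letter:
  "coproduct_word chi (Word [i] + w) =
     lext (\<lambda>(u, v). sing (Word [i] + u, v) 1 + sing (u, Word [i] + v) (chi (alpha i) (word_degree u)))
       (coproduct_word chi w)"
proof -
  let ?X = "sing (Word [i], 0) 1 + sing (0, Word [i]) 1 :: ('i, 'k) nc_poly2"
  have cf: "coef ?X (Word [i], 0) = 1" "coef ?X (0, Word [i]) = 1"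
    by (simp_all add: lookup_add lookup_single)
  have k: "supp ?X = {(Word [i], 0), (0, Word [i])}"
    by (auto simp: in_keys_iff lookup_add lookup_single when_def split: if_splits)
  have "braided_mult chi ?X Y = lext (\<lambda>(u, v). sing (Word [i] + u, v) 1 +
      sing (u, Word [i] + v) (chi (alpha i) (word_degree u))) Y" for Y
    unfolding braided_mult_def k lext_def
    by (simp add: cf case_prod_beta sum.distrib pm.scale_right_distrib)
      (simp add: ac_simps)
  then show ?thesis by (simp add: coproduct_word_def tensor_letter)
qed

lemma conR_zero_coproduct: "conR 0 (coproduct_word chi w) = sing w 1"
proof (induction w rule: word_induct)
  case zero then show ?case by (simp add: coproduct_word_zero conR_def)
next
  case (letter i w)
  have "(\<lambda>Y. conR 0 (lext (\<lambda>(u, v). sing (Word [i] + u, v) 1 + sing (u, Word [i] + v) (chi (alpha i) (word_degree u))) Y)) =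
      (\<lambda>Y. sing (Word [i]) 1 * conR 0 Y)"
    by (rule lin_fun_eqI)
      (auto intro!: lin_intros lin_compose[OF lin_tw] lin_compose[OF lin_con(1)] lin_compose[OF lin_con(2)]
        simp: lin_add[OF lin_lext] conR_def conL_def mult_single)
  note fun_cong[OF this, of "coproduct_word chi w"]
  then show ?case by (simp add: coproduct_word_letter letter mult_single)
qed

lemma conL_zero_coproduct: "conL 0 (coproduct_word chi w) = sing w 1"
proof (induction w rule: word_induct)
  case zero then show ?case by (simp add: coproduct_word_zero conL_def)
next
  case (letter i w)
  have "(\<lambda>Y. conL 0 (lext (\<lambda>(u, v). sing (Word [i] + u, v) 1 + sing (u, Word [i] + v) (chi (alpha i) (word_degree u))) Y)) =
      (\<lambda>Y. sing (Word [i]) 1 * conL 0 Y)"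
    by (rule lin_fun_eqI)
      (auto intro!: lin_intros lin_compose[OF lin_tw] lin_compose[OF lin_con(1)] lin_compose[OF lin_con(2)]
        simp: lin_add[OF lin_lext] conR_def conL_def mult_single)
  note fun_cong[OF this, of "coproduct_word chi w"]
  then show ?case by (simp add: coproduct_word_letter letter mult_single)
qed

text \<open>A right factor E_i arises in two ways: the first letter E_j stays on the left and E_i
  comes from w, or E_j is itself this E_i and has passed all of w, which costs \<chi>(\<alpha>_i,
  deg w).\<close>

lemma conR_coproduct:
  "conR (Word [i]) (coproduct_word chi w) = der (chi (alpha i)) i (sing w 1)"
proof (induction w rule: word_induct)
  case zero then show ?case by (simp add: coproduct_word_zero conR_def)
next
  case (letter j w)
  have "(\<lambda>Y. conR (Word [i]) (lext (\<lambda>(u, v). sing (Word [j] + u, v) 1 + sing (u, Word [j] + v) (chi (alpha j) (word_degree u))) Y)) =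
      (\<lambda>Y. sing (Word [j]) 1 * conR (Word [i]) Y + (if i = j then tw (chi (alpha i)) (conR 0 Y) else 0))"
    by (rule lin_fun_eqI)
      (auto intro!: lin_intros lin_compose[OF lin_tw] lin_compose[OF lin_con(1)] lin_compose[OF lin_con(2)]
        simp: lin_add[OF lin_lext] conR_def conL_def mult_single)
  note fun_cong[OF this, of "coproduct_word chi w"]
  then show ?case by (simp add: coproduct_word_letter letter der_letter conR_zero_coproduct)
qed

text \<open>With E_i as left factor, every earlier letter E_j that goes to the right passes it and
  contributes \<chi>(\<alpha>_j, \<alpha>_i). By the symmetry of q the twist cancels these factors
  and leaves the inverse weights on the deleted letter.\<close>

lemma conL_coproduct:
  "tw (\<lambda>a. inverse (chi (alpha i) a)) (conL (Word [i]) (coproduct_word chi w)) =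
     der (\<lambda>a. inverse (chi (alpha i) a)) i (sing w 1)"
proof (induction w rule: word_induct)
  case zero then show ?case by (simp add: coproduct_word_zero conL_def)
next
  case (letter j w)
  have "(\<lambda>Y. conL (Word [i]) (lext (\<lambda>(u, v). sing (Word [j] + u, v) 1 + sing (u, Word [j] + v) (chi (alpha j) (word_degree u))) Y)) =
      (\<lambda>Y. chi (alpha j) (alpha i) \<cdot> (sing (Word [j]) 1 * conL (Word [i]) Y) + (if i = j then conL 0 Y else 0))"
    by (rule lin_fun_eqI)
      (auto intro!: lin_intros lin_compose[OF lin_tw] lin_compose[OF lin_con(1)] lin_compose[OF lin_con(2)]
        simp: lin_add[OF lin_lext] conR_def conL_def mult_single)
  note fun_cong[OF this, of "coproduct_word chi w"]
  then show ?case
    using tw_letter_mult[OF mchar_inverse[OF mchar_chi[of "alpha i"]]]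
    by (simp add: coproduct_word_letter letter[symmetric] der_letter conL_zero_coproduct
        lin_add[OF lin_tw] lin_scale[OF lin_tw] q_sym[of j i])
qed

lemma coproduct_lext: "coproduct chi = lext (coproduct_word chi)"
  by (rule ext) (simp add: coproduct_def lext_def pscale_def)

text \<open>Contracting y \<otimes> z gives one factor times a coefficient of the other at a word of
  length one. The result is in \<open>J\<close> if the surviving factor is; if the contracted factor
  is in \<open>J\<close>, the coefficient vanishes because \<open>J\<close> starts in length
  two.\<close>

lemma J_con:
  assumes "x \<in> J"
  shows "conR (Word [i]) (coproduct chi x) \<in> J" "conL (Word [i]) (coproduct chi x) \<in> J"
proof -
  obtain s t where s: "s \<in> tensor_subspace J UNIV" and t: "t \<in> tensor_subspace UNIV J"
    and st: "coproduct chi x = s + t"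
    using biideal assms unfolding biideal_def by blast
  have aux: "coef y (Word [i]) \<cdot> x \<in> J" if "x \<in> J \<or> y \<in> J" for x y
    using that by (auto simp: J_coef J_zero pm.subspace_scale[OF J_subspace])
  have "conR (Word [i]) (sum_list (map (\<lambda>(x, y). tensor x y) ts)) \<in> J \<and>
      conL (Word [i]) (sum_list (map (\<lambda>(x, y). tensor x y) ts)) \<in> J"
    if "set ts \<subseteq> J \<times> UNIV \<or> set ts \<subseteq> UNIV \<times> J" for ts :: "(('i, 'k) nc_poly \<times> ('i, 'k) nc_poly) list"
    using that
  proof (induction ts)
    case (Cons a ts)
    then show ?case
      by (cases a) (auto simp: lin_add[OF lin_con(1)] lin_add[OF lin_con(2)] conR_tensor conL_tensor aux
        intro!: J_add)
  qed (simp add: J_zero)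
  then show "conR (Word [i]) (coproduct chi x) \<in> J" "conL (Word [i]) (coproduct chi x) \<in> J"
    using s t unfolding st by (auto simp: tensor_subspace_def lin_add[OF lin_con(1)] lin_add[OF lin_con(2)] intro!: J_add)
qed

abbreviation "chip i \<equiv> chi (alpha i)"
abbreviation "chim i \<equiv> (\<lambda>a. inverse (chi (alpha i) a))"

lemma J_der: "x \<in> J \<Longrightarrow> der (chip i) i x \<in> J" "x \<in> J \<Longrightarrow> der (chim i) i x \<in> J"
proof -
  assume x: "x \<in> J"
  have "(\<lambda>x. conR (Word [i]) (coproduct chi x)) = (\<lambda>x. der (chip i) i x)"
    unfolding coproduct_lext
    by (rule lin_fun_eqI) (auto intro!: lin_intros lin_compose[OF lin_con(1)] simp: conR_coproduct)
  then show "der (chip i) i x \<in> J" using J_con(1)[OF x, of i] by (metis (full_types))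
  have "(\<lambda>x. tw (chim i) (conL (Word [i]) (coproduct chi x))) = (\<lambda>x. der (chim i) i x)"
    unfolding coproduct_lext
    by (rule lin_fun_eqI)
      (auto intro!: lin_intros lin_compose[OF lin_tw] lin_compose[OF lin_con(2)] simp: conL_coproduct)
  then show "der (chim i) i x \<in> J" using J_tw[OF J_con(2)[OF x, of i], of "chim i"] by (metis (full_types))
qed

end

section \<open>The regular representation\<close>

text \<open>The basis element \<open>(u, m, v)\<close> stands for \<open>E\<^sub>u K\<^sub>m F\<^sub>v\<close>.\<close>

type_synonym ('i, 'k) tri = "('i word \<times> 'i zn \<times> 'i word) \<Rightarrow>\<^sub>0 'k"

text \<open>The pure tensor p \<otimes> K_m \<otimes> q. The operators are described on these
  tensors, and not only on the basis, so that elements of \<open>J\<close> can be inserted for p or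
  q.\<close>

definition tri :: "('i, 'k::field) nc_poly \<Rightarrow> 'i zn \<Rightarrow> ('i, 'k) nc_poly \<Rightarrow> ('i, 'k) tri" where
  "tri p m q = lext (\<lambda>u. lext (\<lambda>v. sing (u, m, v) 1) q) p"

lemma lin_lext_fun: "(\<And>b. lin (\<lambda>x. f b x)) \<Longrightarrow> lin (\<lambda>x. lext (\<lambda>b. f b x) a)"
  by (rule linI) (simp_all add: lext_def lin_def pm.scale_right_distrib sum.distrib
      pm.scale_sum_right mult.commute)

lemma lin_tri_left [simp]: "lin (\<lambda>p. tri p m q)"
  and lin_tri_right [simp]: "lin (\<lambda>q. tri p m q)"
  unfolding tri_def by (simp, rule lin_lext_fun) simp

lemma tri_sing: "tri (sing u c) m (sing v d) = sing (u, m, v) (c * d)"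
  by (simp add: tri_def)

lemma tri_zero [simp]: "tri 0 m q = 0" "tri p m 0 = 0"
  using lin_zero[OF lin_tri_left] lin_zero[OF lin_tri_right] by blast+

lemmas tri_intros = lin_intros lin_tw lin_der lin_compose[OF lin_tw] lin_compose[OF lin_der]
  lin_tri_left lin_tri_right lin_compose[OF lin_tri_left] lin_compose[OF lin_tri_right]
  lin_mult_left lin_mult_right

lemma bilin_eqI:
  assumes "\<And>q. lin (\<lambda>p. f p q)" "\<And>p. lin (\<lambda>q. f p q)" "\<And>q. lin (\<lambda>p. g p q)" "\<And>p. lin (\<lambda>q. g p q)"
    "\<And>u v. f (sing u 1) (sing v 1) = g (sing u 1) (sing v 1)"
  shows "f p q = g p q"
proof -
  have "f (sing u 1) q = g (sing u 1) q" for u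
    using lin_eqI[of "f (sing u 1)" "g (sing u 1)" q] assms by simp
  then show ?thesis using lin_eqI[of "\<lambda>p. f p q" "\<lambda>p. g p q" p] assms by simp
qed

context pre_nichols
begin

section \<open>The operators of left multiplication and the defining relations\<close>

definition opE :: "'i \<Rightarrow> ('i, 'k) tri \<Rightarrow> ('i, 'k) tri" where
  "opE j = lext (\<lambda>(u, m, v). sing (Word [j] + u, m, v) 1)"
definition opK :: "'i \<Rightarrow> ('i, 'k) tri \<Rightarrow> ('i, 'k) tri" where
  "opK i = lext (\<lambda>(u, m, v). sing (u, m + alpha i, v) (chip i (word_degree u)))"
definition opL :: "'i \<Rightarrow> ('i, 'k) tri \<Rightarrow> ('i, 'k) tri" where
  "opL i = lext (\<lambda>(u, m, v). sing (u, m - alpha i, v) (chim i (word_degree u)))"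

text \<open>Left multiplication by \<open>F\<^sub>i\<close> in terms of the basis \<open>E\<^sub>u K\<^sub>m F\<^sub>v\<close>, where
  \<open>E\<^sub>u F\<^sub>i - F\<^sub>i E\<^sub>u = d(E\<^sub>u) K\<^sub>i - d'(E\<^sub>u) K\<^sub>i\<^sup>-\<^sup>1\<close> for the two skew derivations \<open>d\<close>, \<open>d'\<close> attached to \<open>i\<close>.\<close>

definition opF :: "'i \<Rightarrow> ('i, 'k) tri \<Rightarrow> ('i, 'k) tri" where
  "opF i = lext (\<lambda>(u, m, v). sing (u, m, Word [i] + v) (chi m (alpha i))
     - tri (der (chip i) i (sing u 1)) (m + alpha i) (sing v 1)
     + tri (der (chim i) i (sing u 1)) (m - alpha i) (sing v 1))"

fun opr :: "'i u_gen \<Rightarrow> ('i, 'k) tri \<Rightarrow> ('i, 'k) tri" where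
  "opr (GE i) = opE i" | "opr (GF i) = opF i" | "opr (GK i) = opK i" | "opr (GKinv i) = opL i"

lemma lin_opr [simp]: "lin (opr g)"
  by (cases g) (simp_all add: opE_def opF_def opK_def opL_def)

lemma lin_ops [simp]: "lin (opE i)" "lin (opF i)" "lin (opK i)" "lin (opL i)"
  by (simp_all add: opE_def opF_def opK_def opL_def)

lemmas op_intros = lin_compose[OF lin_ops(1)] lin_compose[OF lin_ops(2)]
  lin_compose[OF lin_ops(3)] lin_compose[OF lin_ops(4)]

lemma opE_tri: "opE j (tri p m q) = tri (sing (Word [j]) 1 * p) m q"
  by (rule bilin_eqI[of "\<lambda>p q. opE j (tri p m q)"])
    (auto intro!: tri_intros op_intros simp: tri_sing opE_def mult_single)

lemma opK_tri: "opK i (tri p m q) = tri (tw (chip i) p) (m + alpha i) q"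
  by (rule bilin_eqI[of "\<lambda>p q. opK i (tri p m q)"])
    (auto intro!: tri_intros op_intros simp: tri_sing opK_def)

lemma opL_tri: "opL i (tri p m q) = tri (tw (chim i) p) (m - alpha i) q"
  by (rule bilin_eqI[of "\<lambda>p q. opL i (tri p m q)"])
    (auto intro!: tri_intros op_intros simp: tri_sing opL_def)

lemma opF_tri: "opF i (tri p m q) = chi m (alpha i) \<cdot> tri p m (sing (Word [i]) 1 * q)
    - tri (der (chip i) i p) (m + alpha i) q + tri (der (chim i) i p) (m - alpha i) q"
  by (rule bilin_eqI[of "\<lambda>p q. opF i (tri p m q)"])
    (auto intro!: tri_intros op_intros simp: tri_sing opF_def mult_single)

lemma tri_eqI:
  assumes "lin f" "lin g" "\<And>u m v. f (tri (sing u 1) m (sing v 1)) = g (tri (sing u 1) m (sing v 1))"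
  shows "f x = g x"
  by (rule lin_eqI) (use assms in \<open>auto simp: tri_sing\<close>)

lemma opr_sing:
  "opE j (sing (u, m, v) c) = sing (Word [j] + u, m, v) c"
  "opK i (sing (u, m, v) c) = sing (u, m + alpha i, v) (c * chip i (word_degree u))"
  "opL i (sing (u, m, v) c) = sing (u, m - alpha i, v) (c * chim i (word_degree u))"
  by (simp_all add: opE_def opK_def opL_def)

lemma opK_opL: "opK i (opL i x) = x" "opL i (opK i x) = x"
  by (rule lin_eqI[of "\<lambda>x. opK i (opL i x)"] lin_eqI[of "\<lambda>x. opL i (opK i x)"];
      auto intro!: tri_intros op_intros simp: opr_sing)+

lemma opK_opK: "opK i (opK j x) = opK j (opK i x)"
  by (rule lin_eqI[of "\<lambda>x. opK i (opK j x)"])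
    (auto intro!: tri_intros op_intros simp: opr_sing ac_simps)

lemma opK_opE: "opK i (opE j x) = chip i (alpha j) \<cdot> opE j (opK i x)"
  by (rule lin_eqI[of "\<lambda>x. opK i (opE j x)"])
    (auto intro!: tri_intros op_intros simp: opr_sing chi_simps mult.commute)

lemma tw_der:
  assumes "mchar f" shows "tw f (der g j (sing u 1)) = (f (word_degree u) * inverse (f (alpha j))) \<cdot> der g j (sing u 1)"
proof -
  have "tw f (der g j (sing u 1)) = inverse (f (alpha j)) \<cdot> (f (alpha j) \<cdot> tw f (der g j (sing u 1)))"
    using mchar_nz[OF assms] by simp
  then show ?thesis using tw_derw[OF assms, of j g u] by (simp add: mult.commute)
qed

lemma tri_sing_scale:
  "tri (sing u (chi a b)) m q = chi a b \<cdot> tri (sing u 1) m q"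
  "tri (sing u (inverse (chi a b))) m q = inverse (chi a b) \<cdot> tri (sing u 1) m q"
  by (rule lin_sing[OF lin_tri_left])+

lemma opK_tri_sing:
  "opK i (tri (sing u 1) m q) = chip i (word_degree u) \<cdot> tri (sing u 1) (m + alpha i) q"
  "opK i (tri (der g j (sing u 1)) m q) =
     (chip i (word_degree u) * inverse (chip i (alpha j))) \<cdot> tri (der g j (sing u 1)) (m + alpha i) q"
  "opL i (tri (sing u 1) m q) = chim i (word_degree u) \<cdot> tri (sing u 1) (m - alpha i) q"
  by (simp_all add: opK_tri opL_tri tri_sing_scale tw_der[OF mchar_chi] lin_scale[OF lin_tri_left])

text \<open>Lowering the degree of u by \<alpha>_j gives the derivation terms an extra inverse
  factor when K_i acts last; when K_i acts first, the shift of m gives the main term the reciprocal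
  factor. The scalar balances the two.\<close>

lemma opK_opF: "opK i (opF j x) = inverse (chip i (alpha j)) \<cdot> opF j (opK i x)"
proof (rule tri_eqI[of "\<lambda>x. opK i (opF j x)"])
  fix u m v
  show "opK i (opF j (tri (sing u 1) m (sing v 1))) =
      inverse (chip i (alpha j)) \<cdot> opF j (opK i (tri (sing u 1) m (sing v 1)))"
    unfolding opF_tri opK_tri_sing lin_add[OF lin_ops(3)] lin_diff[OF lin_ops(3)]
      lin_scale[OF lin_ops(3)] lin_scale[OF lin_ops(2)] pm.scale_right_distrib
      pm.scale_right_diff_distrib pm.scale_scale
    by (simp add: chi_simps) (simp add: ac_simps diff_add_eq add_diff_eq)
qed (auto intro!: tri_intros op_intros)

lemma opL_opF: "opL i (opF j x) = chip i (alpha j) \<cdot> opF j (opL i x)"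
proof -
  have "opL i (opF j (opK i (opL i x))) = opL i (chip i (alpha j) \<cdot> opK i (opF j (opL i x)))"
    by (simp add: opK_opF)
  then show ?thesis by (simp add: opK_opL lin_scale[OF lin_ops(4)])
qed

text \<open>The recursion of \<open>der\<close> along the first letter is made for this: prefixing
  E_i adds to the two derivatives exactly the terms that K_i and K_i^{-1} contribute.\<close>

lemma opE_opF: "opE i (opF j x) = opF j (opE i x) + (if i = j then opK i x - opL i x else 0)"
proof (rule tri_eqI[of "\<lambda>x. opE i (opF j x)"])
  fix u m v
  have a: "tri (p + q) m r = tri p m r + tri q m r" for m and p q r :: "('i, 'k) nc_poly"
    by (rule lin_add[OF lin_tri_left])
  show "opE i (opF j (tri (sing u 1) m (sing v 1))) = opF j (opE i (tri (sing u 1) m (sing v 1))) +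
      (if i = j then opK i (tri (sing u 1) m (sing v 1)) - opL i (tri (sing u 1) m (sing v 1)) else 0)"
    by (auto simp add: opE_tri opF_tri opK_tri_sing lin_add[OF lin_ops(1)] lin_diff[OF lin_ops(1)]
        lin_scale[OF lin_ops(1)] mult_single der_letter a tri_sing_scale)
qed (auto intro!: tri_intros op_intros)

section \<open>The action of the free algebra and its annihilator modulo N\<close>

definition act :: "('i u_gen, 'k) nc_poly \<Rightarrow> ('i, 'k) tri \<Rightarrow> ('i, 'k) tri" where
  "act a x = lext (\<lambda>w. foldr opr (letters w) x) a"

lemma lin_foldr_opr: "lin (foldr opr gs)"
  by (induction gs) (auto simp: comp_def id_def intro: lin_compose)

lemma lin_act_left [simp]: "lin (\<lambda>a. act a x)" and lin_act [simp]: "lin (act a)"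
  unfolding act_def by simp (rule lin_lext_fun, rule lin_foldr_opr)

lemma act_sing: "act (sing w c) x = c \<cdot> foldr opr (letters w) x"
  by (simp add: act_def)

lemma act_zero [simp]: "act 0 x = 0" using lin_zero[OF lin_act_left] .

lemma act_mult: "act (a * b) x = act a (act b x)"
  by (rule bilin_eqI[of "\<lambda>a b. act (a * b) x" "\<lambda>a b. act a (act b x)"])
    (auto intro!: tri_intros lin_compose[OF lin_act_left] lin_compose[OF lin_act] lin_act_left
      simp: mult_single act_sing)

lemma act_letter [simp]: "act (letter g) x = opr g x"
  by (simp add: act_sing letter_def)

lemma act_sing_zero: "act (sing 0 c) x = c \<cdot> x"
  by (simp add: act_sing)

lemma act_one [simp]: "act 1 x = x" using act_sing_zero[of 1 x] by simp

lemmas act_simps = lin_add[OF lin_act_left] lin_diff[OF lin_act_left] lin_scale[OF lin_act_left]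
  lin_uminus[OF lin_act_left] act_mult act_sing_zero

definition N :: "('i, 'k) tri set" where
  "N = pm.span ({tri x m q | x m q. x \<in> J} \<union> {tri p m y | p m y. y \<in> J})"

lemma N_subspace [simp]: "pm.subspace N" unfolding N_def by (rule pm.subspace_span)

lemma N_tri: "x \<in> J \<or> y \<in> J \<Longrightarrow> tri x m y \<in> N"
  unfolding N_def by (rule pm.span_base) auto

lemmas N_closed = pm.subspace_add[OF N_subspace] pm.subspace_diff[OF N_subspace]
  pm.subspace_scale[OF N_subspace] pm.subspace_0[OF N_subspace]

lemma lin_into_N:
  assumes "lin f" "\<And>p m q. p \<in> J \<or> q \<in> J \<Longrightarrow> f (tri p m q) \<in> N" "x \<in> N"
  shows "f x \<in> N"
  by (rule lin_span_into[OF assms(1) N_subspace _ assms(3)[unfolded N_def]])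
    (use assms(2) in auto)

text \<open>For F_i this is where stability of \<open>J\<close> under both skew derivations enters;
  for the torus generators the grading of \<open>J\<close> suffices.\<close>

lemma opr_N: "x \<in> N \<Longrightarrow> opr g x \<in> N"
proof (cases g)
  fix i assume "g = GE i" and x: "x \<in> N"
  have "opE i x \<in> N"
    by (rule lin_into_N[OF lin_ops(1) _ x]) (auto simp: opE_tri intro!: N_tri J_mult_left)
  then show ?thesis using \<open>g = GE i\<close> by simp
next
  fix i assume "g = GF i" and x: "x \<in> N"
  have "opF i x \<in> N"
    by (rule lin_into_N[OF lin_ops(2) _ x])
      (auto simp: opF_tri intro!: N_closed N_tri J_mult_left J_der)
  then show ?thesis using \<open>g = GF i\<close> by simp
next
  fix i assume "g = GK i" and x: "x \<in> N"
  have "opK i x \<in> N"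
    by (rule lin_into_N[OF lin_ops(3) _ x]) (auto simp: opK_tri intro!: N_tri J_tw)
  then show ?thesis using \<open>g = GK i\<close> by simp
next
  fix i assume "g = GKinv i" and x: "x \<in> N"
  have "opL i x \<in> N"
    by (rule lin_into_N[OF lin_ops(4) _ x]) (auto simp: opL_tri intro!: N_tri J_tw)
  then show ?thesis using \<open>g = GKinv i\<close> by simp
qed

lemma act_N: "x \<in> N \<Longrightarrow> act a x \<in> N"
proof -
  assume x: "x \<in> N"
  have "foldr opr gs x \<in> N" for gs using x by (induction gs) (auto simp: opr_N)
  then show ?thesis
    using lin_into_subspace[OF lin_act_left N_subspace, of a UNIV x] by (simp add: on_def act_sing)
qed

text \<open>The elements acting by zero on the quotient by \<open>N\<close>. As \<open>N\<close> is
  stable under the action this is a two-sided ideal, so it absorbs everything that is set to zero in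
  U as soon as it contains the generators.\<close>

definition Ann :: "('i u_gen, 'k) nc_poly set" where "Ann = {a. \<forall>x. act a x \<in> N}"

lemma ideal_Ann: "ideal Ann free_algebra"
proof (rule idealI)
  interpret kalg "free_algebra :: (('i u_gen, 'k) nc_poly, 'k) kalgebra" by (rule kalg_free)
  show "ring (free_algebra :: (('i u_gen, 'k) nc_poly, 'k) kalgebra)" by (rule ring_axioms)
  have z: "Ann \<noteq> {}" by (auto simp: Ann_def N_closed intro!: exI[of _ 0])
  show "subgroup Ann (add_monoid free_algebra)"
    by (rule add.subgroupI)
      (use z in \<open>auto simp: Ann_def act_simps N_closed pm.subspace_neg[OF N_subspace]\<close>)
qed (auto simp: Ann_def act_simps act_N)

lemma Ut_relations_act: "r \<in> Ut_relations chi \<Longrightarrow> act r x = 0"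
  by (auto simp: Ut_relations_def Let_def act_simps opK_opL opK_opK[of _ _ x] opK_opE opK_opF opE_opF
      split: if_splits)

lemma Ut_ideal_Ann: "Ut_ideal chi \<subseteq> Ann"
  unfolding Ut_ideal_def
  by (rule ring.genideal_minimal[OF kalg.axioms(1)[OF kalg_free] ideal_Ann])
    (auto simp: Ann_def Ut_relations_act N_closed)

abbreviation "Eemb \<equiv> nc_eval free_algebra (\<lambda>i. letter (GE i))"
abbreviation "Femb \<equiv> nc_eval free_algebra (\<lambda>i. letter (GF i))"

lemma sing_letter_mult: "letter i * sing w c = sing (Word [i] + w) c"
  by (simp add: letter_def mult_single)

lemma emb_letter:
  "Eemb (sing (Word [i] + w) 1) = letter (GE i) * Eemb (sing w 1)"
  "Femb (sing (Word [i] + w) 1) = letter (GF i) * Femb (sing w 1)"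
  using nc_eval_free_mult[of _ "letter i" "sing w 1"]
  by (simp_all add: nc_eval_free_letter flip: sing_letter_mult)

lemma emb_sing_letter: "Eemb (sing (Word [i]) 1) = letter (GE i)" "Femb (sing (Word [i]) 1) = letter (GF i)"
  using nc_eval_free_letter[of _ i] unfolding letter_def by blast+

lemma emb_one [simp]: "Eemb 1 = 1" "Femb 1 = 1" by (simp_all add: nc_eval_free_one)

lemma act_Eemb: "act (Eemb x) (tri p m q) = tri (x * p) m q"
proof -
  have "act (Eemb (sing w 1)) (tri p m q) = tri (sing w 1 * p) m q" for w
  proof (induction w rule: word_induct)
    case (letter i w)
    then show ?case
      by (simp add: emb_letter act_mult opE_tri mult.assoc[symmetric] mult_single)
  qed simp
  note * = this
  show ?thesis
    by (rule lin_eqI[of "\<lambda>x. act (Eemb x) (tri p m q)" "\<lambda>x. tri (x * p) m q"])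
      (use * in \<open>auto intro!: lin_compose[OF lin_act_left] nc_eval_free_lin tri_intros\<close>)
qed

text \<open>Without letters E no commutator arises: the letters F only have to pass K_m, which is
  the twist by \<chi>(m, -).\<close>

lemma act_Femb: "act (Femb x) (tri 1 m q) = tri 1 m (tw (chi m) x * q)"
proof -
  have "act (Femb (sing w 1)) (tri 1 m q) = tri 1 m (tw (chi m) (sing w 1) * q)" for w
  proof (induction w rule: word_induct)
    case (letter i w)
    have "act (Femb (sing (Word [i] + w) 1)) (tri 1 m q) =
        chi m (alpha i) \<cdot> tri 1 m (sing (Word [i]) 1 * (tw (chi m) (sing w 1) * q))"
      using letter by (simp add: emb_letter act_mult opF_tri lin_zero[OF lin_tri_left])
    also have "\<dots> = tri 1 m (chi m (alpha i) \<cdot> (sing (Word [i]) 1 * tw (chi m) (sing w 1) * q))"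
      by (simp only: lin_scale[OF lin_tri_right] mult.assoc)
    also have "chi m (alpha i) \<cdot> (sing (Word [i]) 1 * tw (chi m) (sing w 1) * q) =
        tw (chi m) (sing (Word [i] + w) 1) * q"
      by (simp add: mult_single chi_simps flip: mult_pscale_left)
    finally show ?case .
  qed simp
  note * = this
  show ?thesis
    by (rule lin_eqI[of "\<lambda>x. act (Femb x) (tri 1 m q)" "\<lambda>x. tri 1 m (tw (chi m) x * q)"])
      (use * in \<open>auto intro!: lin_compose[OF lin_act_left] nc_eval_free_lin tri_intros\<close>)
qed

lemma opK_act_Femb:
  "opK j (act (Femb (sing w 1)) x) = chim j (word_degree w) \<cdot> act (Femb (sing w 1)) (opK j x)"
  "opL j (act (Femb (sing w 1)) x) = chip j (word_degree w) \<cdot> act (Femb (sing w 1)) (opL j x)"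
  by (induction w rule: word_induct)
    (simp_all add: emb_letter act_mult opK_opF opL_opF lin_scale[OF lin_ops(2)] chi_simps)

text \<open>The mirror image of the formula behind \<open>opF\<close>. The torus elements created by
  commutators now travel to the right through letters F, which inverts their weights and so
  exchanges the two derivations.\<close>

lemma opE_act_Femb:
  "opE j (act (Femb x) y) = act (Femb x) (opE j y)
     + act (Femb (der (chim j) j x)) (opK j y) - act (Femb (der (chip j) j x)) (opL j y)"
proof -
  have "opE j (act (Femb (sing w 1)) y) = act (Femb (sing w 1)) (opE j y)
     + act (Femb (der (chim j) j (sing w 1))) (opK j y) - act (Femb (der (chip j) j (sing w 1))) (opL j y)" for w
  proof (induction w rule: word_induct)
    case zero
    then show ?case by (simp add: lin_zero[OF nc_eval_free_lin] lin_zero[OF lin_act_left])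
  next
    case (letter i w)
    have "Femb (sing w (chi a d)) = chi a d \<cdot> Femb (sing w 1)"
      "Femb (sing w (inverse (chi a d))) = inverse (chi a d) \<cdot> Femb (sing w 1)" for a d
      by (rule lin_sing[OF nc_eval_free_lin])+
    then show ?case
      by (simp add: emb_letter act_mult opE_opF letter lin_add[OF lin_ops(2)] lin_diff[OF lin_ops(2)]
          der_letter lin_add[OF nc_eval_free_lin] lin_zero[OF nc_eval_free_lin] nc_eval_free_mult
          emb_sing_letter act_simps opK_act_Femb)
  qed
  note * = this
  show ?thesis
    by (rule lin_eqI[of "\<lambda>x. opE j (act (Femb x) y)" "\<lambda>x. act (Femb x) (opE j y)
     + act (Femb (der (chim j) j x)) (opK j y) - act (Femb (der (chip j) j x)) (opL j y)"])
      (use * in \<open>auto intro!: lin_compose[OF lin_act_left] nc_eval_free_lin lin_compose[OF nc_eval_free_lin]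
        tri_intros op_intros\<close>)
qed

lemma Eemb_Ann: "x \<in> J \<Longrightarrow> Eemb x \<in> Ann"
proof -
  assume x: "x \<in> J"
  have "act (Eemb x) (sing (u, m, v) 1) \<in> N" for u m v
    using act_Eemb[of x "sing u 1" m "sing v 1"] x by (simp add: tri_sing N_tri J_mult_right)
  then have "act (Eemb x) y \<in> N" for y
    using lin_into_subspace[OF lin_act N_subspace, of y UNIV] by (auto simp: on_def)
  then show ?thesis by (simp add: Ann_def)
qed

text \<open>Induction on the word u of letters E, for all x in \<open>J\<close> at once: pulling the
  first letter of u out to the left leaves x and its two derivatives, all in \<open>J\<close>,
  acting on a shorter word. For empty u the action is the twisted product of
  \<open>act_Femb\<close>.\<close>

lemma Femb_Ann: "x \<in> J \<Longrightarrow> Femb x \<in> Ann"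
proof -
  have *: "act (Femb x) (tri (sing u 1) m q) \<in> N" if "x \<in> J" for x u m q
    using that
  proof (induction u arbitrary: x m rule: word_induct)
    case zero
    then show ?case by (simp add: act_Femb N_tri J_mult_right J_tw)
  next
    case (letter j u)
    have "act (Femb x) (opE j (tri (sing u 1) m q)) =
        opE j (act (Femb x) (tri (sing u 1) m q))
        - act (Femb (der (chim j) j x)) (opK j (tri (sing u 1) m q))
        + act (Femb (der (chip j) j x)) (opL j (tri (sing u 1) m q))"
      by (simp add: opE_act_Femb)
    then show ?case
      using opr_N[of _ "GE j"] letter.IH letter.prems J_der
      by (auto simp: opE_tri opK_tri_sing mult_single lin_scale[OF lin_act] intro!: N_closed)
  qed
  assume x: "x \<in> J"
  have "act (Femb x) (sing (u, m, v) 1) \<in> N" for u m v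
    using *[OF x, of u m "sing v 1"] by (simp add: tri_sing)
  then have "act (Femb x) y \<in> N" for y
    using lin_into_subspace[OF lin_act N_subspace, of y UNIV] by (auto simp: on_def)
  then show ?thesis by (simp add: Ann_def)
qed

end

section \<open>The triangular decomposition\<close>

definition cg :: "('g, 'k::field) nc_poly set \<Rightarrow> ('g, 'k) nc_poly \<Rightarrow> ('g, 'k) nc_poly \<Rightarrow> bool" where
  "cg I a b \<longleftrightarrow> a - b \<in> I"

lemma free_ideal_subspace: "ideal I free_algebra \<Longrightarrow> pm.subspace I" for I :: "('g, 'k::field) nc_poly set"
  by (simp add: pm.subspace_def free_ideal_zero free_ideal_add free_ideal_mult_left pscale_mult)

context
  fixes I :: "('g, 'k::field) nc_poly set"
  assumes I: "ideal I free_algebra"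
begin

lemma cg_refl: "cg I a a"
  by (simp add: cg_def free_ideal_zero[OF I])

lemma cg_sym: "cg I a b \<Longrightarrow> cg I b a"
  unfolding cg_def using pm.subspace_neg[OF free_ideal_subspace[OF I], of "a - b"] by simp

lemma cg_trans: "cg I a b \<Longrightarrow> cg I b c \<Longrightarrow> cg I a c"
  unfolding cg_def using free_ideal_add[OF I, of "a - b" "b - c"] by simp

lemma cg_add: "cg I a b \<Longrightarrow> cg I c d \<Longrightarrow> cg I (a + c) (b + d)"
  unfolding cg_def using free_ideal_add[OF I, of "a - b" "c - d"] by (simp add: algebra_simps)

lemma cg_diff: "cg I a b \<Longrightarrow> cg I c d \<Longrightarrow> cg I (a - c) (b - d)"
  unfolding cg_def using pm.subspace_diff[OF free_ideal_subspace[OF I], of "a - b" "c - d"]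
  by (simp add: algebra_simps)

lemma cg_scale: "cg I a b \<Longrightarrow> cg I (c \<cdot> a) (c \<cdot> b)"
  unfolding cg_def using pm.subspace_scale[OF free_ideal_subspace[OF I], of "a - b" c]
  by (simp add: pm.scale_right_diff_distrib)

lemma cg_left: "cg I a b \<Longrightarrow> cg I (x * a) (x * b)"
  unfolding cg_def using free_ideal_mult_left[OF I, of "a - b" x] by (simp add: algebra_simps)

lemma cg_right: "cg I a b \<Longrightarrow> cg I (a * x) (b * x)"
  unfolding cg_def using free_ideal_mult_right[OF I, of "a - b" x] by (simp add: algebra_simps)

text \<open>If conjugation by K scales X by c, conjugation by the inverse L scales it by 1/c: modulo
  the ideal, X L = L K X L = c L X K L = c L X.\<close>

lemma cg_inverse_commute:
  assumes KL: "cg I (K * L) 1" and LK: "cg I (L * K) 1" and X: "cg I (K * X) (c \<cdot> (X * K))" and c: "c \<noteq> 0"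
  shows "cg I (L * X) (inverse c \<cdot> (X * L))"
proof -
  have "cg I (X * L) (L * K * (X * L))" using cg_right[OF cg_sym[OF LK], of "X * L"] by simp
  moreover have "cg I (L * K * (X * L)) (c \<cdot> (L * X * (K * L)))"
    using cg_left[OF cg_right[OF X, of L], of L]
    by (simp add: mult.assoc mult_pscale_left mult_pscale_right)
  moreover have "cg I (c \<cdot> (L * X * (K * L))) (c \<cdot> (L * X))"
    using cg_scale[OF cg_left[OF KL, of "L * X"], of c] by simp
  ultimately have "cg I (X * L) (c \<cdot> (L * X))" by (blast intro: cg_trans)
  from cg_sym[OF cg_scale[OF this, of "inverse c"]] show ?thesis using c by simp
qed

text \<open>The scalar is left unspecified, because spanning arguments only need that the two
  factors may be exchanged.\<close>

definition qcomm :: "('g, 'k) nc_poly \<Rightarrow> ('g, 'k) nc_poly \<Rightarrow> bool" where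
  "qcomm x y \<longleftrightarrow> (\<exists>c. cg I (x * y) (c \<cdot> (y * x)))"

lemma qcomm_mult: "qcomm x y \<Longrightarrow> qcomm x z \<Longrightarrow> qcomm x (y * z)"
proof -
  assume "qcomm x y" "qcomm x z"
  then obtain c d where c: "cg I (x * y) (c \<cdot> (y * x))" and d: "cg I (x * z) (d \<cdot> (z * x))"
    by (auto simp: qcomm_def)
  have "cg I (x * (y * z)) (c \<cdot> (y * (x * z)))"
    using cg_right[OF c, of z] by (simp add: mult.assoc mult_pscale_left)
  moreover have "cg I (c \<cdot> (y * (x * z))) (c \<cdot> d \<cdot> (y * z * x))"
    using cg_scale[OF cg_left[OF d, of y], of c] by (simp add: mult.assoc mult_pscale_right)
  ultimately have "cg I (x * (y * z)) ((c * d) \<cdot> (y * z * x))" using cg_trans by fastforce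
  then show ?thesis by (auto simp: qcomm_def)
qed

lemma qcomm_one: "qcomm x 1"
  using cg_refl[of x] by (auto simp: qcomm_def intro!: exI[of _ 1])

lemma qcomm_power: "qcomm x y \<Longrightarrow> qcomm x (y ^ n)"
  by (induction n) (auto simp: qcomm_one intro: qcomm_mult)

lemma qcomm_prod_list: "(\<And>y. y \<in> set ys \<Longrightarrow> qcomm x y) \<Longrightarrow> qcomm x (prod_list ys)"
  by (induction ys) (auto simp: qcomm_one intro: qcomm_mult)

lemma cg_commute_power: "cg I (x * y) (y * x) \<Longrightarrow> cg I (x * y ^ n) (y ^ n * x)"
proof (induction n)
  case (Suc n)
  have "cg I (x * (y * y ^ n)) (y * (x * y ^ n))"
    using cg_right[OF Suc.prems, of "y ^ n"] by (simp add: mult.assoc)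
  moreover have "cg I (y * (x * y ^ n)) (y * y ^ n * x)"
    using cg_left[OF Suc.IH[OF Suc.prems], of y] by (simp add: mult.assoc)
  ultimately show ?case using cg_trans by simp
qed (simp add: cg_refl)

text \<open>The element x travels through the factors with which it commutes and merges with the
  i-th one, which \<open>distinct\<close> makes unique. This serves K_l, which is a product in the
  order of the index type.\<close>

lemma cg_prod_list_shift:
  assumes "distinct L" "i \<in> set L"
    and "cg I (x * f i) (g i)" "\<And>j. j \<noteq> i \<Longrightarrow> cg I (x * f j) (f j * x)" "\<And>j. j \<noteq> i \<Longrightarrow> g j = f j"
  shows "cg I (x * prod_list (map f L)) (prod_list (map g L))"
  using assms(1,2)
proof (induction L)
  case (Cons j L)
  show ?case
  proof (cases "j = i")
    case True
    then have m: "map g L = map f L" using Cons.prems by (intro map_cong assms(5)) auto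
    show ?thesis unfolding list.map m
      using cg_right[OF assms(3), of "prod_list (map f L)"] True by (simp add: mult.assoc)
  next
    case False
    then have "cg I (x * (f j * prod_list (map f L))) (f j * (x * prod_list (map f L)))"
      using cg_right[OF assms(4)[of j], of "prod_list (map f L)"] by (simp add: mult.assoc)
    moreover have "cg I (f j * (x * prod_list (map f L))) (f j * prod_list (map g L))"
      using False Cons by (intro cg_left) auto
    ultimately show ?thesis using cg_trans False assms(5) by auto
  qed
qed simp

end

lemma (in kalg) ideal_vsub: "ideal I A \<Longrightarrow> vsub I"
  using additive_subgroup.a_closed[OF ideal.axioms(1), of I A] ideal.I_l_closed[of I A]
    additive_subgroup.zero_closed[OF ideal.axioms(1), of I A]
    additive_subgroup.a_subset[OF ideal.axioms(1), of I A]
  unfolding vsub_def by blast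

section \<open>The relations of Ut and the involution omega\<close>

context pre_nichols
begin

abbreviation "I0 \<equiv> Ut_ideal chi"

lemma ideal_I0: "ideal I0 free_algebra"
  unfolding Ut_ideal_def by (rule ring.genideal_ideal[OF kalg.axioms(1)[OF kalg_free]]) simp

lemma I0_base: "r \<in> Ut_relations chi \<Longrightarrow> r \<in> I0"
  unfolding Ut_ideal_def using ring.genideal_self[OF kalg.axioms(1)[OF kalg_free], of "Ut_relations chi"] by auto

abbreviation "gE i \<equiv> letter (GE i)"
abbreviation "gF i \<equiv> letter (GF i)"
abbreviation "gK i \<equiv> letter (GK i)"
abbreviation "gL i \<equiv> letter (GKinv i)"

lemma I0_relations:
  "cg I0 (gK i * gL i) 1" "cg I0 (gL i * gK i) 1" "cg I0 (gK i * gK j) (gK j * gK i)"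
  "cg I0 (gK i * gE j) (chip i (alpha j) \<cdot> (gE j * gK i))"
  "cg I0 (gK i * gF j) (chim i (alpha j) \<cdot> (gF j * gK i))"
  "cg I0 (gE i * gF j) (gF j * gE i + (if i = j then gK i - gL i else 0))"
proof -
  show "cg I0 (gK i * gL i) 1" "cg I0 (gL i * gK i) 1" "cg I0 (gK i * gK j) (gK j * gK i)"
    unfolding cg_def by (rule I0_base, force simp: Ut_relations_def Let_def)+
  show "cg I0 (gK i * gE j) (chip i (alpha j) \<cdot> (gE j * gK i))"
    "cg I0 (gK i * gF j) (chim i (alpha j) \<cdot> (gF j * gK i))"
    unfolding cg_def pscale_mult mult.assoc[symmetric]
    by (rule I0_base, unfold Ut_relations_def Let_def, blast)+
  show "cg I0 (gE i * gF j) (gF j * gE i + (if i = j then gK i - gL i else 0))"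
    unfolding cg_def diff_diff_add[symmetric]
    by (rule I0_base, unfold Ut_relations_def Let_def, blast)
qed

lemma I0_L_relations:
  "cg I0 (gL i * gK j) (gK j * gL i)" "cg I0 (gK j * gL i) (gL i * gK j)" "cg I0 (gL i * gL j) (gL j * gL i)"
  "cg I0 (gL i * gE j) (chim i (alpha j) \<cdot> (gE j * gL i))"
  "cg I0 (gL i * gF j) (chip i (alpha j) \<cdot> (gF j * gL i))"
proof -
  note inv = cg_inverse_commute[OF ideal_I0 I0_relations(1,2)]
  show 1: "cg I0 (gL i * gK j) (gK j * gL i)" for i j using inv[of i "gK j" 1] I0_relations(3)[of i j] by simp
  show "cg I0 (gK j * gL i) (gL i * gK j)" by (rule cg_sym[OF ideal_I0 1])
  show "cg I0 (gL i * gL j) (gL j * gL i)"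
    using inv[of i "gL j" 1] cg_sym[OF ideal_I0 1[of j i]] by simp
  show "cg I0 (gL i * gE j) (chim i (alpha j) \<cdot> (gE j * gL i))"
    by (rule inv[OF I0_relations(4)]) simp
  show "cg I0 (gL i * gF j) (chip i (alpha j) \<cdot> (gF j * gL i))"
    using inv[OF I0_relations(5), of i j] by simp
qed

abbreviation "Om \<equiv> nc_eval free_algebra (\<lambda>g. letter (omega_gen g) :: ('i u_gen, 'k) nc_poly)"

lemma Om_simps: "Om (a * b) = Om a * Om b" "Om (a + b) = Om a + Om b" "Om (a - b) = Om a - Om b"
  "Om (letter g) = letter (omega_gen g)" "Om 1 = 1" "Om (c \<cdot> a) = c \<cdot> Om a" "Om 0 = 0"
  using lin_add[OF nc_eval_free_lin] lin_diff[OF nc_eval_free_lin] lin_scale[OF nc_eval_free_lin]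
    lin_zero[OF nc_eval_free_lin]
  by (simp_all add: nc_eval_free_mult nc_eval_free_letter nc_eval_free_one)

lemma omega_gen_involution: "omega_gen (omega_gen g) = g" by (cases g) auto

lemma Om_Om: "Om (Om x) = x"
proof -
  have "Om (Om (sing w 1)) = sing w 1" for w
  proof (induction w rule: word_induct)
    case (letter g w)
    then show ?case by (simp add: Om_simps omega_gen_involution flip: sing_letter_mult)
  qed (simp add: Om_simps)
  then show ?thesis
    by (rule lin_eqI[OF lin_compose[OF nc_eval_free_lin nc_eval_free_lin] lin_id])
qed

lemma Om_Eemb: "Om (Eemb x) = Femb x"
proof -
  have "Om (Eemb (sing w 1)) = Femb (sing w 1)" for w
  proof (induction w rule: word_induct)
    case (letter g w)
    then show ?case by (simp add: emb_letter Om_simps)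
  qed (simp add: Om_simps)
  then show ?thesis
    by (rule lin_eqI[OF lin_compose[OF nc_eval_free_lin nc_eval_free_lin] nc_eval_free_lin])
qed

text \<open>The preimage of the ideal under \<open>Om\<close> is an ideal containing the defining
  relations, whose images are consequences of the same relations. The involution turns the inclusion
  into an equality, which is needed because \<open>omega\<close> takes images of whole
  cosets.\<close>

lemma Om_I0: "Om ` I0 = I0"
proof -
  have cgd: "cg I0 a b \<Longrightarrow> a - b \<in> I0" for a b by (simp add: cg_def)
  have sc: "sing 0 c * a * b = c \<cdot> (a * b)" for c and a b :: "('i u_gen, 'k) nc_poly"
    by (simp add: pscale_mult mult.assoc)
  have rel: "Om r \<in> I0" if "r \<in> Ut_relations chi" for r
  proof -
    have 1: "Om (gK i * gL i - 1) \<in> I0" "Om (gL i * gK i - 1) \<in> I0"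
      "Om (gK i * gK j - gK j * gK i) \<in> I0"
      "Om (gK i * gE j - sing 0 (chip i (alpha j)) * gE j * gK i) \<in> I0"
      "Om (gK i * gF j - sing 0 (inverse (chip i (alpha j))) * gF j * gK i) \<in> I0" for i j
      unfolding sc Om_simps omega_gen.simps by (intro cgd I0_relations I0_L_relations)+
    have "Om (gE i * gF j - gF j * gE i - (if i = j then gK i - gL i else 0)) =
        - (gE j * gF i - (gF i * gE j + (if j = i then gK j - gL j else 0)))" for i j
      by (auto simp: Om_simps)
    moreover have "gE j * gF i - (gF i * gE j + (if j = i then gK j - gL j else 0)) \<in> I0" for i j
      by (rule cgd[OF I0_relations(6)])
    ultimately have 2: "Om (gE i * gF j - gF j * gE i - (if i = j then gK i - gL i else 0)) \<in> I0" for i j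
      using pm.subspace_neg[OF free_ideal_subspace[OF ideal_I0]] by presburger
    from that show ?thesis unfolding Ut_relations_def Let_def
      by (elim UnE CollectE exE conjE) (simp_all only: 1 2)
  qed
  interpret free: kalg "free_algebra :: (('i u_gen, 'k) nc_poly, 'k) kalgebra" by (rule kalg_free)
  have "ideal {a. Om a \<in> I0} free_algebra"
  proof (rule idealI[OF free.ring_axioms])
    show "subgroup {a. Om a \<in> I0} (add_monoid free_algebra)"
      using free_ideal_zero[OF ideal_I0]
      by (intro free.add.subgroupI)
        (auto intro!: exI[of _ 0] simp: Om_simps lin_uminus[OF nc_eval_free_lin] free_ideal_add[OF ideal_I0]
          pm.subspace_neg[OF free_ideal_subspace[OF ideal_I0]] simp flip: a_inv_def
)
  qed (auto simp: Om_simps free_ideal_mult_left[OF ideal_I0] free_ideal_mult_right[OF ideal_I0])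
  then have "Idl\<^bsub>free_algebra\<^esub> (Ut_relations chi) \<subseteq> {a. Om a \<in> I0}"
    by (rule free.genideal_minimal) (auto simp: rel)
  then have *: "Om a \<in> I0" if "a \<in> I0" for a using that unfolding Ut_ideal_def by blast
  then show ?thesis using Om_Om by (auto simp: image_iff) metis
qed

section \<open>The quotient maps from the free algebra to Ut and U\<close>

definition q0 :: "('i u_gen, 'k) nc_poly \<Rightarrow> ('i, 'k) ut" where "q0 a = I0 +>\<^bsub>free_algebra\<^esub> a"
definition qU :: "('i u_gen, 'k) nc_poly \<Rightarrow> ('i, 'k) u" where
  "qU a = U_ideal chi J +>\<^bsub>Ut chi\<^esub> q0 a"

abbreviation "U \<equiv> U_alg chi J"

lemma kalg_Ut: "kalg (Ut chi)"
  unfolding Ut_def by (rule kalg_alg_quot[OF kalg_free ideal_I0])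

lemma q0_hom: "q0 \<in> ring_hom free_algebra (Ut chi)"
  using alg_quot_ring_hom[OF ideal_I0] unfolding q0_def[abs_def] Ut_def .

lemma q0_scal: "q0 (sing 0 c) = scal (Ut chi) c"
  by (simp add: q0_def Ut_def alg_quot_simps)

lemma carrier_Ut: "carrier (Ut chi) = range q0"
  by (auto simp: Ut_def alg_quot_simps FactRing_def A_RCOSETS_def' q0_def)

lemma q0_eq: "q0 a = q0 b \<longleftrightarrow> a - b \<in> I0"
  unfolding q0_def using kalg.coset_eq[OF kalg_free kalg.ideal_vsub[OF kalg_free ideal_I0], of a b]
  by (simp add: a_minus_def)

lemma q0_simps: "q0 (a + b) = q0 a \<oplus>\<^bsub>Ut chi\<^esub> q0 b" "q0 (a * b) = q0 a \<otimes>\<^bsub>Ut chi\<^esub> q0 b"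
  "q0 1 = \<one>\<^bsub>Ut chi\<^esub>"
  using ring_hom_add[OF q0_hom] ring_hom_mult[OF q0_hom] ring_hom_one[OF q0_hom] by simp_all

lemma q0_zero: "q0 0 = \<zero>\<^bsub>Ut chi\<^esub>"
proof -
  interpret Ut: kalg "Ut chi" by (rule kalg_Ut)
  have "q0 0 \<oplus>\<^bsub>Ut chi\<^esub> q0 0 = q0 0" using q0_simps(1)[of 0 0] by simp
  then show ?thesis using carrier_Ut by (simp add: Ut.add.l_cancel_one)
qed

lemma q0_uminus: "q0 (- a) = \<ominus>\<^bsub>Ut chi\<^esub> q0 a"
proof -
  interpret Ut: kalg "Ut chi" by (rule kalg_Ut)
  show ?thesis using q0_simps(1)[of "- a" a] Ut.minus_equality[of "q0 (- a)" "q0 a"] carrier_Ut q0_zero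
    by simp
qed

lemma Ut_embed_eq: "Ut_embed chi J = q0 ` Eemb ` J"
proof -
  have "nc_eval (Ut chi) (\<lambda>i. Ut_gen chi (GE i)) x = q0 (Eemb x)" for x
    using nc_eval_hom[OF kalg_free kalg_Ut q0_hom, of "\<lambda>i. gE i" x]
    by (simp add: q0_scal Ut_gen_def flip: q0_def)
  then show ?thesis by (simp add: Ut_embed_def image_image)
qed

lemma omega_q0: "omega (q0 a) = q0 (Om a)"
proof -
  have q: "q0 b = (\<lambda>r. r + b) ` I0" for b
    by (auto simp: q0_def a_r_coset_def')
  have "omega (q0 a) = (\<lambda>r. r + Om a) ` Om ` I0"
    unfolding omega_def q[of a] by (simp add: image_image Om_simps)
  then show ?thesis unfolding Om_I0 q[of "Om a"] .
qed

lemma U_ideal_eq: "U_ideal chi J = Idl\<^bsub>Ut chi\<^esub> (q0 ` (Eemb ` J \<union> Femb ` J))"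
  unfolding U_ideal_def Ut_embed_eq by (simp add: image_image omega_q0 Om_Eemb image_Un)

lemma ideal_U_ideal: "ideal (U_ideal chi J) (Ut chi)"
  unfolding U_ideal_eq
  by (rule ring.genideal_ideal[OF kalg.axioms(1)[OF kalg_Ut]]) (auto simp: carrier_Ut)

lemma ideal_q0_Ann: "ideal (q0 ` Ann) (Ut chi)"
proof -
  interpret Ut: kalg "Ut chi" by (rule kalg_Ut)
  note cl = free_ideal_add[OF ideal_Ann] free_ideal_mult_left[OF ideal_Ann]
    free_ideal_mult_right[OF ideal_Ann] free_ideal_zero[OF ideal_Ann]
    pm.subspace_neg[OF free_ideal_subspace[OF ideal_Ann]]
  show ?thesis
  proof (rule idealI[OF Ut.ring_axioms])
    show "subgroup (q0 ` Ann) (add_monoid (Ut chi))"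
    proof (rule Ut.add.subgroupI)
      show "q0 ` Ann \<subseteq> carrier (Ut chi)" by (auto simp: carrier_Ut)
      show "q0 ` Ann \<noteq> {}" using cl(4) by auto
    next
      fix x assume "x \<in> q0 ` Ann"
      then show "\<ominus>\<^bsub>Ut chi\<^esub> x \<in> q0 ` Ann"
        using cl(5) by (auto simp flip: q0_uminus)
    next
      fix x y assume "x \<in> q0 ` Ann" "y \<in> q0 ` Ann"
      then show "x \<oplus>\<^bsub>Ut chi\<^esub> y \<in> q0 ` Ann" using cl(1) by (auto simp flip: q0_simps)
    qed
  qed (use cl(2,3) in \<open>auto simp: carrier_Ut simp flip: q0_simps\<close>)
qed

text \<open>The image of \<open>Ann\<close> in \<open>Ut\<close> is an ideal containing both copies
  of \<open>J\<close>. Passing back to the free algebra changes an element only by relations, and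
  these lie in \<open>Ann\<close>.\<close>

lemma U_ideal_Ann: "q0 a \<in> U_ideal chi J \<Longrightarrow> a \<in> Ann"
proof -
  assume "q0 a \<in> U_ideal chi J"
  moreover have "U_ideal chi J \<subseteq> q0 ` Ann"
    unfolding U_ideal_eq
    by (rule ring.genideal_minimal[OF kalg.axioms(1)[OF kalg_Ut] ideal_q0_Ann])
      (auto simp: Eemb_Ann Femb_Ann)
  ultimately obtain b where b: "b \<in> Ann" "q0 a = q0 b" by auto
  then have "a - b \<in> Ann" using Ut_ideal_Ann q0_eq by auto
  then show "a \<in> Ann" using free_ideal_add[OF ideal_Ann, of "a - b" b] b by simp
qed

lemma U_ideal_emb: "x \<in> J \<Longrightarrow> q0 (Eemb x) \<in> U_ideal chi J" "x \<in> J \<Longrightarrow> q0 (Femb x) \<in> U_ideal chi J"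
  unfolding U_ideal_eq
  using ring.genideal_self[OF kalg.axioms(1)[OF kalg_Ut], of "q0 ` (Eemb ` J \<union> Femb ` J)"]
  by (auto simp: carrier_Ut)

lemma kalg_U: "kalg U"
  unfolding U_alg_def by (rule kalg_alg_quot[OF kalg_Ut ideal_U_ideal])

sublocale U: kalg U by (rule kalg_U)

lemma qU_hom: "qU \<in> ring_hom free_algebra U"
proof -
  have "(+>\<^bsub>Ut chi\<^esub>) (U_ideal chi J) \<circ> q0 \<in> ring_hom free_algebra U"
    using ring_hom_trans[OF q0_hom alg_quot_ring_hom[OF ideal_U_ideal]] unfolding U_alg_def .
  then show ?thesis by (simp add: qU_def[abs_def] comp_def)
qed

lemma qU_scal: "qU (sing 0 c) = scal U c"
  by (simp add: qU_def U_alg_def alg_quot_simps q0_scal)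

lemma carrier_U: "carrier U = range qU"
  by (auto simp: U_alg_def alg_quot_simps FactRing_def A_RCOSETS_def' qU_def carrier_Ut)

lemma qU_closed [simp]: "qU a \<in> carrier U" by (simp add: carrier_U)

lemma qU_simps: "qU (a + b) = qU a \<oplus>\<^bsub>U\<^esub> qU b" "qU (a * b) = qU a \<otimes>\<^bsub>U\<^esub> qU b"
  "qU 1 = \<one>\<^bsub>U\<^esub>"
  using ring_hom_add[OF qU_hom] ring_hom_mult[OF qU_hom] ring_hom_one[OF qU_hom] by simp_all

lemma qU_linto: "U.linto qU"
  by (simp add: U.linto_def qU_simps pscale_mult qU_scal)

lemma qU_zero_iff: "qU a = \<zero>\<^bsub>U\<^esub> \<longleftrightarrow> q0 a \<in> U_ideal chi J"
proof -
  interpret Ut: kalg "Ut chi" by (rule kalg_Ut)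
  have "\<zero>\<^bsub>U\<^esub> = U_ideal chi J" by (simp add: U_alg_def alg_quot_simps FactRing_simps)
  then show ?thesis
    using Ut.coset_eq_self[OF Ut.ideal_vsub[OF ideal_U_ideal], of "q0 a"] carrier_Ut
    by (simp add: qU_def)
qed

lemma qU_gen: "U_gen chi J g = qU (letter g)"
  by (simp add: U_gen_def Ut_gen_def qU_def q0_def)

lemma qU_nc_eval: "nc_eval U (\<lambda>g. qU (v g)) p = qU (nc_eval free_algebra v p)"
  using nc_eval_hom[OF kalg_free kalg_U qU_hom, of v p] by (simp add: qU_scal)

lemma qU_power: "qU (a ^ n) = qU a [^]\<^bsub>U\<^esub> n"
  by (induction n) (simp_all add: qU_simps power_Suc2 del: power_Suc)

lemma qU_prod_list: "list_prod U (map qU xs) = qU (prod_list xs)"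
  by (induction xs) (simp_all add: qU_simps)

text \<open>The kernel of the map onto U; congruences modulo it replace computations with cosets of
  cosets.\<close>

definition KI :: "('i u_gen, 'k) nc_poly set" where "KI = {a. qU a = \<zero>\<^bsub>U\<^esub>}"

lemma KI_Ann: "a \<in> KI \<Longrightarrow> a \<in> Ann"
  using U_ideal_Ann by (simp add: KI_def qU_zero_iff)

lemma ideal_KI: "ideal KI free_algebra"
proof -
  interpret free: kalg "free_algebra :: (('i u_gen, 'k) nc_poly, 'k) kalgebra" by (rule kalg_free)
  show ?thesis
  proof (rule idealI[OF free.ring_axioms])
    show "subgroup KI (add_monoid free_algebra)"
    proof (rule free.add.subgroupI)
      show "KI \<noteq> {}" using U.linto_zero[OF qU_linto] by (auto simp: KI_def)
    qed (auto simp: KI_def qU_simps U.linto_uminus[OF qU_linto] simp flip: a_inv_def)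
  qed (auto simp: KI_def qU_simps)
qed

lemma qU_eq: "qU a = qU b \<longleftrightarrow> cg KI a b"
  by (simp add: cg_def KI_def U.linto_diff[OF qU_linto] U.r_right_minus_eq)

lemma I0_KI: "cg I0 a b \<Longrightarrow> cg KI a b"
proof -
  assume "cg I0 a b"
  then have "q0 a = q0 b" by (simp add: q0_eq cg_def)
  then show "cg KI a b" unfolding qU_eq[symmetric] qU_def by simp
qed

lemmas KI_relations = I0_relations[THEN I0_KI] I0_L_relations[THEN I0_KI]

section \<open>Torus monomials\<close>

definition kf :: "'i zn \<Rightarrow> 'i \<Rightarrow> ('i u_gen, 'k) nc_poly" where
  "kf l i = (if 0 \<le> l $ i then gK i ^ nat (l $ i) else gL i ^ nat (- (l $ i)))"

definition Kf :: "'i zn \<Rightarrow> ('i u_gen, 'k) nc_poly" where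
  "Kf l = prod_list (map (kf l) (sorted_list_of_set UNIV))"

lemma U_K_eq: "U_K chi J l = qU (Kf l)"
  unfolding U_K_def Kf_def qU_prod_list[symmetric] map_map comp_def kf_def
  by (simp add: U_Ki_def U_Kinv_def qU_gen qU_power if_distrib[of qU] cong: if_cong)

lemma alpha_nth: "alpha i $ j = (if i = j then 1 else 0)"
  by (simp add: alpha_def axis_def)

lemma Kf_zero: "Kf 0 = 1"
proof -
  have "prod_list (map (kf 0) L) = 1" for L :: "'i list" by (induction L) (auto simp: kf_def)
  then show ?thesis by (simp add: Kf_def)
qed

lemma Kf_add: "cg KI (gK i * Kf l) (Kf (l + alpha i))"
  unfolding Kf_def
proof (rule cg_prod_list_shift[OF ideal_KI, where i = i])
  show "cg KI (gK i * kf l i) (kf (l + alpha i) i)"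
  proof (cases "0 \<le> l $ i")
    case True
    then have "nat (l $ i + 1) = Suc (nat (l $ i))" by simp
    then show ?thesis using True by (simp add: kf_def alpha_nth cg_refl[OF ideal_KI])
  next
    case False
    define n where "n = nat (- (l $ i) - 1)"
    have n: "nat (- (l $ i)) = Suc n" using False by (simp add: n_def)
    \<comment> \<open>For the exponent - 1 the sum is 0 and the definition switches to its other
      branch; there n = 0 too and both powers are 1.\<close>
    have "kf (l + alpha i) i = gL i ^ n"
    proof (cases "l $ i = - 1")
      case False
      then have "nat (- (l $ i + 1)) = n" by (simp add: n_def)
      then show ?thesis using \<open>\<not> 0 \<le> l $ i\<close> False by (auto simp: kf_def alpha_nth)
    qed (simp add: kf_def alpha_nth n_def)
    then show ?thesis
      using cg_right[OF ideal_KI KI_relations(1)[of i], of "gL i ^ n"] False n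
      by (simp add: kf_def mult.assoc)
  qed
  show "cg KI (gK i * kf l j) (kf l j * gK i)" for j
    by (auto simp: kf_def intro!: cg_commute_power[OF ideal_KI] KI_relations)
qed (auto simp: kf_def alpha_nth)

lemma Kf_diff: "cg KI (gL i * Kf l) (Kf (l - alpha i))"
  unfolding Kf_def
proof (rule cg_prod_list_shift[OF ideal_KI, where i = i])
  show "cg KI (gL i * kf l i) (kf (l - alpha i) i)"
  proof (cases "0 < l $ i")
    case False
    then have "nat (1 - l $ i) = Suc (nat (- (l $ i)))" by simp
    then show ?thesis using False by (auto simp: kf_def alpha_nth cg_refl[OF ideal_KI])
  next
    case True
    define n where "n = nat (l $ i - 1)"
    have n: "nat (l $ i) = Suc n" using True by (simp add: n_def)
    have "kf (l - alpha i) i = gK i ^ n"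
      using True by (auto simp: kf_def alpha_nth n_def)
    then show ?thesis
      using cg_right[OF ideal_KI KI_relations(2)[of i], of "gK i ^ n"] True n
      by (simp add: kf_def mult.assoc)
  qed
  show "cg KI (gL i * kf l j) (kf l j * gL i)" for j
    by (auto simp: kf_def intro!: cg_commute_power[OF ideal_KI] KI_relations)
qed (auto simp: kf_def alpha_nth)

abbreviation "qc \<equiv> qcomm KI"

lemma qcomm_letters: "qc (gF i) (gK j)" "qc (gF i) (gL j)" "qc (gK j) (gE i)" "qc (gL j) (gE i)"
proof -
  show "qc (gK j) (gE i)" "qc (gL j) (gE i)"
    unfolding qcomm_def[OF ideal_KI] using KI_relations by blast+
  have sw: "qc y x" if "cg KI (x * y) (c \<cdot> (y * x))" "c \<noteq> 0" for x y c
    using cg_sym[OF ideal_KI cg_scale[OF ideal_KI that(1), of "inverse c"]] that(2)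
    unfolding qcomm_def[OF ideal_KI] by auto
  show "qc (gF i) (gK j)" by (rule sw[OF KI_relations(5)]) simp
  show "qc (gF i) (gL j)" by (rule sw[OF KI_relations(11)]) simp
qed

lemma qcomm_gF_Kf: "qc (gF i) (Kf l)"
  unfolding Kf_def
  by (rule qcomm_prod_list[OF ideal_KI])
    (auto simp: kf_def intro!: qcomm_power[OF ideal_KI] qcomm_letters)

lemma qcomm_Eemb: "qc (gK j) (Eemb (sing w 1))" "qc (gL j) (Eemb (sing w 1))"
  by (induction w rule: word_induct)
    (auto simp: emb_letter intro: qcomm_one[OF ideal_KI] qcomm_mult[OF ideal_KI] qcomm_letters)

section \<open>Normal forms and the isomorphism of the quotient by N with U\<close>

definition lift :: "('i, 'k) tri \<Rightarrow> ('i u_gen, 'k) nc_poly" where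
  "lift = lext (\<lambda>(u, m, v). Eemb (sing u 1) * Kf m * Femb (sing v 1))"

lemma lin_lift [simp]: "lin lift" by (simp add: lift_def)

lemma lift_tri: "lift (tri p m q) = Eemb p * Kf m * Femb q"
  by (rule bilin_eqI[of "\<lambda>p q. lift (tri p m q)"])
    (auto intro!: lin_compose[OF lin_lift] lin_tri_left lin_tri_right lin_intros
      nc_eval_free_lin simp: tri_sing lift_def)

definition X1 :: "('i, 'k) tri" where "X1 = sing (0, 0, 0) 1"

lemma tri_one: "tri 1 m (sing v c) = (sing (0, m, v) c :: ('i, 'k) tri)"
  using tri_sing[of 0 1 m v c] by simp

lemma X1_tri: "X1 = tri 1 0 1"
  using tri_one[of 0 0 1] by (simp add: X1_def)

lemma lift_X1: "lift X1 = 1" by (simp add: X1_tri lift_tri Kf_zero)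

text \<open>Being K_l, as seen by the action. It is used for \<open>Kf\<close> and later for
  products of the generators of \<open>U_poly\<close>, whose values in U are compared through what
  they do to basis vectors.\<close>

definition acts :: "('i u_gen, 'k) nc_poly \<Rightarrow> 'i zn \<Rightarrow> bool" where
  "acts a l \<longleftrightarrow> (\<forall>u m v. act a (sing (u, m, v) 1) = sing (u, m + l, v) (chi l (word_degree u)))"

lemma acts_one: "acts 1 0" by (simp add: acts_def)

lemma acts_mult: "acts a l \<Longrightarrow> acts b m \<Longrightarrow> acts (a * b) (l + m)"
  by (simp add: acts_def act_mult lin_sing[OF lin_act, of a "(_, _, _)" "chi _ _"] chi_simps ac_simps)

lemma acts_letters: "acts (gK i) (alpha i)" "acts (gL i) (- alpha i)"
  by (simp_all add: acts_def opr_sing chi_simps)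

lemma acts_power: "acts a l \<Longrightarrow> acts (a ^ n) (of_nat n *s l)"
proof (induction n)
  case (Suc n)
  have "of_nat (Suc n) *s l = l + of_nat n *s l"
    by (simp add: vec_eq_iff algebra_simps)
  then show ?case using acts_mult[OF Suc.prems Suc.IH[OF Suc.prems]] by simp
qed (simp add: acts_one)

lemma acts_kf: "acts (kf l i) (l $ i *s alpha i)"
proof (cases "0 \<le> l $ i")
  case True
  then have "l $ i = of_nat (nat (l $ i))" by simp
  then show ?thesis using acts_power[OF acts_letters(1)[of i], of "nat (l $ i)"] True by (simp add: kf_def)
next
  case False
  then have "l $ i *s alpha i = of_nat (nat (- (l $ i))) *s (- alpha i)"
    by (simp add: vec_eq_iff)
  then show ?thesis using acts_power[OF acts_letters(2)[of i], of "nat (- (l $ i))"] False by (simp add: kf_def)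
qed

lemma sum_alpha: "(\<Sum>i\<in>UNIV. l $ i *s alpha i) = l"
  by (simp add: vec_eq_iff alpha_nth sum_component if_distrib cong: if_cong)

lemma acts_Kf: "acts (Kf l) l"
proof -
  have "acts (prod_list (map (kf l) L)) (sum_list (map (\<lambda>i. l $ i *s alpha i) L))" for L
    by (induction L) (auto simp: acts_one acts_kf intro: acts_mult)
  moreover have "sum_list (map (\<lambda>i. l $ i *s alpha i) (sorted_list_of_set UNIV)) = l"
    by (simp add: sum_list_distinct_conv_sum_set sum_alpha)
  ultimately show ?thesis unfolding Kf_def by metis
qed

text \<open>Applied to the vector of 1, the factors F_v, K_m and E_u create the three entries one
  after the other, without commutators. This is the independence half of the decomposition.\<close>

lemma act_lift: "act (lift x) X1 = x"
proof -
  have "act (lift (tri (sing u 1) m (sing v 1))) X1 = tri (sing u 1) m (sing v 1)" for u m v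
  proof -
    have "act (Femb (sing v 1)) X1 = sing (0, 0, v) 1"
      using act_Femb[of "sing v 1" 0 1] by (simp add: X1_tri tri_one)
    moreover have "act (Kf m) (sing (0, 0, v) 1) = tri 1 m (sing v 1)"
      using acts_Kf[of m] by (simp add: acts_def tri_one)
    ultimately show ?thesis by (simp add: lift_tri act_mult act_Eemb)
  qed
  then show ?thesis
    by (rule tri_eqI[OF lin_compose[OF lin_act_left lin_lift] lin_id])
qed

definition liftable :: "('i u_gen, 'k) nc_poly set" where "liftable = {a. \<exists>x. cg KI a (lift x)}"

lemma liftable_subspace: "pm.subspace liftable"
proof -
  have "cg KI 0 (lift 0)" by (simp add: cg_refl[OF ideal_KI])
  moreover have "\<exists>x. cg KI (a + b) (lift x)" if "cg KI a (lift x)" "cg KI b (lift y)" for a b x y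
    using cg_add[OF ideal_KI that] by (auto simp flip: lin_add[OF lin_lift])
  moreover have "\<exists>x. cg KI (c \<cdot> a) (lift x)" if "cg KI a (lift x)" for a c x
    using cg_scale[OF ideal_KI that] by (auto simp flip: lin_scale[OF lin_lift])
  ultimately show ?thesis unfolding pm.subspace_def liftable_def by blast
qed

lemma liftable_lift: "lift x \<in> liftable" using cg_refl[OF ideal_KI] by (auto simp: liftable_def)

lemma liftable_cg: "cg KI a b \<Longrightarrow> b \<in> liftable \<Longrightarrow> a \<in> liftable"
  unfolding liftable_def using cg_trans[OF ideal_KI] by blast

lemma liftable_KL:
  "gK i * (Eemb (sing u 1) * Kf m * Femb (sing v 1)) \<in> liftable"
  "gL i * (Eemb (sing u 1) * Kf m * Femb (sing v 1)) \<in> liftable"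
proof -
  have *: "x * (Eemb (sing u 1) * Kf m * Femb (sing v 1)) \<in> liftable"
    if qx: "qc x (Eemb (sing u 1))" and kx: "cg KI (x * Kf m) (Kf m')" for x m'
  proof -
    obtain c where "cg KI (x * Eemb (sing u 1)) (c \<cdot> (Eemb (sing u 1) * x))"
      using qx unfolding qcomm_def[OF ideal_KI] by blast
    from cg_right[OF ideal_KI this, of "Kf m * Femb (sing v 1)"]
    have "cg KI (x * (Eemb (sing u 1) * Kf m * Femb (sing v 1)))
        (c \<cdot> (Eemb (sing u 1) * (x * Kf m) * Femb (sing v 1)))"
      by (simp add: mult.assoc mult_pscale_left)
    moreover have "cg KI (c \<cdot> (Eemb (sing u 1) * (x * Kf m) * Femb (sing v 1)))
        (lift (c \<cdot> tri (sing u 1) m' (sing v 1)))"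
      unfolding lin_scale[OF lin_lift] lift_tri
      by (intro cg_scale cg_left cg_right ideal_KI kx)
    ultimately show ?thesis using cg_trans[OF ideal_KI] unfolding liftable_def by blast
  qed
  show "gK i * (Eemb (sing u 1) * Kf m * Femb (sing v 1)) \<in> liftable"
    by (rule *[OF qcomm_Eemb(1) Kf_add])
  show "gL i * (Eemb (sing u 1) * Kf m * Femb (sing v 1)) \<in> liftable"
    by (rule *[OF qcomm_Eemb(2) Kf_diff])
qed

lemma liftable_letterI:
  assumes "\<And>u m v. letter g * (Eemb (sing u 1) * Kf m * Femb (sing v 1)) \<in> liftable" "a \<in> liftable"
  shows "letter g * a \<in> liftable"
proof -
  obtain x where x: "cg KI a (lift x)" using assms(2) by (auto simp: liftable_def)
  have "letter g * lift x \<in> liftable"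
    by (rule lin_into_subspace[OF lin_compose[OF lin_mult_left lin_lift] liftable_subspace, of _ UNIV])
      (use assms(1) in \<open>auto simp: on_def lift_def\<close>)
  then show ?thesis by (rule liftable_cg[OF cg_left[OF ideal_KI x]])
qed

lemma liftable_gE: "a \<in> liftable \<Longrightarrow> gE i * a \<in> liftable"
proof (rule liftable_letterI)
  fix u m v
  have "gE i * (Eemb (sing u 1) * Kf m * Femb (sing v 1)) = lift (tri (sing (Word [i] + u) 1) m (sing v 1))"
    by (simp add: lift_tri emb_letter mult.assoc)
  then show "gE i * (Eemb (sing u 1) * Kf m * Femb (sing v 1)) \<in> liftable" by (simp add: liftable_lift)
qed

text \<open>F_i passes the first letter E_j at the price of K_j - K_j^{-1}, covered by
  \<open>liftable_KL\<close>; the induction hypothesis treats F_i on the shorter word, and E_j is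
  put back in front. With no letter E left, F_i passes K_m up to a scalar.\<close>

lemma liftable_gF: "gF i * (Eemb (sing u 1) * Kf m * Femb (sing v 1)) \<in> liftable"
proof (induction u rule: word_induct)
  case zero
  obtain c where "cg KI (gF i * Kf m) (c \<cdot> (Kf m * gF i))"
    using qcomm_gF_Kf[of i m] unfolding qcomm_def[OF ideal_KI] by blast
  from cg_right[OF ideal_KI this, of "Femb (sing v 1)"]
  have "cg KI (gF i * (Kf m * Femb (sing v 1))) (lift (c \<cdot> tri 1 m (sing (Word [i] + v) 1)))"
    by (simp add: lin_scale[OF lin_lift] lift_tri emb_letter mult.assoc mult_pscale_left)
  then show ?case using liftable_cg liftable_lift by simp
next
  case (letter j u)
  let ?R = "Eemb (sing u 1) * Kf m * Femb (sing v 1)"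
  let ?d = "if j = i then gK j - gL j else 0"
  have "cg KI (gF i * gE j) (gE j * gF i - ?d)"
    using cg_diff[OF ideal_KI cg_sym[OF ideal_KI KI_relations(6)[of j i]] cg_refl[OF ideal_KI, of ?d]]
    by simp
  from cg_right[OF ideal_KI this, of ?R]
  have "cg KI (gF i * (Eemb (sing (Word [j] + u) 1) * Kf m * Femb (sing v 1))) (gE j * (gF i * ?R) - ?d * ?R)"
    by (simp add: emb_letter mult.assoc left_diff_distrib)
  moreover have "?d * ?R \<in> liftable"
    using pm.subspace_diff[OF liftable_subspace] pm.subspace_0[OF liftable_subspace] liftable_KL
    by (simp add: left_diff_distrib)
  ultimately show ?case
    using liftable_cg pm.subspace_diff[OF liftable_subspace liftable_gE[OF letter]] by blast
qed

text \<open>A subspace that contains 1 and is stable under left multiplication by the generators is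
  everything: the spanning half.\<close>

lemma liftable_all: "a \<in> liftable"
proof -
  have l: "letter g * a \<in> liftable" if "a \<in> liftable" for g a
    using that by (cases g) (auto intro: liftable_gE liftable_letterI[OF _ that] liftable_KL liftable_gF)
  have "sing w 1 \<in> liftable" for w
  proof (induction w rule: word_induct)
    case zero then show ?case using liftable_lift[of X1] by (simp add: lift_X1)
  next
    case (letter x w) then show ?case using l[OF letter, of x] by (simp add: sing_letter_mult)
  qed
  then show ?thesis
    using lin_into_subspace[OF lin_id liftable_subspace, of a UNIV] by (simp add: on_def)
qed

lemma lift_N: "x \<in> N \<Longrightarrow> lift x \<in> KI"
proof -
  have "Eemb y \<in> KI" "Femb y \<in> KI" if "y \<in> J" for y
    using U_ideal_emb that by (auto simp: KI_def qU_zero_iff)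
  then have "lift (tri p m q) \<in> KI" if "p \<in> J \<or> q \<in> J" for p m q
    using that by (auto simp: lift_tri intro: free_ideal_mult_left[OF ideal_KI] free_ideal_mult_right[OF ideal_KI])
  then have "\<And>b. b \<in> {tri x m q |x m q. x \<in> J} \<union> {tri p m y |p m y. y \<in> J} \<Longrightarrow> lift b \<in> KI"
    by (elim UnE CollectE exE conjE) simp_all
  from lin_span_into[OF lin_lift free_ideal_subspace[OF ideal_KI] this]
  show "x \<in> N \<Longrightarrow> lift x \<in> KI" unfolding N_def .
qed

definition Psi :: "('i, 'k) tri \<Rightarrow> ('i, 'k) u" where "Psi x = qU (lift x)"

lemma linto_Psi: "U.linto Psi"
  unfolding Psi_def by (rule U.linto_compose[OF qU_linto lin_lift])

lemma Psi_closed [simp]: "Psi x \<in> carrier U" by (simp add: Psi_def)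

text \<open>If a is congruent to the normal form of y, applying a to the vector of 1 gives y modulo
  \<open>N\<close>, and \<open>lift\<close> sends \<open>N\<close> into the kernel. So acting on
  that vector inverts \<open>Psi\<close>.\<close>

lemma Psi_act_X1: "Psi (act a X1) = qU a"
proof -
  obtain y where y: "a - lift y \<in> KI" using liftable_all[of a] by (auto simp: liftable_def cg_def)
  then have "act (a - lift y) X1 \<in> N" using KI_Ann by (auto simp: Ann_def)
  then have "lift (act a X1) - lift y \<in> KI"
    using lift_N[of "act a X1 - y"] by (simp add: act_simps act_lift lin_diff[OF lin_lift])
  then have "cg KI (lift (act a X1)) a"
    using y cg_trans[OF ideal_KI] cg_sym[OF ideal_KI] unfolding cg_def by blast
  then show ?thesis by (simp add: Psi_def qU_eq)
qed

lemma Psi_act: "Psi (act a x) = qU a \<otimes>\<^bsub>U\<^esub> Psi x"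
  using Psi_act_X1[of "a * lift x"] by (simp add: act_mult act_lift qU_simps Psi_def)

text \<open>An element of the kernel annihilates modulo \<open>N\<close>, and a lifted x applied to
  the vector of 1 is x itself; the converse is \<open>lift_N\<close>. With surjectivity this is the
  triangular decomposition.\<close>

lemma Psi_zero_iff: "Psi x = \<zero>\<^bsub>U\<^esub> \<longleftrightarrow> x \<in> N"
proof
  assume "Psi x = \<zero>\<^bsub>U\<^esub>"
  then have "lift x \<in> Ann" using KI_Ann by (simp add: Psi_def KI_def)
  then show "x \<in> N" using act_lift[of x] by (metis (mono_tags) Ann_def mem_Collect_eq)
next
  assume "x \<in> N" then show "Psi x = \<zero>\<^bsub>U\<^esub>" using lift_N by (simp add: KI_def Psi_def)
qed

lemma Psi_eq_iff: "Psi x = Psi y \<longleftrightarrow> x - y \<in> N"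
  using Psi_zero_iff[of "x - y"] by (simp add: U.linto_diff[OF linto_Psi] U.r_right_minus_eq)

lemma carrier_U_Psi: "carrier U = range Psi"
  unfolding carrier_U by (metis (no_types) Psi_act_X1 Psi_def image_subset_iff rangeI subset_antisym)

lemma Psi_tri: "Psi (tri p m q) = qU (Eemb p) \<otimes>\<^bsub>U\<^esub> U_K chi J m \<otimes>\<^bsub>U\<^esub> qU (Femb q)"
  by (simp add: Psi_def lift_tri qU_simps U_K_eq)

lemma Psi_tri_Femb: "Psi (tri p m r) \<otimes>\<^bsub>U\<^esub> qU (Femb q) = Psi (tri p m (r * q))"
  by (simp add: Psi_tri nc_eval_free_mult qU_simps U_K_eq U.m_assoc)

end

section \<open>The projections\<close>

lemma word_degree_nonneg: "word_degree w \<in> nonneg"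
  by (induction w rule: word_induct) (auto simp: nonneg_def alpha_def axis_def)

lemma sum_alpha_components: "(\<Sum>j\<in>UNIV. alpha i $ j) = 1"
  by (simp add: alpha_def axis_def)

lemma sum_word_degree: "(\<Sum>j\<in>UNIV. word_degree w $ j) = int (length (letters w))"
  by (induction w rule: word_induct) (simp_all add: sum.distrib sum_alpha_components)

lemma word_degree_eq_zero [simp]: "word_degree w = 0 \<longleftrightarrow> w = 0"
  using sum_word_degree[of w] letters_inject[of w 0] by auto

lemma der_homogeneous: "der f i (sing u 1) \<in> on {w. word_degree w = word_degree u - alpha i}"
proof (induction u rule: word_induct)
  case (letter j u)
  have "sing (Word [j]) 1 * x \<in> on {w. word_degree w = word_degree (Word [j] + u) - alpha i}"
    if "x \<in> on {w. word_degree w = word_degree u - alpha i}" for x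
    by (rule lin_into_subspace[OF lin_mult_left subspace_on that])
      (auto simp: mult_single on_def)
  from this[OF letter] show ?case
    by (auto simp: der_letter intro!: pm.subspace_add[OF subspace_on] pm.subspace_0[OF subspace_on])
      (auto simp: on_def)
qed (simp add: pm.subspace_0[OF subspace_on])

lemma tri_on: "p \<in> on A \<Longrightarrow> q \<in> on C \<Longrightarrow> tri p m q \<in> on {(u, m', v). u \<in> A \<and> m' = m \<and> v \<in> C}"
proof -
  assume p: "p \<in> on A" and q: "q \<in> on C"
  let ?S = "on {(u, m', v). u \<in> A \<and> m' = m \<and> v \<in> C}"
  have "tri (sing u 1) m q \<in> ?S" if "u \<in> A" for u
    by (rule lin_into_subspace[OF lin_tri_right subspace_on q]) (use that in \<open>auto simp: tri_sing on_def\<close>)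
  then show ?thesis by (rule lin_into_subspace[OF lin_tri_left subspace_on p])
qed

context pre_nichols
begin

text \<open>Such sets are unions of multidegrees; the words enter only through their degrees, which
  is all that a graded \<open>J\<close> can see.\<close>

definition degree_closed :: "('i word \<times> 'i zn \<times> 'i word) set \<Rightarrow> bool" where
  "degree_closed B \<longleftrightarrow> (\<forall>u m v u' v'. word_degree u = word_degree u' \<longrightarrow> word_degree v = word_degree v' \<longrightarrow>
     (u, m, v) \<in> B \<longrightarrow> (u', m, v') \<in> B)"

text \<open>If the factor outside \<open>J\<close> is a word, restriction twists the factor in
  \<open>J\<close> by an indicator function of the degree, and \<open>J_tw\<close> applies;
  linearity in the other factor does the rest.\<close>

lemma restr_N:
  assumes B: "degree_closed B" and x: "x \<in> N" shows "restr B x \<in> N"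
proof (rule lin_into_N[OF lin_restr _ x])
  fix p m q
  define f where "f a b = (if \<exists>u v. (u, m, v) \<in> B \<and> word_degree u = a \<and> word_degree v = b then 1 else 0 :: 'k)" for a b
  have f: "(u, m, v) \<in> B \<longleftrightarrow> f (word_degree u) (word_degree v) = 1" for u v
  proof
    assume "(u, m, v) \<in> B" then show "f (word_degree u) (word_degree v) = 1" by (auto simp: f_def)
  next
    assume "f (word_degree u) (word_degree v) = 1"
    then obtain u' v' where "(u', m, v') \<in> B" "word_degree u' = word_degree u" "word_degree v' = word_degree v"
      by (auto simp: f_def split: if_splits)
    then show "(u, m, v) \<in> B" using B unfolding degree_closed_def by blast
  qed
  have f': "f a b = 0 \<or> f a b = 1" for a b by (simp add: f_def)
  have base: "restr B (tri (sing u 1) m (sing v 1)) = sing (u, m, v) (f (word_degree u) (word_degree v))" for u v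
    using f[of u v] f'[of "word_degree u" "word_degree v"] by (auto simp: tri_sing restr_sing)
  have 1: "restr B (tri p m (sing v 1)) = tri (tw (\<lambda>a. f a (word_degree v)) p) m (sing v 1)" for v
    by (rule lin_eqI[of "\<lambda>p. restr B (tri p m (sing v 1))"])
      (auto intro!: tri_intros lin_compose[OF lin_restr] simp: base, simp add: tri_sing)
  have 2: "restr B (tri (sing u 1) m q) = tri (sing u 1) m (tw (\<lambda>b. f (word_degree u) b) q)" for u
    by (rule lin_eqI[of "\<lambda>q. restr B (tri (sing u 1) m q)"])
      (auto intro!: tri_intros lin_compose[OF lin_restr] simp: base, simp add: tri_sing)
  assume "p \<in> J \<or> q \<in> J"
  then show "restr B (tri p m q) \<in> N"
  proof
    assume "p \<in> J"
    then have "restr B (tri p m (sing v 1)) \<in> N" for v by (simp add: 1 N_tri J_tw)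
    then show ?thesis
      using lin_into_subspace[OF lin_compose[OF lin_restr lin_tri_right] N_subspace, of q UNIV]
      by (simp add: on_def)
  next
    assume "q \<in> J"
    then have "restr B (tri (sing u 1) m q) \<in> N" for u by (simp add: 2 N_tri J_tw)
    then show ?thesis
      using lin_into_subspace[OF lin_compose[OF lin_restr lin_tri_left] N_subspace, of p UNIV]
      by (simp add: on_def)
  qed
qed

lemma vsub_Psi_on: "U.vsub (Psi ` on B)"
  by (rule U.vsub_image[OF linto_Psi subspace_on])

lemma Psi_on_basis: "b \<in> B \<Longrightarrow> Psi (sing b c) \<in> Psi ` on B"
  by (auto simp: on_def)

text \<open>Restriction preserves \<open>N\<close>, so the images of complementary coordinate
  subspaces still meet only in zero.\<close>

lemma proj_along_Psi:
  assumes B: "degree_closed B"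
  shows "proj_along U (Psi ` on B) (Psi ` on (- B)) (Psi x) = Psi (restr B x)"
proof (rule U.proj_along_eq[OF vsub_Psi_on vsub_Psi_on])
  show "Psi ` on B \<inter> Psi ` on (- B) \<subseteq> {\<zero>\<^bsub>U\<^esub>}"
  proof
    fix y assume "y \<in> Psi ` on B \<inter> Psi ` on (- B)"
    then obtain a b where a: "a \<in> on B" and b: "b \<in> on (- B)" and ab: "Psi a = Psi b" "y = Psi b"
      by (elim IntE imageE) simp
    then have "restr B (a - b) \<in> N" using restr_N[OF B] Psi_eq_iff[of a b] by simp
    then have "a \<in> N"
      using restr_ident[OF a] restr_disjoint[OF b, of B] by (simp add: lin_diff[OF lin_restr])
    then show "y \<in> {\<zero>\<^bsub>U\<^esub>}" using ab Psi_zero_iff[of a] by simp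
  qed
  show "Psi x \<ominus>\<^bsub>U\<^esub> Psi (restr B x) \<in> Psi ` on (- B)"
    by (simp add: minus_restr flip: U.linto_diff[OF linto_Psi])
qed auto

lemma lin_span_Psi:
  assumes "S \<subseteq> Psi ` on B" "\<And>b. b \<in> B \<Longrightarrow> Psi (sing b 1) \<in> lin_span U S"
  shows "lin_span U S = Psi ` on B"
proof
  show "lin_span U S \<subseteq> Psi ` on B" by (rule U.lin_span_minimal[OF vsub_Psi_on assms(1)])
  have S: "S \<subseteq> carrier U" using assms(1) U.vsub_carrier[OF vsub_Psi_on] by blast
  show "Psi ` on B \<subseteq> lin_span U S"
    using U.linto_into[OF linto_Psi U.vsub_lin_span[OF S]] assms(2) by blast
qed

lemma summand_proj_Psi:
  assumes V: "\<And>i. i \<in> I \<Longrightarrow> V i = Psi ` on (B i)" and j: "j \<in> I"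
    and part: "(\<Union>i\<in>I - {j}. B i) = - B j" and B: "degree_closed (B j)"
  shows "summand_proj U I V j (Psi x) = Psi (restr (B j) x)"
proof -
  have "lin_span U (\<Union>i\<in>I - {j}. V i) = Psi ` on (- B j)"
  proof (rule lin_span_Psi)
    show "(\<Union>i\<in>I - {j}. V i) \<subseteq> Psi ` on (- B j)"
    proof
      fix y assume "y \<in> (\<Union>i\<in>I - {j}. V i)"
      then obtain i x where "i \<in> I - {j}" "x \<in> on (B i)" "y = Psi x" using V by auto
      moreover from this have "x \<in> on (- B j)" unfolding part[symmetric] on_def by auto
      ultimately show "y \<in> Psi ` on (- B j)" by blast
    qed
    fix b assume "b \<in> - B j"
    then have "b \<in> (\<Union>i\<in>I - {j}. B i)" by (simp only: part)
    then obtain i where i: "i \<in> I - {j}" "b \<in> B i" by (rule UN_E)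
    then have "Psi (sing b 1) \<in> V i" using V[of i] Psi_on_basis[of b "B i"] by simp
    then have "Psi (sing b 1) \<in> (\<Union>i\<in>I - {j}. V i)" using i(1) by (rule UN_I[rotated])
    then show "Psi (sing b 1) \<in> lin_span U (\<Union>i\<in>I - {j}. V i)" by (rule U.lin_span_base) simp
  qed
  then show ?thesis using proj_along_Psi[OF B] V[OF j] by (simp add: summand_proj_def)
qed

lemma U_E_eq: "U_E chi J = (\<lambda>i. qU (gE i))" and U_F_eq: "U_F chi J = (\<lambda>i. qU (gF i))"
  and U_Ki_eq: "U_Ki chi J = (\<lambda>i. qU (gK i))" and U_Kinv_eq: "U_Kinv chi J = (\<lambda>i. qU (gL i))"
  by (auto simp: U_E_def U_F_def U_Ki_def U_Kinv_def qU_gen)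

lemma U_plus_eq: "U_plus chi J = range (\<lambda>p. qU (Eemb p))"
  unfolding U_plus_def U_E_eq by (subst U.gen_subalgebra_range) (auto simp: qU_nc_eval)

definition FKemb :: "('i, 'k) nc_poly \<Rightarrow> ('i u_gen, 'k) nc_poly" where
  "FKemb = nc_eval free_algebra (\<lambda>i. gF i * gK i)"

lemma G_minus_eq: "G_minus chi J = range (\<lambda>p. qU (FKemb p))"
  unfolding G_minus_def U_F_eq U_Ki_eq qU_simps[symmetric] FKemb_def
  by (subst U.gen_subalgebra_range) (auto simp: qU_nc_eval)

lemma FKemb_letter: "FKemb (sing (Word [i] + w) 1) = gF i * gK i * FKemb (sing w 1)"
  using nc_eval_free_mult[of _ "letter i" "sing w 1"]
  by (simp add: FKemb_def nc_eval_free_letter flip: sing_letter_mult)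

text \<open>Each factor F_i K_i raises m by \<alpha>_i and prepends i to v, and no letter E is there
  to produce further terms. The scalar is a product of values of \<chi>; only that it is invertible
  matters.\<close>

lemma act_FKemb: "\<exists>c. c \<noteq> 0 \<and> act (FKemb (sing w 1)) X1 = sing (0, word_degree w, w) c"
proof (induction w rule: word_induct)
  case zero
  show ?case by (rule exI[of _ 1]) (simp add: FKemb_def nc_eval_free_one X1_def)
next
  case (letter i w)
  then obtain c where c: "c \<noteq> 0" "act (FKemb (sing w 1)) X1 = sing (0, word_degree w, w) c" by blast
  have "opF i (opK i (sing (0, word_degree w, w) c)) =
      sing (0, word_degree (Word [i] + w), Word [i] + w) (c * chi (word_degree w + alpha i) (alpha i))"
    by (simp add: opr_sing opF_def add.commute[of "alpha i"])
  then have "act (FKemb (sing (Word [i] + w) 1)) X1 =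
      sing (0, word_degree (Word [i] + w), Word [i] + w) (c * chi (word_degree w + alpha i) (alpha i))"
    by (simp add: FKemb_letter act_mult c(2))
  moreover have "c * chi (word_degree w + alpha i) (alpha i) \<noteq> 0" using c(1) by simp
  ultimately show ?case by blast
qed

text \<open>The index set of \<open>U\<^sup>+ K\<^sub>l G\<^sup>-\<close>: a product of the generators \<open>F\<^sub>i K\<^sub>i\<close> is a multiple of \<open>K\<^sub>d F\<^sub>v\<close> with \<open>d\<close> the degree of \<open>v\<close>.\<close>

definition Pset :: "'i zn \<Rightarrow> ('i word \<times> 'i zn \<times> 'i word) set" where
  "Pset l = {(u, m, v). m = l + word_degree v}"

lemma E_K_FK: "\<exists>c. c \<noteq> 0 \<and>
  qU (Eemb p) \<otimes>\<^bsub>U\<^esub> U_K chi J l \<otimes>\<^bsub>U\<^esub> qU (FKemb (sing w 1)) = Psi (tri p (l + word_degree w) (sing w c))"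
proof -
  obtain c where c: "c \<noteq> 0" "act (FKemb (sing w 1)) X1 = sing (0, word_degree w, w) c"
    using act_FKemb by blast
  have t: "c \<cdot> tri p m (sing w 1) = tri p m (sing w c)" for m
    by (rule lin_sing[OF lin_tri_right, symmetric])
  have "act (Eemb p * Kf l * FKemb (sing w 1)) X1 = tri p (l + word_degree w) (sing w c)"
    using acts_Kf[of l]
    by (simp add: act_mult c(2) lin_sing[OF lin_act, of _ _ c] acts_def)
      (simp add: act_Eemb lin_scale[OF lin_act] t add.commute[of l] flip: tri_one)
  from arg_cong[OF this, of Psi] show ?thesis
    using c(1) by (auto simp: Psi_act_X1 qU_simps U_K_eq)
qed

lemma P_summand:
  "lin_span U (U_plus chi J <#>\<^bsub>U\<^esub> {U_K chi J l} <#>\<^bsub>U\<^esub> G_minus chi J) = Psi ` on (Pset l)"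
proof (rule lin_span_Psi)
  let ?S = "U_plus chi J <#>\<^bsub>U\<^esub> {U_K chi J l} <#>\<^bsub>U\<^esub> G_minus chi J"
  have S: "?S = {qU (Eemb p) \<otimes>\<^bsub>U\<^esub> U_K chi J l \<otimes>\<^bsub>U\<^esub> qU (FKemb q) | p q. True}"
    by (auto simp: set_mult_def U_plus_eq G_minus_eq)
  have on: "tri p (l + word_degree w) (sing w c) \<in> on (Pset l)"
    for p and w :: "'i word" and c :: 'k
  proof -
    have "sing w c \<in> on {w}" by (simp add: on_def)
    from tri_on[OF _ this, of p UNIV "l + word_degree w"] show ?thesis
      by (auto simp: on_def Pset_def)
  qed
  have "qU (Eemb p) \<otimes>\<^bsub>U\<^esub> U_K chi J l \<otimes>\<^bsub>U\<^esub> qU (FKemb q) \<in> Psi ` on (Pset l)" for p q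
  proof (rule U.linto_into[OF _ vsub_Psi_on, where f = "\<lambda>q. qU (Eemb p) \<otimes>\<^bsub>U\<^esub> U_K chi J l \<otimes>\<^bsub>U\<^esub> qU (FKemb q)" and B = UNIV])
    show "U.linto (\<lambda>q. qU (Eemb p) \<otimes>\<^bsub>U\<^esub> U_K chi J l \<otimes>\<^bsub>U\<^esub> qU (FKemb q))"
      unfolding FKemb_def
      by (intro U.linto_mult_left U.linto_compose[OF qU_linto] nc_eval_free_lin) (simp add: U_K_eq)
    show "qU (Eemb p) \<otimes>\<^bsub>U\<^esub> U_K chi J l \<otimes>\<^bsub>U\<^esub> qU (FKemb (sing w 1)) \<in> Psi ` on (Pset l)" for w
      using E_K_FK[of p l w] on by blast
  qed (simp add: on_def)
  then show "?S \<subseteq> Psi ` on (Pset l)" unfolding S by blast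
  fix b assume "b \<in> Pset l"
  then obtain u v where b: "b = (u, l + word_degree v, v)" by (auto simp: Pset_def)
  obtain c where c: "c \<noteq> 0"
    "qU (Eemb (sing u 1)) \<otimes>\<^bsub>U\<^esub> U_K chi J l \<otimes>\<^bsub>U\<^esub> qU (FKemb (sing v 1)) = Psi (tri (sing u 1) (l + word_degree v) (sing v c))"
    using E_K_FK by blast
  have car: "?S \<subseteq> carrier U" unfolding S by (auto simp: U_K_eq)
  have "Psi (sing b c) \<in> lin_span U ?S"
    by (rule U.lin_span_base) (use c(2) in \<open>auto simp: S b tri_sing\<close>)
  from U.vsub_scal[OF U.vsub_lin_span[OF car] this, of "inverse c"]
  have "Psi (inverse c \<cdot> sing b c) \<in> lin_span U ?S" unfolding U.linto_scale[OF linto_Psi] .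
  then show "Psi (sing b 1) \<in> lin_span U ?S" using c(1) by simp
qed

lemma P_proj_Psi: "P_proj chi J l (Psi x) = Psi (restr (Pset l) x)"
  unfolding P_proj_def
proof (rule summand_proj_Psi)
  show "(\<Union>i\<in>UNIV - {l}. Pset i) = - Pset l"
  proof -
    have "(u, m, v) \<in> Pset (m - word_degree v)" for u v :: "'i word" and m by (simp add: Pset_def)
    moreover have "b \<in> Pset i \<Longrightarrow> b \<in> Pset l \<Longrightarrow> i = l" for b i by (auto simp: Pset_def)
    ultimately show ?thesis by fast
  qed
  show "degree_closed (Pset l)" by (auto simp: degree_closed_def Pset_def)
qed (simp_all add: P_summand)

definition Hset :: "('i word \<times> 'i zn \<times> 'i word) set" where "Hset = {(0, m, 0) | m. True}"

lemma Psi_H: "Psi (sing (0, m, 0) 1) = U_K chi J m"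
  using Psi_tri[of 1 m 1] tri_one[of m 0 1] by (simp add: qU_simps U_K_eq)

lemma U_K_mult: "U_K chi J l \<otimes>\<^bsub>U\<^esub> U_K chi J m = U_K chi J (l + m)"
proof -
  have "act (Kf l * Kf m) X1 = act (Kf (l + m)) X1"
    using acts_Kf by (simp add: acts_def X1_def act_mult add.commute)
  from arg_cong[OF this, of Psi] show ?thesis by (simp add: Psi_act_X1 qU_simps U_K_eq)
qed

lemma U_zero_eq: "U_zero chi J = Psi ` on Hset"
proof
  let ?G = "range (U_Ki chi J) \<union> range (U_Kinv chi J)"
  have K: "U_Ki chi J i = U_K chi J (alpha i)" "U_Kinv chi J i = U_K chi J (- alpha i)" for i
  proof -
    show "U_Ki chi J i = U_K chi J (alpha i)" "U_Kinv chi J i = U_K chi J (- alpha i)"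
      unfolding U_K_eq U_Ki_eq U_Kinv_eq Psi_act_X1[symmetric]
      using acts_Kf[of "alpha i"] acts_Kf[of "- alpha i"] by (simp_all add: acts_def X1_def opr_sing)
  qed
  have Kc: "U_K chi J m \<in> carrier U" for m by (simp add: U_K_eq)
  have KH: "U_K chi J m \<in> Psi ` on Hset" for m
    unfolding Psi_H[symmetric] by (rule Psi_on_basis) (auto simp: Hset_def)
  show "U_zero chi J \<subseteq> Psi ` on Hset" unfolding U_zero_def
  proof (rule U.gen_subalgebra_minimal[OF vsub_Psi_on])
    have "U_K chi J 0 = \<one>\<^bsub>U\<^esub>" by (simp add: U_K_eq Kf_zero qU_simps)
    then show "\<one>\<^bsub>U\<^esub> \<in> Psi ` on Hset" using KH by metis
    show "?G \<subseteq> Psi ` on Hset" using KH by (auto simp: K)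
    fix x y assume "x \<in> Psi ` on Hset" "y \<in> Psi ` on Hset"
    then obtain a b where a: "a \<in> on Hset" "x = Psi a" and b: "b \<in> on Hset" "y = Psi b" by auto
    have KK: "Psi (sing (0, l, 0) 1) \<otimes>\<^bsub>U\<^esub> Psi (sing x 1) \<in> Psi ` on Hset" if x: "x \<in> Hset" for l x
    proof -
      obtain m where "x = (0, m, 0)" using x by (auto simp: Hset_def)
      then show ?thesis using KH[of "l + m"] by (simp add: Psi_H U_K_mult)
    qed
    have "Psi (sing (0, l, 0) 1) \<otimes>\<^bsub>U\<^esub> Psi b \<in> Psi ` on Hset" for l
      by (rule U.linto_into[OF U.linto_mult_left[OF linto_Psi] vsub_Psi_on b(1)]) (simp_all add: KK)
    then have "Psi a \<otimes>\<^bsub>U\<^esub> Psi b \<in> Psi ` on Hset"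
      by (intro U.linto_into[OF U.linto_mult_right[OF linto_Psi] vsub_Psi_on a(1)])
        (auto simp: Hset_def)
    then show "x \<otimes>\<^bsub>U\<^esub> y \<in> Psi ` on Hset" using a b by simp
  qed
  have G: "?G \<subseteq> carrier U" by (auto simp: U_Ki_eq U_Kinv_eq)
  note pr = U.gen_subalgebra_props[OF G, folded U_zero_def]
  have pw: "x [^]\<^bsub>U\<^esub> n \<in> U_zero chi J" if "x \<in> U_zero chi J" for x and n :: nat
    using that by (induction n) (auto simp: pr)
  have gen: "U_Ki chi J i \<in> U_zero chi J" "U_Kinv chi J i \<in> U_zero chi J" for i
    unfolding U_zero_def by (auto intro: U.gen_subalgebra_base)
  have lp: "list_prod U xs \<in> U_zero chi J" if "set xs \<subseteq> U_zero chi J" for xs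
    using that by (induction xs) (auto simp: pr)
  have "U_K chi J m \<in> U_zero chi J" for m
    unfolding U_K_def
  proof (rule lp, unfold set_map, rule image_subsetI)
    fix i
    show "(if 0 \<le> m $ i then U_Ki chi J i [^]\<^bsub>U\<^esub> nat (m $ i)
        else U_Kinv chi J i [^]\<^bsub>U\<^esub> nat (- (m $ i))) \<in> U_zero chi J"
      by (split if_split) (intro conjI impI pw gen)
  qed
  then show "Psi ` on Hset \<subseteq> U_zero chi J"
    using U.linto_into[OF linto_Psi pr(1), of _ Hset] by (auto simp: Hset_def Psi_H)
qed

definition Dset :: "'i zn \<times> 'i zn \<Rightarrow> ('i word \<times> 'i zn \<times> 'i word) set" where
  "Dset ab = {(u, m, v). word_degree u = fst ab \<and> word_degree v = snd ab}"

lemma homogeneous_on: "homogeneous l = on {w. word_degree w = l}"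
  by (auto simp: homogeneous_def on_def)

lemma pi00_summand:
  "lin_span U (U_plus_part chi J a <#>\<^bsub>U\<^esub> U_zero chi J <#>\<^bsub>U\<^esub> U_minus_part chi J b) = Psi ` on (Dset (a, b))"
proof (rule lin_span_Psi)
  let ?S = "U_plus_part chi J a <#>\<^bsub>U\<^esub> U_zero chi J <#>\<^bsub>U\<^esub> U_minus_part chi J b"
  have S: "?S = {qU (Eemb p) \<otimes>\<^bsub>U\<^esub> Psi h \<otimes>\<^bsub>U\<^esub> qU (Femb q) | p h q. p \<in> homogeneous a \<and> h \<in> on Hset \<and> q \<in> homogeneous b}"
    unfolding set_mult_def U_plus_part_def U_minus_part_def U_zero_eq U_E_eq U_F_eq qU_nc_eval by blast
  have "qU (Eemb p) \<otimes>\<^bsub>U\<^esub> Psi h \<otimes>\<^bsub>U\<^esub> qU (Femb q) \<in> Psi ` on (Dset (a, b))"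
    if p: "p \<in> homogeneous a" and h: "h \<in> on Hset" and q: "q \<in> homogeneous b" for p h q
  proof (rule U.linto_into[OF U.linto_mult_right[OF U.linto_mult_left[OF linto_Psi]] vsub_Psi_on h])
    fix x assume "x \<in> Hset"
    then obtain m where x: "x = (0, m, 0)" by (auto simp: Hset_def)
    have "tri p m q \<in> on (Dset (a, b))"
      using tri_on[of p _ q _ m] p q unfolding homogeneous_on
      by (fastforce simp: on_def Dset_def)
    then show "qU (Eemb p) \<otimes>\<^bsub>U\<^esub> Psi (sing x 1) \<otimes>\<^bsub>U\<^esub> qU (Femb q) \<in> Psi ` on (Dset (a, b))"
      unfolding x Psi_H Psi_tri[symmetric] by blast
  qed simp_all
  then show "?S \<subseteq> Psi ` on (Dset (a, b))" unfolding S by blast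
  fix x assume "x \<in> Dset (a, b)"
  then obtain u m v where x: "x = (u, m, v)" "word_degree u = a" "word_degree v = b"
    by (auto simp: Dset_def)
  have "Psi (sing x 1) = qU (Eemb (sing u 1)) \<otimes>\<^bsub>U\<^esub> Psi (sing (0, m, 0) 1) \<otimes>\<^bsub>U\<^esub> qU (Femb (sing v 1))"
    using Psi_tri[of "sing u 1" m "sing v 1"] by (simp add: Psi_H tri_sing x)
  then have "Psi (sing x 1) \<in> ?S"
    unfolding S using x by (force simp: homogeneous_def on_def Hset_def)
  then show "Psi (sing x 1) \<in> lin_span U ?S" by (rule U.lin_span_base) simp
qed

text \<open>Only the empty word has degree zero, so the summand for (0, 0) is spanned by the
  K_m.\<close>

lemma Dset_zero: "Dset (0, 0) = Hset"
  by (auto simp: Dset_def Hset_def)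

lemma pi00_Psi: "pi00 chi J (Psi x) = Psi (restr Hset x)"
  unfolding pi00_def Dset_zero[symmetric]
proof (rule summand_proj_Psi)
  show "(\<Union>i\<in>nonneg \<times> nonneg - {(0, 0)}. Dset i) = - Dset (0, 0)"
  proof -
    have mem: "(u, m, v) \<in> Dset (word_degree u, word_degree v)"
      "(word_degree u, word_degree v) \<in> nonneg \<times> nonneg" for u m v
      by (simp_all add: Dset_def word_degree_nonneg)
    have uniq: "b \<in> Dset i \<Longrightarrow> b \<in> Dset j \<Longrightarrow> i = j" for b i j
      by (auto simp: Dset_def prod_eq_iff)
    show ?thesis
    proof (intro Set.set_eqI iffI)
      fix b assume "b \<in> (\<Union>i\<in>nonneg \<times> nonneg - {(0, 0)}. Dset i)"
      then obtain i where "i \<in> nonneg \<times> nonneg - {(0, 0)}" "b \<in> Dset i" by (rule UN_E)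
      then show "b \<in> - Dset (0, 0)" using uniq[of b i "(0, 0)"] by auto
    next
      fix b assume b: "b \<in> - Dset (0, 0)"
      obtain u m v where buv: "b = (u, m, v)" by (cases b)
      then have "(word_degree u, word_degree v) \<noteq> (0, 0)" using b mem(1)[of u m v] by auto
      then show "b \<in> (\<Union>i\<in>nonneg \<times> nonneg - {(0, 0)}. Dset i)"
        using mem(1)[of u m v] mem(2)[of u v] buv by (intro UN_I[of "(word_degree u, word_degree v)"]) auto
    qed
  qed
  show "degree_closed (Dset (0, 0))" by (auto simp: degree_closed_def Dset_def)
  show "(0, 0) \<in> nonneg \<times> nonneg" by (simp add: nonneg_def)
qed (auto simp: pi00_summand)

end

section \<open>The elements B_i and the support of p(B)\<close>

locale coideal = pre_nichols chi J
  for chi :: "'i::{finite,linorder} zn \<Rightarrow> 'i zn \<Rightarrow> 'k::field" and J :: "('i, 'k) nc_poly set" +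
  fixes tau :: "'i \<Rightarrow> 'i" and c :: "('k, 'i) vec"
  assumes tau_tau: "tau (tau i) = i"
begin

abbreviation "PL \<equiv> poly_lattice tau"

definition Bf :: "'i \<Rightarrow> ('i u_gen, 'k) nc_poly" where
  "Bf i = gF i + (c $ i) \<cdot> (gE (tau i) * gL i)"

lemma B_elem_eq: "B_elem chi J tau c = (\<lambda>i. qU (Bf i))"
  by (rule ext) (simp add: B_elem_def Bf_def U_E_eq U_F_eq U_Kinv_eq qU_simps pscale_mult qU_scal U.m_assoc)

lemma tau_lattice_nth: "tau_lattice tau l $ j = l $ tau j"
proof -
  have "tau_lattice tau l $ j = (\<Sum>i\<in>UNIV. if i = tau j then l $ i else 0)"
    unfolding tau_lattice_def sum_component
    by (rule sum.cong) (auto simp: alpha_nth tau_tau)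
  then show ?thesis by simp
qed

lemma lattice_theta_iff: "l \<in> lattice_theta tau \<longleftrightarrow> (\<forall>j. l $ tau j = - (l $ j))"
  by (simp add: lattice_theta_def vec_eq_iff tau_lattice_nth)

lemma PL_iff: "l \<in> PL \<longleftrightarrow> (\<exists>t\<in>lattice_theta tau. t - l \<in> nonneg)"
proof
  assume "l \<in> PL"
  then obtain a t where "l = - a + t" "a \<in> nonneg" "t \<in> lattice_theta tau" by (auto simp: poly_lattice_def)
  then show "\<exists>t\<in>lattice_theta tau. t - l \<in> nonneg" by (intro bexI[of _ t]) auto
next
  assume "\<exists>t\<in>lattice_theta tau. t - l \<in> nonneg"
  then obtain t where t: "t \<in> lattice_theta tau" "t - l \<in> nonneg" by blast
  have "l = - (t - l) + t" by simp
  then show "l \<in> PL" unfolding poly_lattice_def using t by blast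
qed

lemma nonneg_add: "a \<in> nonneg \<Longrightarrow> b \<in> nonneg \<Longrightarrow> a + b \<in> nonneg"
  by (simp add: nonneg_def)

lemma nonneg_alpha: "alpha i \<in> nonneg" by (simp add: nonneg_def alpha_nth)

lemma PL_minus: "l \<in> PL \<Longrightarrow> a \<in> nonneg \<Longrightarrow> l - a \<in> PL"
  unfolding PL_iff using nonneg_add[of _ a] by (metis diff_diff_eq2 add_diff_eq add.commute)

lemma PL_theta: "l \<in> PL \<Longrightarrow> t \<in> lattice_theta tau \<Longrightarrow> l + t \<in> PL"
proof -
  assume "l \<in> PL" and t: "t \<in> lattice_theta tau"
  then obtain s where s: "s \<in> lattice_theta tau" "s - l \<in> nonneg" by (auto simp: PL_iff)
  then have "s + t \<in> lattice_theta tau" "s + t - (l + t) \<in> nonneg" using t by (simp_all add: lattice_theta_iff)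
  then show ?thesis unfolding PL_iff by blast
qed

lemma PL_zero: "0 \<in> PL"
  unfolding PL_iff by (rule bexI[of _ 0]) (simp_all add: lattice_theta_iff nonneg_def)

lemma theta_alpha: "alpha i - alpha (tau i) \<in> lattice_theta tau" "alpha (tau i) - alpha i \<in> lattice_theta tau"
  using tau_tau by (auto simp: lattice_theta_iff alpha_nth) metis+

text \<open>The three conditions bound, for a monomial in the \<open>B\<^sub>i\<close> of degree \<open>d\<close>, the summands \<open>U\<^sup>+ K\<^sub>l G\<^sup>-\<close> it meets,
  place it in \<open>U(\<chi>)\<^sup>p\<^sup>o\<^sup>l\<^sup>y\<close>, and restrict its weight.\<close>

definition Q :: "'i zn \<Rightarrow> ('i word \<times> 'i zn \<times> 'i word) set" where
  "Q d = {(u, m, v). m - word_degree v + d \<in> nonneg \<and> m + word_degree u \<in> PL \<and>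
     word_degree u - word_degree v + d \<in> tau_submonoid tau}"

lemma act_Bf_Q:
  assumes x: "x \<in> on (Q d)" shows "act (Bf i) x \<in> on (Q (d + alpha i))"
proof (rule lin_into_subspace[OF lin_act subspace_on x])
  fix b assume "b \<in> Q d"
  then obtain u m v where b: "b = (u, m, v)" and 1: "m - word_degree v + d \<in> nonneg"
    and 2: "m + word_degree u \<in> PL" and 3: "word_degree u - word_degree v + d \<in> tau_submonoid tau"
    by (auto simp: Q_def)
  have sgl: "sing (u', m', v') k \<in> on (Q (d + alpha i))" if "(u', m', v') \<in> Q (d + alpha i)" for u' m' v' and k :: 'k
    using that by (auto simp: on_def)
  have F: "(u, m, Word [i] + v) \<in> Q (d + alpha i)"
    using 1 2 3 by (simp add: Q_def algebra_simps)
  \<comment> \<open>The commutator terms change m by \<alpha>_i or - \<alpha>_i and shorten the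
    degree of u by \<alpha>_i. As d grows by \<alpha>_i, the first quantity in \<open>Q\<close>
    grows by 2 \<alpha>_i or 0, the second drops by 0 or 2 \<alpha>_i, and the third is
    unchanged.\<close>
  have C: "tri (der f i (sing u 1)) m' (sing v 1) \<in> on (Q (d + alpha i))"
    if "m' = m + alpha i \<or> m' = m - alpha i" for f m'
  proof -
    have "(u', m', v) \<in> Q (d + alpha i)" if u': "word_degree u' = word_degree u - alpha i" for u'
    proof -
      have "m' - word_degree v + (d + alpha i) = m - word_degree v + d + (alpha i + alpha i) \<or>
          m' - word_degree v + (d + alpha i) = m - word_degree v + d"
        using \<open>m' = _ \<or> _\<close> by (auto simp: algebra_simps)
      then have "m' - word_degree v + (d + alpha i) \<in> nonneg"
        using 1 nonneg_add[OF 1 nonneg_add[OF nonneg_alpha[of i] nonneg_alpha[of i]]] by metis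
      moreover have "m' + word_degree u' = m + word_degree u \<or>
          m' + word_degree u' = m + word_degree u - (alpha i + alpha i)"
        using \<open>m' = _ \<or> _\<close> u' by (auto simp: algebra_simps)
      then have "m' + word_degree u' \<in> PL"
        using 2 PL_minus[OF 2 nonneg_add[OF nonneg_alpha[of i] nonneg_alpha[of i]]] by metis
      moreover have w: "word_degree u' - word_degree v + (d + alpha i) = word_degree u - word_degree v + d"
        using u' by (simp add: algebra_simps)
      ultimately show ?thesis using 3 by (simp only: Q_def mem_Collect_eq prod.case w simp_thms)
    qed
    then show ?thesis
      using tri_on[OF der_homogeneous[of f i u], of "sing v 1" "{v}" m'] by (auto simp: on_def)
  qed
  \<comment> \<open>The E-term shifts m + deg u by an element of \<open>lattice_theta\<close>. It is
    the only term that moves the weight condition, and it does so by a generator of the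
    submonoid.\<close>
  have E: "(Word [tau i] + u, m - alpha i, v) \<in> Q (d + alpha i)"
  proof -
    have e: "m - alpha i + word_degree (Word [tau i] + u) = m + word_degree u + (alpha (tau i) - alpha i)"
      "word_degree (Word [tau i] + u) - word_degree v + (d + alpha i) =
        word_degree u - word_degree v + d + (alpha i + alpha (tau i))"
      "m - alpha i - word_degree v + (d + alpha i) = m - word_degree v + d"
      by (simp_all add: algebra_simps)
    show ?thesis unfolding Q_def mem_Collect_eq prod.case e
      using 1 PL_theta[OF 2 theta_alpha(2)[of i]] tau_submonoid.step[OF 3, of i] by simp
  qed
  have "act (Bf i) (sing b 1) = opF i (sing (u, m, v) 1) + (c $ i) \<cdot> opE (tau i) (opL i (sing (u, m, v) 1))"
    by (simp add: Bf_def act_simps b)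
  also have "\<dots> \<in> on (Q (d + alpha i))"
    unfolding opr_sing opF_def lext_sing prod.case
    by (intro pm.subspace_add[OF subspace_on] pm.subspace_diff[OF subspace_on]
        pm.subspace_scale[OF subspace_on] sgl F C E) auto
  finally show "act (Bf i) (sing b 1) \<in> on (Q (d + alpha i))" .
qed

definition eta :: "('i, 'k) nc_poly \<Rightarrow> ('i, 'k) tri" where
  "eta p = act (nc_eval free_algebra Bf p) X1"

lemma nc_eval_B: "nc_eval U (B_elem chi J tau c) p = Psi (eta p)"
  by (simp add: B_elem_eq qU_nc_eval eta_def Psi_act_X1)

lemma eta_Q: "p \<in> homogeneous l \<Longrightarrow> eta p \<in> on (Q l)"
proof -
  assume p: "p \<in> homogeneous l"
  have "eta (sing w 1) \<in> on (Q (word_degree w))" for w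
  proof (induction w rule: word_induct)
    case zero
    have "(0, 0, 0) \<in> Q 0"
      using PL_zero tau_submonoid.zero by (simp add: Q_def nonneg_def)
    then show ?case by (simp add: eta_def nc_eval_free_one X1_def on_def)
  next
    case (letter i w)
    then show ?case using act_Bf_Q[OF letter, of i]
      by (simp add: eta_def nc_eval_free_mult nc_eval_free_letter act_mult add.commute flip: sing_letter_mult)
  qed
  then show ?thesis
    unfolding eta_def
    by (intro lin_into_subspace[OF lin_compose[OF lin_act_left nc_eval_free_lin] subspace_on p[unfolded homogeneous_on]])
      (auto simp: eta_def)
qed

lemma restr_H_P: "restr Hset (restr (Pset l) x) = sing (0, l, 0) (coef x (0, l, 0))"
  "restr (Pset l) (restr Hset x) = sing (0, l, 0) (coef x (0, l, 0))"
proof -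
  have "Hset \<inter> Pset l = {(0, l, 0)}" by (auto simp: Hset_def Pset_def)
  then show "restr Hset (restr (Pset l) x) = sing (0, l, 0) (coef x (0, l, 0))"
    "restr (Pset l) (restr Hset x) = sing (0, l, 0) (coef x (0, l, 0))"
    by (simp_all add: restr_restr restr_single Int_commute)
qed

lemma pi00_P_proj: "pi00 chi J (P_proj chi J l (Psi x)) = Psi (sing (0, l, 0) (coef x (0, l, 0)))"
  and P_proj_pi00: "P_proj chi J l (pi00 chi J (Psi x)) = Psi (sing (0, l, 0) (coef x (0, l, 0)))"
  by (simp_all add: P_proj_Psi pi00_Psi restr_H_P)

text \<open>With both words empty, the weight condition in \<open>Q\<close> reads that l itself lies
  in the submonoid.\<close>

lemma coef_eta_zero:
  assumes "p \<in> homogeneous l" "l \<notin> tau_submonoid tau" shows "coef (eta p) (0, m, 0) = 0"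
proof -
  have "(0, m, 0) \<notin> Q l" using assms(2) by (simp add: Q_def)
  then show ?thesis using eta_Q[OF assms(1)] by (auto simp: on_def in_keys_iff)
qed

end

section \<open>The negative Heisenberg double\<close>

context kalg
begin

lemma lin_span_mult:
  assumes S: "S \<subseteq> carrier A" and T: "T \<subseteq> carrier A" and V: "vsub V"
    and ST: "\<And>s t. s \<in> S \<Longrightarrow> t \<in> T \<Longrightarrow> s \<otimes> t \<in> V"
    and x: "x \<in> lin_span A S" and y: "y \<in> lin_span A T"
  shows "x \<otimes> y \<in> V"
proof -
  note c = vsub_carrier[OF vsub_lin_span[OF S]] vsub_carrier[OF vsub_lin_span[OF T]]
  have "x \<otimes> t \<in> V" if t: "t \<in> T" for t
  proof -
    have tc: "t \<in> carrier A" using t T by auto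
    have "vsub {x \<in> carrier A. x \<otimes> t \<in> V}"
      using V tc by (auto simp: vsub_def l_distr m_assoc)
    from lin_span_minimal[OF this, of S] show ?thesis using S ST t x by auto
  qed
  moreover have "vsub {y \<in> carrier A. x \<otimes> y \<in> V}"
    using V c(1)[OF x] by (auto simp: vsub_def r_distr scal_left_commute)
  ultimately show ?thesis using lin_span_minimal[of "{y \<in> carrier A. x \<otimes> y \<in> V}" T] T y by auto
qed

lemma filtered_gen_filtration:
  assumes v: "\<And>g. v g \<in> carrier A" shows "filtered A (gen_filtration A v d)"
proof -
  let ?S = "\<lambda>m. {list_prod A (map v gs) |gs. sum_list (map d gs) \<le> m}"
  have S: "?S m \<subseteq> carrier A" for m using word_prod_closed[of v, OF v] by auto
  show ?thesis
  proof (unfold_locales, unfold gen_filtration_def)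
    fix m show "vsub (lin_span A (?S m))" by (rule vsub_lin_span[OF S])
    show "lin_span A (?S m) \<subseteq> lin_span A (?S (Suc m))"
      by (rule lin_span_mono[OF _ S]) (use S in \<open>auto intro!: lin_span_base intro: le_SucI\<close>)
  next
    fix x i y j assume "x \<in> lin_span A (?S i)" "y \<in> lin_span A (?S j)"
    then show "x \<otimes> y \<in> lin_span A (?S (i + j))"
    proof (rule lin_span_mult[OF S S vsub_lin_span[OF S], rotated])
      fix s t assume "s \<in> ?S i" "t \<in> ?S j"
      then obtain gs hs where gs: "s = list_prod A (map v gs)" "sum_list (map d gs) \<le> i"
        and hs: "t = list_prod A (map v hs)" "sum_list (map d hs) \<le> j" by blast
      have "s \<otimes> t = list_prod A (map v (gs @ hs))"
        unfolding gs(1) hs(1) map_append using v by (subst list_prod_append) auto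
      moreover have "sum_list (map d (gs @ hs)) \<le> i + j" using gs(2) hs(2) by simp
      ultimately have "s \<otimes> t \<in> ?S (i + j)" by blast
      then show "s \<otimes> t \<in> lin_span A (?S (i + j))" using S by (intro lin_span_base) auto
    qed
  next
    have "\<one> \<in> ?S 0" by (rule CollectI, rule exI[of _ "[]"]) simp
    then show "\<one> \<in> lin_span A (?S 0)" by (rule lin_span_base) simp
  qed
qed

end

section \<open>The polynomial subalgebra and its filtration\<close>

context coideal
begin

abbreviation "Up \<equiv> U_poly chi J tau"
abbreviation "gv \<equiv> poly_gen_value chi J tau"
abbreviation "FU \<equiv> U_poly_filtration chi J tau"

fun gvf :: "'i poly_gen \<Rightarrow> ('i u_gen, 'k) nc_poly" where
  "gvf (PE i) = gE i * gL i" | "gvf (PF i) = gF i" | "gvf (PKinv i) = gL i"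
| "gvf (PKtheta i) = gK i * gL (tau i)"

lemma gv_eq: "gv g = qU (gvf g)"
  by (cases g) (simp_all add: U_Et_def U_E_eq U_F_eq U_Ki_eq U_Kinv_eq qU_simps)

lemma gv_carrier: "range gv \<subseteq> carrier U" by (auto simp: gv_eq)

lemma Up_simps: "carrier Up = gen_subalgebra U (range gv)" "mult Up = mult U" "one Up = one U"
  "zero Up = zero U" "add Up = add U" "scal Up = scal U"
  by (simp_all add: U_poly_def)

lemmas Up_closed = U.gen_subalgebra_props[OF gv_carrier, folded Up_simps(1)]

lemma Up_carrier: "x \<in> carrier Up \<Longrightarrow> x \<in> carrier U"
  using U.vsub_carrier[OF Up_closed(1)] .

lemma gv_Up: "gv g \<in> carrier Up"
  unfolding Up_simps(1) by (rule U.gen_subalgebra_base) simp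

lemma kalg_Up: "kalg Up"
proof -
  have "U \<lparr>carrier := carrier Up\<rparr> = Up" by (simp add: U_poly_def)
  then have ring: "ring Up" using U.subring_is_ring[OF Up_closed(4)] by simp
  have c: "scal Up k \<in> carrier Up" for k unfolding Up_simps(6) by (rule Up_closed(5))
  show ?thesis
    by (intro kalg.intro kalg_axioms.intro ring c)
      (simp_all only: Up_simps(2-6) U.scal_add U.scal_mult U.scal_one U.scal_central Up_carrier)
qed

sublocale Up: kalg Up by (rule kalg_Up)

lemma list_prod_Up: "list_prod Up = list_prod U"
  by (rule ext) (simp add: list_prod_def Up_simps)

lemma lin_span_Up: "S \<subseteq> carrier Up \<Longrightarrow> lin_span Up S = lin_span U S"
proof -
  assume S: "S \<subseteq> carrier Up"
  have am: "add_monoid Up = (add_monoid U)\<lparr>carrier := carrier Up\<rparr>"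
    by (simp add: U_poly_def)
  have sm: "range (scal Up) <#>\<^bsub>Up\<^esub> S = range (scal U) <#>\<^bsub>U\<^esub> S"
    by (simp add: set_mult_def Up_simps)
  have "range (scal U) <#>\<^bsub>U\<^esub> S \<subseteq> carrier Up"
    using S Up_closed(3,5) by (auto simp: set_mult_def)
  then show ?thesis unfolding lin_span_def am sm
    using U.add.generate_consistent[OF _ subring.axioms(1)[OF Up_closed(4)]] by blast
qed

sublocale G: filtered Up FU
  unfolding U_poly_filtration_def by (rule Up.filtered_gen_filtration[OF gv_Up])

definition hsum :: "'i zn \<Rightarrow> int" where "hsum l = (\<Sum>i\<in>UNIV. l $ i)"

lemma hsum_simps [simp]: "hsum (a + b) = hsum a + hsum b" "hsum (a - b) = hsum a - hsum b"
  "hsum (- a) = - hsum a" "hsum 0 = 0" "hsum (alpha i) = 1"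
  by (simp_all add: hsum_def sum.distrib sum_subtractf sum_negf sum_alpha_components)

lemma hsum_word_degree [simp]: "hsum (word_degree w) = int (length (letters w))"
  by (simp add: hsum_def sum_word_degree)

lemma hsum_nonneg: "a \<in> nonneg \<Longrightarrow> 0 \<le> hsum a"
  by (auto simp: nonneg_def hsum_def intro: sum_nonneg)

lemma hsum_nonneg_eq_zero: "a \<in> nonneg \<Longrightarrow> hsum a = 0 \<Longrightarrow> a = 0"
  by (auto simp: nonneg_def hsum_def sum_nonneg_eq_0_iff vec_eq_iff)

text \<open>Applying \<tau> permutes the coordinates and also negates them, so their sum equals its
  own negative.\<close>

lemma hsum_theta: "t \<in> lattice_theta tau \<Longrightarrow> hsum t = 0"
proof -
  assume t: "t \<in> lattice_theta tau"
  have "bij tau" using tau_tau by (metis bijI' )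
  then have "hsum t = (\<Sum>i\<in>UNIV. t $ tau i)" unfolding hsum_def
    by (rule sum.reindex_bij_betw[symmetric])
  also have "\<dots> = - hsum t" using t by (simp add: lattice_theta_iff hsum_def sum_negf)
  finally show ?thesis by simp
qed

lemma hsum_PL: "l \<in> PL \<Longrightarrow> hsum l \<le> 0"
  using hsum_nonneg hsum_theta by (fastforce simp: PL_iff)

text \<open>Up to a scalar \<open>E\<^sub>u K\<^sub>m F\<^sub>v\<close> is \<open>K\<^sub>l\<close>, \<open>l = m + deg u\<close>, multiplied from the left by \<open>length u\<close> generators \<open>E\<^sub>i K\<^sub>i\<^sup>-\<^sup>1\<close> and from the
  right by \<open>length v\<close> generators \<open>F\<^sub>i\<close>; since \<open>K\<^sub>l\<close> has degree \<open>- hsum l\<close>, the lengths of \<open>u\<close> cancel in its degree.\<close>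

definition FS :: "int \<Rightarrow> ('i word \<times> 'i zn \<times> 'i word) set" where
  "FS n = {(u, m, v). m + word_degree u \<in> PL \<and> int (length (letters v)) - hsum m \<le> n}"

lemma FS_mono: "n \<le> n' \<Longrightarrow> x \<in> on (FS n) \<Longrightarrow> x \<in> on (FS n')"
  by (auto simp: FS_def on_def)

text \<open>What remains after splitting off u and v is K_l with l in \<open>PL\<close>, whose
  degree - hsum l is nonnegative.\<close>

lemma FS_length: "(u, m, v) \<in> FS n \<Longrightarrow> int (length (letters u)) + int (length (letters v)) \<le> n"
  using hsum_PL[of "m + word_degree u"] by (simp add: FS_def)

lemma act_gvf_FS:
  assumes x: "x \<in> on (FS n)" shows "act (gvf g) x \<in> on (FS (n + int (poly_gen_degree g)))"
proof (rule lin_into_subspace[OF lin_act subspace_on x])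
  fix b assume b: "b \<in> FS n"
  obtain u m v where buv: "b = (u, m, v)" by (cases b)
  have 1: "m + word_degree u \<in> PL" and 2: "int (length (letters v)) - hsum m \<le> n"
    using b by (auto simp: FS_def buv)
  have sgl: "(u', m', v') \<in> FS n' \<Longrightarrow> sing (u', m', v') k \<in> on (FS n')" for u' m' v' n' and k :: 'k
    by (auto simp: on_def)
  show "act (gvf g) (sing b 1) \<in> on (FS (n + int (poly_gen_degree g)))"
  proof (cases g)
    case (PE i)
    have "(Word [i] + u, m - alpha i, v) \<in> FS (n + 1)" using 1 2 by (simp add: FS_def)
    then show ?thesis using PE by (simp add: buv act_mult opr_sing sgl)
  next
    case (PKinv i)
    have e: "m - alpha i + word_degree u = m + word_degree u - alpha i" by simp
    have "(u, m - alpha i, v) \<in> FS (n + 1)"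
      using PL_minus[OF 1 nonneg_alpha[of i]] 2 by (simp add: FS_def e)
    then show ?thesis using PKinv by (simp add: buv opr_sing sgl)
  next
    case (PKtheta i)
    have e: "m - alpha (tau i) + alpha i + word_degree u = m + word_degree u + (alpha i - alpha (tau i))"
      by simp
    have "(u, m - alpha (tau i) + alpha i, v) \<in> FS n"
      using PL_theta[OF 1 theta_alpha(1)[of i]] 2 by (simp add: FS_def e)
    then show ?thesis using PKtheta by (simp add: buv act_mult opr_sing sgl)
  next
    case (PF i)
    have F: "(u, m, Word [i] + v) \<in> FS (n + 1)" using 1 2 by (simp add: FS_def)
    \<comment> \<open>The term with K_i lowers the degree by one and the term with K_i^{-1} raises
      it by one, so both stay within the degree 1 granted to F_i.\<close>
    have C: "tri (der f i (sing u 1)) m' (sing v 1) \<in> on (FS (n + 1))"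
      if "m' = m + alpha i \<or> m' = m - alpha i" for f m'
    proof -
      have "(u', m', v) \<in> FS (n + 1)" if u': "word_degree u' = word_degree u - alpha i" for u'
      proof -
        have "m' + word_degree u' = m + word_degree u \<or>
            m' + word_degree u' = m + word_degree u - (alpha i + alpha i)"
          using \<open>m' = _ \<or> _\<close> u' by (auto simp: algebra_simps)
        then have "m' + word_degree u' \<in> PL"
          using 1 PL_minus[OF 1 nonneg_add[OF nonneg_alpha[of i] nonneg_alpha[of i]]] by metis
        then show ?thesis using 2 \<open>m' = _ \<or> _\<close> by (auto simp: FS_def)
      qed
      then show ?thesis
        using tri_on[OF der_homogeneous[of f i u], of "sing v 1" "{v}" m'] by (auto simp: on_def)
    qed
    have "opF i (sing (u, m, v) 1) \<in> on (FS (n + 1))"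
      unfolding opF_def lext_sing prod.case
      by (intro pm.subspace_add[OF subspace_on] pm.subspace_diff[OF subspace_on]
          pm.subspace_scale[OF subspace_on] sgl F C) auto
    then show ?thesis using PF by (simp add: buv)
  qed
qed

lemma act_gvfs_FS:
  "act (prod_list (map gvf gs)) X1 \<in> on (FS (int (sum_list (map poly_gen_degree gs))))"
proof (induction gs)
  case Nil
  have "(0, 0, 0) \<in> FS 0" using PL_zero by (simp add: FS_def)
  then show ?case by (simp add: X1_def on_def)
next
  case (Cons g gs)
  then show ?case using act_gvf_FS[OF Cons, of g] by (simp add: act_mult add.commute)
qed

text \<open>For l = - a + t, the part - a takes one generator K_i^{-1} for each unit of a, and t
  takes generators K_i K_\<tau>(i)^{-1} of degree 0. The total is the coordinate sum of a, that is -
  hsum l.\<close>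

lemma PL_word:
  assumes "l \<in> PL"
  shows "\<exists>ks. acts (prod_list (map gvf ks)) l \<and> int (sum_list (map poly_gen_degree ks)) = - hsum l"
proof -
  let ?R = "\<lambda>l ks. acts (prod_list (map gvf ks)) l \<and> int (sum_list (map poly_gen_degree ks)) = - hsum l"
  have app: "?R l ks \<Longrightarrow> ?R m ks' \<Longrightarrow> ?R (l + m) (ks @ ks')" for l m ks ks'
    by (simp add: acts_mult)
  have one: "?R 0 []" by (simp add: acts_one)
  have KL: "?R (- alpha i) [PKinv i]" "?R (alpha i - alpha (tau i)) [PKtheta i]" for i
    using acts_letters acts_mult[OF acts_letters(1)[of i] acts_letters(2)[of "tau i"]] by simp_all
  have neg: "\<exists>ks. ?R (- a) ks" if "a \<in> nonneg" for a
    using that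
  proof (induction "nat (hsum a)" arbitrary: a rule: less_induct)
    case less
    show ?case
    proof (cases "a = 0")
      case True then show ?thesis using one by (intro exI[of _ "[]"]) simp
    next
      case False
      then obtain i where i: "a $ i \<noteq> 0" by (auto simp: vec_eq_iff)
      have "0 \<le> a $ i" using less.prems by (simp add: nonneg_def)
      then have "1 \<le> a $ i" using i by linarith
      then have "a - alpha i \<in> nonneg" using less.prems by (auto simp: nonneg_def alpha_nth)
      moreover from this have "nat (hsum (a - alpha i)) < nat (hsum a)"
        using hsum_nonneg[of "a - alpha i"] by simp
      ultimately obtain ks where "?R (- (a - alpha i)) ks" using less.hyps by blast
      from app[OF KL(1)[of i] this] show ?thesis by (intro exI[of _ "PKinv i # ks"]) simp
    qed
  qed
  have th: "\<exists>ks. ?R t ks" if "t \<in> lattice_theta tau" for t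
    using that
  proof (induction "nat (\<Sum>i\<in>UNIV. \<bar>t $ i\<bar>)" arbitrary: t rule: less_induct)
    case less
    show ?case
    proof (cases "t = 0")
      case True then show ?thesis using one by (intro exI[of _ "[]"]) simp
    next
      case False
      then obtain j where j: "t $ j \<noteq> 0" by (auto simp: vec_eq_iff)
      have tt: "t $ tau k = - (t $ k)" for k using less.prems by (simp add: lattice_theta_iff)
      \<comment> \<open>An entry and its mirror image under \<tau> are opposite, so a nonzero t has
        a positive entry, at an index that \<tau> does not fix. Removing one generator there lowers
        the sum of absolute values.\<close>
      obtain i where i: "t $ i > 0" using j tt[of j] by (cases "t $ j > 0") (auto intro: that[of j] that[of "tau j"])
      have ne: "tau i \<noteq> i" using tt[of i] i by auto
      let ?t = "t - (alpha i - alpha (tau i))"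
      have th: "?t \<in> lattice_theta tau"
        using less.prems theta_alpha(1)[of i] by (simp add: lattice_theta_iff)
      have "(\<Sum>k\<in>UNIV. \<bar>?t $ k\<bar>) < (\<Sum>k\<in>UNIV. \<bar>t $ k\<bar>)"
      proof (rule sum_strict_mono_ex1)
        show "\<forall>k\<in>UNIV. \<bar>?t $ k\<bar> \<le> \<bar>t $ k\<bar>"
          using i ne tt[of i] by (auto simp: alpha_nth)
        show "\<exists>k\<in>UNIV. \<bar>?t $ k\<bar> < \<bar>t $ k\<bar>"
          using i ne by (intro bexI[of _ i]) (auto simp: alpha_nth)
      qed simp
      moreover have "0 \<le> (\<Sum>k\<in>UNIV. \<bar>?t $ k\<bar>)" by (rule sum_nonneg) simp
      ultimately have "nat (\<Sum>k\<in>UNIV. \<bar>?t $ k\<bar>) < nat (\<Sum>k\<in>UNIV. \<bar>t $ k\<bar>)" by linarith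
      then obtain ks where "?R ?t ks" using less.hyps th by blast
      from app[OF KL(2)[of i] this] show ?thesis by (intro exI[of _ "PKtheta i # ks"]) simp
    qed
  qed
  obtain a t where "l = - a + t" "a \<in> nonneg" "t \<in> lattice_theta tau"
    using assms by (auto simp: poly_lattice_def)
  then show ?thesis using neg[of a] th[of t] app by blast
qed

definition Etemb :: "('i, 'k) nc_poly \<Rightarrow> ('i u_gen, 'k) nc_poly" where
  "Etemb = nc_eval free_algebra (\<lambda>i. gE i * gL i)"

lemma emb_prod_list:
  fixes w :: "'i word"
  shows "Etemb (sing w 1) = prod_list (map (\<lambda>i. gE i * gL i) (letters w))"
  and "Femb (sing w 1) = (prod_list (map gF (letters w)) :: ('i u_gen, 'k) nc_poly)"
proof -
  have "nc_eval free_algebra f (sing w 1) = prod_list (map f (letters w))" for f :: "'i \<Rightarrow> ('i u_gen, 'k) nc_poly"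
  proof (induction w rule: word_induct)
    case (letter x w)
    then show ?case
      using nc_eval_free_mult[of f "letter x" "sing w 1"] by (simp add: nc_eval_free_letter sing_letter_mult)
  qed (simp add: nc_eval_free_one)
  then show "Etemb (sing w 1) = prod_list (map (\<lambda>i. gE i * gL i) (letters w))"
    "Femb (sing w 1) = (prod_list (map gF (letters w)) :: ('i u_gen, 'k) nc_poly)"
    by (simp_all add: Etemb_def)
qed

lemma act_Etemb: "\<exists>d. d \<noteq> 0 \<and> act (Etemb (sing u 1)) (sing (0, m, v) 1) = sing (u, m - word_degree u, v) d"
proof (induction u rule: word_induct)
  case zero
  show ?case by (intro exI[of _ 1]) (simp add: Etemb_def nc_eval_free_one)
next
  case (letter i u)
  then obtain d where d: "d \<noteq> 0" "act (Etemb (sing u 1)) (sing (0, m, v) 1) = sing (u, m - word_degree u, v) d"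
    by blast
  have "act (Etemb (sing (Word [i] + u) 1)) (sing (0, m, v) 1) =
      sing (Word [i] + u, m - word_degree (Word [i] + u), v) (d * chim i (word_degree u))"
    using d(2) by (simp add: emb_prod_list act_mult opr_sing diff_diff_eq add.commute)
  moreover have "d * chim i (word_degree u) \<noteq> 0" using d(1) by simp
  ultimately show ?case by blast
qed

lemma act_Femb_X1: "act (Femb (sing v 1)) X1 = sing (0, 0, v) 1"
  using act_Femb[of "sing v 1" 0 1] by (simp add: X1_tri tri_one)

lemma FU_gen: "FU m = lin_span U {list_prod U (map gv gs) |gs. sum_list (map poly_gen_degree gs) \<le> m}"
proof -
  have "list_prod U (map gv gs) \<in> carrier Up" for gs
    using Up.word_prod_closed[of gv, OF gv_Up] by (simp add: list_prod_Up)
  then show ?thesis unfolding U_poly_filtration_def gen_filtration_def list_prod_Up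
    by (subst lin_span_Up) auto
qed

text \<open>Products of generators stay in \<open>FS\<close> by \<open>act_gvfs_FS\<close>.
  Conversely a basis element is, up to a nonzero scalar, a product of generators E_i K_i^{-1} for u,
  a word for the torus from \<open>PL_word\<close> and letters F for v, whose degrees add up to the
  one in \<open>FS\<close>.\<close>

lemma FU_eq: "FU m = Psi ` on (FS (int m))"
  unfolding FU_gen
proof (rule lin_span_Psi)
  let ?S = "{list_prod U (map gv gs) |gs. sum_list (map poly_gen_degree gs) \<le> m}"
  have lp: "list_prod U (map gv gs) = Psi (act (prod_list (map gvf gs)) X1)" for gs
  proof -
    have "gv = (\<lambda>g. qU (gvf g))" by (rule ext) (rule gv_eq)
    then show ?thesis using qU_prod_list[of "map gvf gs"] by (simp add: Psi_act_X1 comp_def)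
  qed
  show "?S \<subseteq> Psi ` on (FS (int m))"
    using FS_mono[OF _ act_gvfs_FS] by (auto simp: lp)
  fix b assume b: "b \<in> FS (int m)"
  obtain u k v where buv: "b = (u, k, v)" by (cases b)
  have PL: "k + word_degree u \<in> PL" and len: "int (length (letters v)) - hsum k \<le> int m"
    using b by (auto simp: FS_def buv)
  obtain ks where ks: "acts (prod_list (map gvf ks)) (k + word_degree u)"
    "int (sum_list (map poly_gen_degree ks)) = - hsum (k + word_degree u)"
    using PL_word[OF PL] by blast
  obtain d where d: "d \<noteq> 0" "act (Etemb (sing u 1)) (sing (0, k + word_degree u, v) 1) = sing (u, k, v) d"
    using act_Etemb[of u "k + word_degree u" v] by auto
  let ?gs = "map PE (letters u) @ ks @ map PF (letters v)"
  have "prod_list (map gvf ?gs) = Etemb (sing u 1) * (prod_list (map gvf ks) * Femb (sing v 1))"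
    by (simp add: emb_prod_list comp_def)
  then have "act (prod_list (map gvf ?gs)) X1 = sing b d"
    using ks(1) d(2) by (simp only: act_mult act_Femb_X1) (simp add: acts_def buv)
  moreover have "sum_list (map poly_gen_degree ?gs) \<le> m"
  proof -
    have "sum_list (map poly_gen_degree (map PE (letters u))) = length (letters u)"
      "sum_list (map poly_gen_degree (map PF (letters v))) = length (letters v)"
      by (simp_all add: comp_def sum_list_triv)
    then have "int (sum_list (map poly_gen_degree ?gs)) \<le> int m"
      using ks(2) len by simp
    then show ?thesis by simp
  qed
  ultimately have "Psi (sing b d) \<in> ?S"
    using lp[of ?gs] by (metis (mono_tags, lifting) mem_Collect_eq)
  then have "Psi (sing b d) \<in> lin_span U ?S" by (rule U.lin_span_base) simp
  moreover have car: "?S \<subseteq> carrier U" using lp by auto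
  ultimately have "Psi (inverse d \<cdot> sing b d) \<in> lin_span U ?S"
    unfolding U.linto_scale[OF linto_Psi] by (intro U.vsub_scal[OF U.vsub_lin_span[OF car]])
  then show "Psi (sing b 1) \<in> lin_span U ?S" using d(1) by simp
qed

text \<open>The bound in \<open>FS\<close> is an integer so that the step before the zeroth is
  covered: \<open>FS (- 1)\<close> is empty and spans the zero space.\<close>

lemma P_eq: "prev_step Up FU m = Psi ` on (FS (int m - 1))"
proof (cases m)
  case 0
  have "FS (- 1) = {}" using FS_length by fastforce
  then have "on (FS (- 1)) = {0 :: ('i, 'k) tri}" by (auto simp: on_def)
  then show ?thesis using 0 by (simp add: prev_step_def Up_simps U.linto_zero[OF linto_Psi])
next
  case (Suc n) then show ?thesis by (simp add: prev_step_def FU_eq)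
qed

section \<open>The Heisenberg double: torus part and augmentation ideals\<close>

abbreviation "gr \<equiv> gr_class Up FU"
abbreviation "H \<equiv> assoc_graded Up FU"
abbreviation "HE \<equiv> Heis_E chi J tau"
abbreviation "HF \<equiv> Heis_F chi J tau"
abbreviation "HK \<equiv> Heis_K chi J tau"

sublocale H: kalg H by (rule G.kalg_Gr)

lemma FU_I: "x \<in> on (FS (int m)) \<Longrightarrow> Psi x \<in> FU m"
  by (simp add: FU_eq)

lemma qU_gvfs_FU: "qU (prod_list (map gvf gs)) \<in> FU (sum_list (map poly_gen_degree gs))"
  unfolding Psi_act_X1[symmetric] by (rule FU_I[OF act_gvfs_FS])

lemma FU_Up: "x \<in> FU m \<Longrightarrow> x \<in> carrier Up"
  by (rule G.Fl_carrier)

lemma U_F_FU: "U_F chi J i \<in> FU 1" and Et_FU: "qU (gE i * gL i) \<in> FU 1"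
  using qU_gvfs_FU[of "[PF i]"] qU_gvfs_FU[of "[PE i]"] by (simp_all add: U_F_eq)

lemma HE_eq: "HE i = gr 1 (qU (gE i * gL i))" and HF_eq: "HF i = gr 1 (qU (gF i))"
  by (simp_all add: Heis_E_def Heis_F_def Heis_class_def U_Et_def U_E_eq U_F_eq U_Kinv_eq qU_simps)

lemma HK_eq: "HK l = gr (nat (- hsum l)) (U_K chi J l)"
  by (simp add: Heis_K_def Heis_class_def hsum_def)

lemma U_K_FU: "l \<in> PL \<Longrightarrow> U_K chi J l \<in> FU (nat (- hsum l))"
  unfolding Psi_H[symmetric]
  by (rule FU_I) (use hsum_PL[of l] in \<open>auto simp: on_def FS_def\<close>)

lemma list_prod_gr:
  assumes x: "\<And>i. x i \<in> FU 1"
  shows "list_prod U (map x ws) \<in> FU (length ws) \<and>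
    list_prod H (map (\<lambda>i. gr 1 (x i)) ws) = gr (length ws) (list_prod U (map x ws))"
proof (induction ws)
  case Nil
  show ?case using G.Fl_one by (simp add: G.Gr_simps(3) Up_simps)
next
  case (Cons i ws)
  then show ?case
    using G.Fl_mult[OF x[of i], of _ "length ws"] G.gr_mult[OF x[of i], of _ "length ws"]
    by (simp add: Up_simps)
qed

lemma nc_eval_gr:
  assumes x: "\<And>i. x i \<in> FU 1"
  shows "nc_eval H (\<lambda>i. gr 1 (x i)) (sing w 1) = gr (length (letters w)) (nc_eval U x (sing w 1))"
    and "nc_eval U x (sing w 1) \<in> FU (length (letters w))"
proof -
  have c: "x i \<in> carrier U" for i using FU_Up[OF x] Up_carrier by blast
  have cg: "gr 1 (x i) \<in> carrier H" for i by (rule G.gr_closed[OF x])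
  note lp = list_prod_gr[of x, OF x, of "letters w"]
  have "list_prod U (map x (letters w)) \<in> carrier U" by (rule U.word_prod_closed[of x, OF c])
  then have e: "nc_eval U x (sing w 1) = list_prod U (map x (letters w))"
    by (simp add: U.nc_eval_sing[of x, OF c])
  then show "nc_eval U x (sing w 1) \<in> FU (length (letters w))" using lp by simp
  show "nc_eval H (\<lambda>i. gr 1 (x i)) (sing w 1) = gr (length (letters w)) (nc_eval U x (sing w 1))"
    using lp e H.nc_eval_sing[of "\<lambda>i. gr 1 (x i)", OF cg, of w 1]
      H.word_prod_closed[of "\<lambda>i. gr 1 (x i)", OF cg, of "letters w"] by simp
qed

lemma HE_closed: "HE i \<in> carrier H" and HF_closed: "HF i \<in> carrier H"
  using G.gr_closed[OF Et_FU] G.gr_closed[OF U_F_FU] by (simp_all add: HE_eq HF_eq U_F_eq)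

lemma nc_eval_HE: "nc_eval H HE (sing w 1) = gr (length (letters w)) (qU (Etemb (sing w 1)))"
  and Etemb_FU: "qU (Etemb (sing w 1)) \<in> FU (length (letters w))"
  using nc_eval_gr[of "\<lambda>i. qU (gE i * gL i)" w, OF Et_FU]
  by (simp_all add: HE_eq[abs_def] qU_nc_eval Etemb_def)

lemma nc_eval_HF: "nc_eval H HF (sing w 1) = gr (length (letters w)) (qU (Femb (sing w 1)))"
  and Femb_FU: "qU (Femb (sing w 1)) \<in> FU (length (letters w))"
  using nc_eval_gr[of "\<lambda>i. qU (gF i)" w] U_F_FU
  by (simp_all add: HF_eq[abs_def] qU_nc_eval U_F_eq)

definition off_torus :: "nat \<Rightarrow> ('i word \<times> 'i zn \<times> 'i word) set" where
  "off_torus m = {(u, l, v). \<not> (u = 0 \<and> v = 0 \<and> hsum l = - int m)}"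

definition torus :: "nat \<Rightarrow> ('i word \<times> 'i zn \<times> 'i word) set" where
  "torus m = {(u, l, v). u = 0 \<and> v = 0 \<and> hsum l = - int m}"

text \<open>\<open>J\<close> has no constant terms, so in each term of a generator of
  \<open>N\<close> the word on one side is nonempty. Hence coefficients at the K_m are functions on
  U.\<close>

lemma N_coef: "x \<in> N \<Longrightarrow> coef x (0, m, 0) = 0"
proof -
  have "tri p l q \<in> on (- Hset)" if "p \<in> J \<or> q \<in> J" for p q l
  proof -
    have z: "y \<in> on (- {0})" if "y \<in> J" for y
      using J_coef[OF that, of 0] by (auto simp: on_def in_keys_iff)
    have u: "y \<in> on UNIV" for y :: "('i, 'k) nc_poly" by (simp add: on_def)
    from that show ?thesis
    proof
      assume "p \<in> J"
      from tri_on[OF z[OF this] u[of q], of l] show ?thesis by (auto simp: on_def Hset_def)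
    next
      assume "q \<in> J"
      from tri_on[OF u[of p] z[OF this], of l] show ?thesis by (auto simp: on_def Hset_def)
    qed
  qed
  then have "N \<subseteq> on (- Hset)" unfolding N_def by (intro pm.span_minimal subspace_on) auto
  moreover have "(0, m, 0) \<in> Hset" by (simp add: Hset_def)
  ultimately show "x \<in> N \<Longrightarrow> coef x (0, m, 0) = 0"
    unfolding on_def using in_keys_iff[of "(0, m, 0)" x] by blast
qed

lemma Psi_off_torus: "Psi x \<in> Psi ` on (off_torus m) \<Longrightarrow> hsum l = - int m \<Longrightarrow> coef x (0, l, 0) = 0"
proof -
  assume "Psi x \<in> Psi ` on (off_torus m)" and l: "hsum l = - int m"
  then obtain y where y: "y \<in> on (off_torus m)" "x - y \<in> N" using Psi_eq_iff by auto
  have "coef y (0, l, 0) = 0" using y(1) l by (auto simp: on_def off_torus_def in_keys_iff)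
  then show ?thesis using N_coef[OF y(2), of l] by (simp add: lookup_minus)
qed

lemma Up_vsub: "U.vsub V \<Longrightarrow> Up.vsub (carrier Up \<inter> V)"
  using Up_closed(1) unfolding Up.vsub_def U.vsub_def Up_simps(2-) by blast

definition Up_on :: "('i word \<times> 'i zn \<times> 'i word) set \<Rightarrow> ('i, 'k) u set" where
  "Up_on B = carrier Up \<inter> Psi ` on B"

lemma vsub_Up_on: "Up.vsub (Up_on B)"
  unfolding Up_on_def by (rule Up_vsub[OF vsub_Psi_on])

definition gr_on :: "(nat \<Rightarrow> ('i word \<times> 'i zn \<times> 'i word) set) \<Rightarrow> ('i, 'k) heis set" where
  "gr_on B = {f \<in> carrier H. \<forall>m. \<exists>x\<in>f m. x \<in> Up_on (B m)}"

lemma vsub_gr_on: "H.vsub (gr_on B)"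
  unfolding gr_on_def by (rule G.vsub_componentwise) (rule vsub_Up_on)

text \<open>The first letter of w is prepended to the E-part of every term, so no torus term is
  left, whatever h contributes.\<close>

lemma HE_mult_gr_on:
  assumes h: "h \<in> carrier H" and w: "w \<noteq> 0"
  shows "nc_eval H HE (sing w 1) \<otimes>\<^bsub>H\<^esub> h \<in> gr_on off_torus"
  unfolding gr_on_def
proof (intro CollectI conjI allI)
  show "nc_eval H HE (sing w 1) \<otimes>\<^bsub>H\<^esub> h \<in> carrier H"
    by (intro H.m_closed h H.nc_eval_closed HE_closed)
  fix m
  let ?k = "length (letters w)" and ?x = "qU (Etemb (sing w 1))"
  let ?y = "G.rep h (m - ?k)"
  have y: "?y \<in> h (m - ?k)" "?y \<in> carrier Up" using G.rep_mem[OF h] G.rep_carrier[OF h] by auto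
  have "?x \<otimes>\<^bsub>U\<^esub> ?y \<in> Up_on (off_torus m)"
  proof -
    obtain z where z: "?y = Psi z" using Up_carrier[OF y(2)] carrier_U_Psi by auto
    obtain i w' where iw: "w = Word [i] + w'"
      using w by (induction w rule: word_induct) auto
    have "act (Etemb (sing w 1)) z = opE i (act (gL i * Etemb (sing w' 1)) z)"
      by (simp add: iw emb_prod_list act_mult)
    also have "\<dots> \<in> on (off_torus m)"
      by (rule lin_into_subspace[OF lin_ops(1) subspace_on, of _ UNIV])
        (auto simp: on_def off_torus_def opE_def)
    finally have "?x \<otimes>\<^bsub>U\<^esub> ?y \<in> Psi ` on (off_torus m)" unfolding z Psi_act[symmetric] by blast
    moreover have "?x \<otimes>\<^bsub>U\<^esub> ?y \<in> carrier Up" by (rule Up_closed(3)[OF FU_Up[OF Etemb_FU] y(2)])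
    ultimately show ?thesis by (simp add: Up_on_def)
  qed
  then have "(if ?k \<le> m then ?x \<otimes>\<^bsub>Up\<^esub> ?y else \<zero>\<^bsub>Up\<^esub>) \<in> Up_on (off_torus m)"
    using Up.vsub_zero[OF vsub_Up_on] by (simp add: Up_simps)
  then show "\<exists>x\<in>(nc_eval H HE (sing w 1) \<otimes>\<^bsub>H\<^esub> h) m. x \<in> Up_on (off_torus m)"
    using G.gr_mult_coset(1)[OF Etemb_FU h y(1)] unfolding nc_eval_HE by blast
qed

text \<open>Right multiplication is not given by \<open>act\<close>, but letters F on the right
  simply extend the F-part of a basis element.\<close>

lemma HF_mult_gr_on:
  assumes h: "h \<in> carrier H" and w: "w \<noteq> 0"
  shows "h \<otimes>\<^bsub>H\<^esub> nc_eval H HF (sing w 1) \<in> gr_on off_torus"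
  unfolding gr_on_def
proof (intro CollectI conjI allI)
  show "h \<otimes>\<^bsub>H\<^esub> nc_eval H HF (sing w 1) \<in> carrier H"
    by (intro H.m_closed h H.nc_eval_closed HF_closed)
  fix m
  let ?k = "length (letters w)" and ?x = "qU (Femb (sing w 1))"
  let ?y = "G.rep h (m - ?k)"
  have y: "?y \<in> h (m - ?k)" "?y \<in> carrier Up" using G.rep_mem[OF h] G.rep_carrier[OF h] by auto
  have "?y \<otimes>\<^bsub>U\<^esub> ?x \<in> Up_on (off_torus m)"
  proof -
    obtain z where z: "?y = Psi z" using Up_carrier[OF y(2)] carrier_U_Psi by auto
    have "Psi (sing b 1) \<otimes>\<^bsub>U\<^esub> ?x \<in> Psi ` on (off_torus m)" for b
    proof -
      obtain u l v where b: "b = (u, l, v)" by (cases b)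
      have "Psi (sing b 1) \<otimes>\<^bsub>U\<^esub> ?x = Psi (sing (u, l, v + w) 1)"
        using Psi_tri_Femb[of "sing u 1" l "sing v 1" "sing w 1"] by (simp add: b tri_sing mult_single)
      then show ?thesis using w Psi_on_basis[of "(u, l, v + w)" "off_torus m" 1] by (simp add: off_torus_def)
    qed
    then have "Psi z \<otimes>\<^bsub>U\<^esub> ?x \<in> Psi ` on (off_torus m)"
      using U.linto_into[OF U.linto_mult_right[OF linto_Psi] vsub_Psi_on, of ?x z UNIV] by (simp add: on_def)
    moreover have "?y \<otimes>\<^bsub>U\<^esub> ?x \<in> carrier Up" by (rule Up_closed(3)[OF y(2) FU_Up[OF Femb_FU]])
    ultimately show ?thesis by (simp add: Up_on_def z)
  qed
  then have "(if ?k \<le> m then ?y \<otimes>\<^bsub>Up\<^esub> ?x else \<zero>\<^bsub>Up\<^esub>) \<in> Up_on (off_torus m)"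
    using Up.vsub_zero[OF vsub_Up_on] by (simp add: Up_simps)
  then show "\<exists>x\<in>(h \<otimes>\<^bsub>H\<^esub> nc_eval H HF (sing w 1)) m. x \<in> Up_on (off_torus m)"
    using G.gr_mult_coset(2)[OF Femb_FU h y(1)] unfolding nc_eval_HF by blast
qed

abbreviation "Eaug \<equiv> Heis_G_plus_aug chi J tau"
abbreviation "Faug \<equiv> Heis_U_minus_aug chi J tau"

definition Waug :: "('i, 'k) heis set" where
  "Waug = (Eaug <#>\<^bsub>H\<^esub> carrier H) \<union> (carrier H <#>\<^bsub>H\<^esub> Faug)"

lemma Waug_gr_on: "Waug \<subseteq> gr_on off_torus"
proof -
  have E: "nc_eval H HE p \<otimes>\<^bsub>H\<^esub> h \<in> gr_on off_torus" if "counit p = 0" "h \<in> carrier H" for p h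
  proof (rule H.linto_into[OF H.linto_mult_right[OF H.linto_nc_eval] vsub_gr_on, of HE h p "- {0}"])
    show "p \<in> on (- {0})" using that(1) by (auto simp: on_def counit_def in_keys_iff)
  qed (simp_all add: HE_closed HE_mult_gr_on that)
  have F: "h \<otimes>\<^bsub>H\<^esub> nc_eval H HF p \<in> gr_on off_torus" if "counit p = 0" "h \<in> carrier H" for p h
  proof (rule H.linto_into[OF H.linto_mult_left[OF H.linto_nc_eval] vsub_gr_on, of HF h p "- {0}"])
    show "p \<in> on (- {0})" using that(1) by (auto simp: on_def counit_def in_keys_iff)
  qed (simp_all add: HF_closed HF_mult_gr_on that)
  show ?thesis
    unfolding Waug_def Heis_G_plus_aug_def Heis_U_minus_aug_def Heis_def set_mult_def
    using E F by auto
qed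

lemma HK_closed: "l \<in> PL \<Longrightarrow> HK l \<in> carrier H"
  unfolding HK_eq by (rule G.gr_closed[OF U_K_FU])

lemma HK_gr_on: "HK ` PL \<subseteq> gr_on torus"
proof
  fix f assume "f \<in> HK ` PL"
  then obtain l where l: "l \<in> PL" "f = HK l" by auto
  have "\<exists>x\<in>f m. x \<in> Up_on (torus m)" for m
  proof (rule bexI)
    show "(if m = nat (- hsum l) then U_K chi J l else \<zero>\<^bsub>Up\<^esub>) \<in> f m"
      unfolding l HK_eq by (rule G.gr_mem[OF U_K_FU[OF l(1)]])
    have "U_K chi J l \<in> Psi ` on (torus (nat (- hsum l)))"
      unfolding Psi_H[symmetric] using hsum_PL[OF l(1)] by (intro Psi_on_basis) (simp add: torus_def)
    then show "(if m = nat (- hsum l) then U_K chi J l else \<zero>\<^bsub>Up\<^esub>) \<in> Up_on (torus m)"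
      using FU_Up[OF U_K_FU[OF l(1)]] Up.vsub_zero[OF vsub_Up_on] by (simp add: Up_on_def)
  qed
  then show "f \<in> gr_on torus" using HK_closed[OF l(1)] l(2) by (simp add: gr_on_def)
qed

text \<open>Two representatives in one degree differ by an element of lower filtration, which is off
  the torus. So the torus representative is off the torus as well, and its coefficients, well
  defined modulo \<open>N\<close>, vanish.\<close>

lemma gr_on_disjoint: "gr_on torus \<inter> gr_on off_torus \<subseteq> {\<zero>\<^bsub>H\<^esub>}"
proof
  fix f assume f: "f \<in> gr_on torus \<inter> gr_on off_torus"
  then have fc: "f \<in> carrier H" by (simp add: gr_on_def)
  have "\<zero>\<^bsub>Up\<^esub> \<in> f m" for m
  proof -
    obtain x y where x: "x \<in> f m" "x \<in> Up_on (torus m)" and y: "y \<in> f m" "y \<in> Up_on (off_torus m)"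
      using f unfolding gr_on_def by blast
    have yc: "y \<in> carrier Up" using y(2) by (simp add: Up_on_def)
    have xc: "x \<in> carrier Up" using x(2) by (simp add: Up_on_def)
    have "x \<ominus>\<^bsub>Up\<^esub> y \<in> prev_step Up FU m"
      using x(1) G.mem_coset[OF fc y(1)] Up.coset_mem[OF G.vsub_P yc] by simp
    moreover have "on (FS (int m - 1)) \<subseteq> on (off_torus m)"
      by (auto simp: on_def FS_def off_torus_def)
    ultimately have "x \<ominus>\<^bsub>Up\<^esub> y \<in> Up_on (off_torus m)"
      using xc yc by (auto simp: P_eq Up_on_def)
    then have "(x \<ominus>\<^bsub>Up\<^esub> y) \<oplus>\<^bsub>Up\<^esub> y \<in> Up_on (off_torus m)"
      using y(2) by (rule Up.vsub_add[OF vsub_Up_on])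
    then have xK: "x \<in> Up_on (off_torus m)" using xc yc by (simp add: Up.minus_eq Up.a_assoc Up.l_neg)
    obtain z where z: "z \<in> on (torus m)" "x = Psi z" using x(2) by (auto simp: Up_on_def)
    have "coef z b = 0" for b
    proof (cases "b \<in> torus m")
      case True
      then obtain l where "b = (0, l, 0)" "hsum l = - int m" by (cases b) (auto simp: torus_def)
      then show ?thesis using Psi_off_torus[of z m l] xK z(2) by (simp add: Up_on_def)
    next
      case False
      then show ?thesis using z(1) by (auto simp: on_def in_keys_iff)
    qed
    then have "z = 0" by (intro poly_mapping_eqI) simp
    then show ?thesis using x(1) z(2) by (simp add: U.linto_zero[OF linto_Psi] Up_simps)
  qed
  moreover have "\<zero>\<^bsub>Up\<^esub> \<in> \<zero>\<^bsub>H\<^esub> m" for m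
    by (simp add: G.Gr_simps(2) Up.vsub_zero[OF G.vsub_P])
  ultimately have "f = \<zero>\<^bsub>H\<^esub>" by (intro G.Gr_eqI[OF fc H.zero_closed]) blast
  then show "f \<in> {\<zero>\<^bsub>H\<^esub>}" by simp
qed

lemma Waug_carrier: "Waug \<subseteq> carrier H" using Waug_gr_on by (auto simp: gr_on_def)

lemma pi00_Heis_eq:
  assumes "x \<in> carrier H" "y \<in> lin_span H (HK ` PL)" "x \<ominus>\<^bsub>H\<^esub> y \<in> lin_span H Waug"
  shows "pi00_Heis chi J tau x = y"
proof -
  have HKc: "HK ` PL \<subseteq> carrier H" using HK_closed by auto
  have "lin_span H (HK ` PL) \<inter> lin_span H Waug \<subseteq> {\<zero>\<^bsub>H\<^esub>}"
    using H.lin_span_minimal[OF vsub_gr_on HK_gr_on] H.lin_span_minimal[OF vsub_gr_on Waug_gr_on] gr_on_disjoint by blast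
  from H.proj_along_eq[OF H.vsub_lin_span[OF HKc] H.vsub_lin_span[OF Waug_carrier] this assms]
  show ?thesis by (simp add: pi00_Heis_def Heis_def Waug_def)
qed

section \<open>Symbols of the B_i and comparison of the projections\<close>

lemma B_Heis_eq: "B_Heis chi J tau c i = gr 1 (B_elem chi J tau c i)"
  and B_elem_FU: "B_elem chi J tau c i \<in> FU 1"
proof -
  let ?d = "alpha (tau i) - alpha i" and ?E = "qU (gE (tau i) * gL (tau i))"
  have d: "?d \<in> PL" using PL_theta[OF PL_zero theta_alpha(2)[of i]] by simp
  have K: "HK ?d = gr 0 (U_K chi J ?d)" "U_K chi J ?d \<in> FU 0"
    using U_K_FU[OF d] by (simp_all add: HK_eq)
  \<comment> \<open>The K_\<tau>(i)^{-1} inside the Heisenberg generator cancels against the torus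
    factor, which has degree 0; what remains is the E-term of B_i.\<close>
  have "act (gE (tau i) * gL (tau i) * Kf ?d) X1 = act (gE (tau i) * gL i) X1"
    using acts_Kf[of ?d] by (simp add: act_mult acts_def X1_def opr_sing)
  from arg_cong[OF this, of Psi]
  have e: "?E \<otimes>\<^bsub>U\<^esub> U_K chi J ?d = qU (gE (tau i) * gL i)"
    by (simp add: Psi_act_X1 qU_simps U_K_eq)
  have cE: "scal U (c $ i) \<otimes>\<^bsub>U\<^esub> ?E \<in> FU 1"
    using Up.vsub_scal[OF G.Fl_vsub Et_FU] by (simp add: Up_simps)
  have cEK: "scal U (c $ i) \<otimes>\<^bsub>U\<^esub> ?E \<otimes>\<^bsub>U\<^esub> U_K chi J ?d \<in> FU 1"
    using G.Fl_mult[OF cE K(2)] by (simp add: Up_simps)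
  have B: "B_elem chi J tau c i = U_F chi J i \<oplus>\<^bsub>U\<^esub> (scal U (c $ i) \<otimes>\<^bsub>U\<^esub> ?E \<otimes>\<^bsub>U\<^esub> U_K chi J ?d)"
  proof -
    have "U_K chi J ?d \<in> carrier U" by (simp add: U_K_eq)
    then have "scal U (c $ i) \<otimes>\<^bsub>U\<^esub> ?E \<otimes>\<^bsub>U\<^esub> U_K chi J ?d = scal U (c $ i) \<otimes>\<^bsub>U\<^esub> qU (gE (tau i) * gL i)"
      by (subst U.m_assoc) (simp_all only: e U.scal_closed qU_closed)
    then show ?thesis by (simp only: B_elem_def U_E_eq U_Kinv_eq)
      (simp add: qU_simps U.m_assoc)
  qed
  show "B_elem chi J tau c i \<in> FU 1"
    unfolding B using Up.vsub_add[OF G.Fl_vsub U_F_FU cEK] by (simp add: Up_simps)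
  have "B_Heis chi J tau c i = HF i \<oplus>\<^bsub>H\<^esub> scal H (c $ i) \<otimes>\<^bsub>H\<^esub> HE (tau i) \<otimes>\<^bsub>H\<^esub> HK ?d"
    by (simp add: B_Heis_def Heis_def)
  also have "scal H (c $ i) \<otimes>\<^bsub>H\<^esub> HE (tau i) = gr 1 (scal U (c $ i) \<otimes>\<^bsub>U\<^esub> ?E)"
    unfolding HE_eq G.gr_scal[OF Et_FU] by (simp add: Up_simps)
  also have "gr 1 (scal U (c $ i) \<otimes>\<^bsub>U\<^esub> ?E) \<otimes>\<^bsub>H\<^esub> HK ?d = gr 1 (scal U (c $ i) \<otimes>\<^bsub>U\<^esub> ?E \<otimes>\<^bsub>U\<^esub> U_K chi J ?d)"
    unfolding K(1) G.gr_mult[OF cE K(2)] by (simp add: Up_simps)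
  also have "HF i \<oplus>\<^bsub>H\<^esub> gr 1 (scal U (c $ i) \<otimes>\<^bsub>U\<^esub> ?E \<otimes>\<^bsub>U\<^esub> U_K chi J ?d) = gr 1 (B_elem chi J tau c i)"
    using G.gr_add[OF U_F_FU cEK] unfolding B by (simp add: HF_eq U_F_eq Up_simps)
  finally show "B_Heis chi J tau c i = gr 1 (B_elem chi J tau c i)" .
qed

text \<open>Every word of degree l has hsum l letters, so all terms of p have their symbols in the
  same degree and these add up.\<close>

lemma nc_eval_B_Heis:
  assumes p: "p \<in> homogeneous l"
  shows "nc_eval H (B_Heis chi J tau c) p = gr (nat (hsum l)) (Psi (eta p))"
    and "Psi (eta p) \<in> FU (nat (hsum l))"
proof -
  let ?m = "nat (hsum l)" and ?B = "B_elem chi J tau c" and ?C = "B_Heis chi J tau c"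
  have Bc: "?B i \<in> carrier U" for i by (simp add: B_elem_eq)
  have Cc: "?C i \<in> carrier H" for i unfolding B_Heis_eq by (rule G.gr_closed[OF B_elem_FU])
  note l1 = U.linto_nc_eval[of ?B, OF Bc] and l2 = H.linto_nc_eval[of ?C, OF Cc]
  let ?S = "{p. nc_eval U ?B p \<in> FU ?m \<and> nc_eval H ?C p = gr ?m (nc_eval U ?B p)}"
  have sub: "pm.subspace ?S"
    unfolding pm.subspace_def
  proof (intro conjI ballI allI)
    show "0 \<in> ?S"
      using Up.vsub_zero[OF G.Fl_vsub] G.gr_zero[OF Up.vsub_zero[OF G.vsub_P], of ?m]
      by (simp add: U.linto_zero[OF l1] H.linto_zero[OF l2] Up_simps)
  next
    fix x y assume "x \<in> ?S" "y \<in> ?S"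
    then show "x + y \<in> ?S"
      using Up.vsub_add[OF G.Fl_vsub, of "nc_eval U ?B x" ?m "nc_eval U ?B y"]
        G.gr_add[of "nc_eval U ?B x" ?m "nc_eval U ?B y"]
      by (simp add: U.linto_add[OF l1] H.linto_add[OF l2] Up_simps)
  next
    fix k x assume "x \<in> ?S"
    then show "k \<cdot> x \<in> ?S"
      using Up.vsub_scal[OF G.Fl_vsub, of "nc_eval U ?B x" ?m k] G.gr_scal[of "nc_eval U ?B x" ?m k]
      by (simp add: U.linto_scale[OF l1] H.linto_scale[OF l2] Up_simps)
  qed
  have "p \<in> ?S"
  proof (rule lin_into_subspace[OF lin_id sub p[unfolded homogeneous_on]])
    fix w :: "'i word" assume "w \<in> {w. word_degree w = l}"
    then have "?m = length (letters w)" using hsum_word_degree[of w] by simp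
    moreover have "?C = (\<lambda>i. gr 1 (?B i))" by (rule ext) (rule B_Heis_eq)
    ultimately show "sing w 1 \<in> ?S" using nc_eval_gr[of ?B w, OF B_elem_FU] by simp
  qed
  then show "nc_eval H ?C p = gr ?m (Psi (eta p))" "Psi (eta p) \<in> FU ?m"
    by (simp_all add: nc_eval_B)
qed

text \<open>A nonempty u is split off on the left as a product of elements E_i K_i^{-1}, up to a
  nonzero scalar; otherwise v is split off on the right. By \<open>FS_length\<close> the length
  removed is at most n, so the other factor has a class in the complementary degree.\<close>

lemma gr_basis_Waug:
  assumes b: "(u, m, v) \<in> FS (int n)" and uv: "u \<noteq> 0 \<or> v \<noteq> 0"
  shows "gr n (Psi (sing (u, m, v) 1)) \<in> lin_span H Waug"
proof (cases "u = 0")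
  case False
  let ?k = "length (letters u)" and ?y = "Psi (sing (0, m + word_degree u, v) 1)"
  obtain d where d: "d \<noteq> 0" "act (Etemb (sing u 1)) (sing (0, m + word_degree u, v) 1) = sing (u, m, v) d"
    using act_Etemb[of u "m + word_degree u" v] by auto
  have k: "?k \<le> n" using FS_length[OF b] by linarith
  have "(0, m + word_degree u, v) \<in> FS (int (n - ?k))" using b k by (simp add: FS_def of_nat_diff)
  then have y: "?y \<in> FU (n - ?k)" by (intro FU_I) (simp add: on_def)
  have "qU (Etemb (sing u 1)) \<otimes>\<^bsub>U\<^esub> ?y = Psi (sing (u, m, v) d)"
    unfolding Psi_act[symmetric] d(2) ..
  then have "nc_eval H HE (sing u 1) \<otimes>\<^bsub>H\<^esub> gr (n - ?k) ?y = gr n (Psi (sing (u, m, v) d))"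
    unfolding nc_eval_HE G.gr_mult[OF Etemb_FU y] using k by (simp add: Up_simps)
  moreover have "nc_eval H HE (sing u 1) \<in> Eaug"
    unfolding Heis_G_plus_aug_def Heis_def using False
    by (intro imageI) (simp add: counit_def lookup_single)
  ultimately have "gr n (Psi (sing (u, m, v) d)) \<in> Waug"
    using G.gr_closed[OF y] unfolding Waug_def set_mult_def by (intro UnI1) force
  then have "gr n (Psi (sing (u, m, v) d)) \<in> lin_span H Waug"
    using Waug_carrier by (intro H.lin_span_base) auto
  from H.vsub_scal[OF H.vsub_lin_span[OF Waug_carrier] this, of "inverse d"]
  have "gr n (scal Up (inverse d) \<otimes>\<^bsub>Up\<^esub> Psi (sing (u, m, v) d)) \<in> lin_span H Waug"
    using b by (subst (asm) G.gr_scal) (auto intro!: FU_I simp: on_def)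
  then show ?thesis
    using d(1) by (simp add: Up_simps flip: U.linto_scale[OF linto_Psi])
next
  case True
  then have v: "v \<noteq> 0" using uv by simp
  let ?k = "length (letters v)" and ?y = "Psi (sing (0, m, 0) 1)"
  have k: "?k \<le> n" using FS_length[OF b] by linarith
  have "(0, m, 0) \<in> FS (int (n - ?k))" using b k True by (simp add: FS_def of_nat_diff)
  then have y: "?y \<in> FU (n - ?k)" by (intro FU_I) (simp add: on_def)
  have "?y \<otimes>\<^bsub>U\<^esub> qU (Femb (sing v 1)) = Psi (sing (u, m, v) 1)"
    using Psi_tri_Femb[of 1 m 1 "sing v 1"] tri_one[of m 0 1] True by (simp add: tri_one)
  then have "gr (n - ?k) ?y \<otimes>\<^bsub>H\<^esub> nc_eval H HF (sing v 1) = gr n (Psi (sing (u, m, v) 1))"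
    unfolding nc_eval_HF G.gr_mult[OF y Femb_FU] using k by (simp add: Up_simps)
  moreover have "nc_eval H HF (sing v 1) \<in> Faug"
    unfolding Heis_U_minus_aug_def Heis_def using v
    by (intro imageI) (simp add: counit_def lookup_single)
  ultimately have "gr n (Psi (sing (u, m, v) 1)) \<in> Waug"
    using G.gr_closed[OF y] unfolding Waug_def set_mult_def by (intro UnI2) force
  then show ?thesis using Waug_carrier by (intro H.lin_span_base) auto
qed

lemma gr_Waug:
  assumes x: "x \<in> on (FS (int n) - Hset)" shows "gr n (Psi x) \<in> lin_span H Waug"
proof -
  let ?S = "{x. x \<in> on (FS (int n)) \<and> gr n (Psi x) \<in> lin_span H Waug}"
  note W = H.vsub_lin_span[OF Waug_carrier]
  have sub: "pm.subspace ?S"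
    unfolding pm.subspace_def
  proof (intro conjI ballI allI)
    have "gr n (Psi 0) = \<zero>\<^bsub>H\<^esub>"
      using G.gr_zero[OF Up.vsub_zero[OF G.vsub_P], of n] by (simp add: U.linto_zero[OF linto_Psi] Up_simps)
    then show "0 \<in> ?S" using H.vsub_zero[OF W] by (simp add: on_def)
  next
    fix x y assume xy: "x \<in> ?S" "y \<in> ?S"
    then have "gr n (Psi (x + y)) = gr n (Psi x) \<oplus>\<^bsub>H\<^esub> gr n (Psi y)"
      using G.gr_add[OF FU_I FU_I, of x n y] by (simp add: U.linto_add[OF linto_Psi] Up_simps)
    then show "x + y \<in> ?S" using xy H.vsub_add[OF W] pm.subspace_add[OF subspace_on[of "FS (int n)"], of x y] by simp
  next
    fix k x assume x: "x \<in> ?S"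
    then have "gr n (Psi (k \<cdot> x)) = scal H k \<otimes>\<^bsub>H\<^esub> gr n (Psi x)"
      using G.gr_scal[OF FU_I, of x n k] by (simp add: U.linto_scale[OF linto_Psi] Up_simps)
    then show "k \<cdot> x \<in> ?S" using x H.vsub_scal[OF W] pm.subspace_scale[OF subspace_on[of "FS (int n)"], of x k] by simp
  qed
  have "x \<in> ?S"
  proof (rule lin_into_subspace[OF lin_id sub x])
    fix b assume b: "b \<in> FS (int n) - Hset"
    obtain u m v where buv: "b = (u, m, v)" by (cases b)
    then have "u \<noteq> 0 \<or> v \<noteq> 0" using b by (auto simp: Hset_def)
    then show "sing b 1 \<in> ?S" using gr_basis_Waug[of u m v n] b buv by (simp add: on_def)
  qed
  then show ?thesis by simp
qed

text \<open>The degree of a basis element in \<open>Q l\<close> is hsum l minus the coordinate sum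
  of the nonnegative vector m - deg v + l. It is maximal exactly when this vector vanishes, that is,
  in the summand of - l.\<close>

lemma Q_FS: "Q l \<subseteq> FS (hsum l)" and Q_FS_less: "Q l - Pset (- l) \<subseteq> FS (hsum l - 1)"
proof -
  have *: "b \<in> FS (hsum l) \<and> (b \<notin> Pset (- l) \<longrightarrow> b \<in> FS (hsum l - 1))" if b: "b \<in> Q l" for b
  proof -
    obtain u m v where buv: "b = (u, m, v)" by (cases b)
    have nn: "m - word_degree v + l \<in> nonneg" and PL: "m + word_degree u \<in> PL"
      using b by (auto simp: Q_def buv)
    have "m - word_degree v + l \<noteq> 0" if "b \<notin> Pset (- l)"
      using that by (auto simp: Pset_def buv algebra_simps eq_neg_iff_add_eq_0)
    then have "hsum (m - word_degree v + l) > 0" if "b \<notin> Pset (- l)"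
      using that hsum_nonneg[OF nn] hsum_nonneg_eq_zero[OF nn] by fastforce
    then show ?thesis using hsum_nonneg[OF nn] PL by (auto simp: FS_def buv)
  qed
  then show "Q l \<subseteq> FS (hsum l)" "Q l - Pset (- l) \<subseteq> FS (hsum l - 1)" by blast+
qed

lemma pi00_Heis_B:
  assumes p: "p \<in> homogeneous l" and l: "l \<in> nonneg"
  shows "pi00_Heis chi J tau (nc_eval H (B_Heis chi J tau c) p) =
    scal H (coef (eta p) (0, - l, 0)) \<otimes>\<^bsub>H\<^esub> HK (- l)"
proof -
  define m where "m = nat (hsum l)"
  have m: "int m = hsum l" using hsum_nonneg[OF l] by (simp add: m_def)
  let ?x = "eta p" and ?b = "(0, - l, 0) :: 'i word \<times> 'i zn \<times> 'i word"
  let ?a = "coef ?x ?b"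
  have x: "?x \<in> on (Q l)" by (rule eta_Q[OF p])
  have lPL: "- l \<in> PL" using PL_minus[OF PL_zero l] by simp
  \<comment> \<open>The torus term of the summand - l, the rest of that summand, and all other
    summands. The class in degree m kills the last part, and the middle one goes to the augmentation
    ideals because its terms contain a nonempty word.\<close>
  let ?x1 = "sing ?b ?a" and ?x2 = "restr (Pset (- l) - {?b}) ?x" and ?x3 = "restr (- Pset (- l)) ?x"
  have bP: "?b \<in> Pset (- l)" by (simp add: Pset_def)
  have dec: "?x = ?x1 + (?x2 + ?x3)"
    by (rule poly_mapping_eqI) (use bP in \<open>auto simp: lookup_add coef_restr lookup_single when_def\<close>)
  have on: "?x1 \<in> on (FS (int m))" "?x2 \<in> on (FS (int m) - Hset)" "?x3 \<in> on (FS (int m - 1))"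
  proof -
    have "?b \<in> FS (int m)" using lPL by (simp add: FS_def m)
    then show "?x1 \<in> on (FS (int m))" by (auto simp: on_def)
    have "Pset (- l) \<inter> Hset = {?b}" by (auto simp: Pset_def Hset_def)
    then show "?x2 \<in> on (FS (int m) - Hset)"
      using x Q_FS[of l] by (simp add: on_def supp_restr m) blast
    show "?x3 \<in> on (FS (int m - 1))"
      using x Q_FS_less[of l] by (simp add: on_def supp_restr m) blast
  qed
  have F: "Psi ?x1 \<in> FU m" "Psi ?x2 \<in> FU m" and P3: "Psi ?x3 \<in> prev_step Up FU m"
    using on by (auto simp: P_eq on_def intro!: FU_I)
  have F3: "Psi ?x3 \<in> FU m" using G.P_Fl[OF P3] .
  have F23: "Psi (?x2 + ?x3) \<in> FU m"
    using Up.vsub_add[OF G.Fl_vsub F(2) F3] by (simp add: U.linto_add[OF linto_Psi] Up_simps)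
  have g: "gr m (Psi x) \<oplus>\<^bsub>H\<^esub> gr m (Psi y) = gr m (Psi (x + y))" if "Psi x \<in> FU m" "Psi y \<in> FU m" for x y
    using G.gr_add[OF that] by (simp add: U.linto_add[OF linto_Psi] Up_simps)
  have "gr m (Psi ?x) = gr m (Psi ?x1) \<oplus>\<^bsub>H\<^esub> (gr m (Psi ?x2) \<oplus>\<^bsub>H\<^esub> gr m (Psi ?x3))"
    unfolding g[OF F(2) F3] g[OF F(1) F23] dec[symmetric] ..
  also have "\<dots> = gr m (Psi ?x1) \<oplus>\<^bsub>H\<^esub> gr m (Psi ?x2)"
    using G.gr_closed[OF F(2)] by (simp add: G.gr_zero[OF P3])
  finally have e: "gr m (Psi ?x) = gr m (Psi ?x1) \<oplus>\<^bsub>H\<^esub> gr m (Psi ?x2)" .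
  have "Psi ?x1 = scal U ?a \<otimes>\<^bsub>U\<^esub> U_K chi J (- l)"
    using U.linto_scale[OF linto_Psi, of ?a "sing ?b 1"] by (simp add: Psi_H)
  then have y: "gr m (Psi ?x1) = scal H ?a \<otimes>\<^bsub>H\<^esub> HK (- l)"
    using G.gr_scal[OF U_K_FU[OF lPL], of ?a] by (simp add: HK_eq m_def Up_simps)
  have "pi00_Heis chi J tau (gr m (Psi ?x)) = gr m (Psi ?x1)"
  proof (rule pi00_Heis_eq)
    show "gr m (Psi ?x) \<in> carrier H"
      unfolding e using G.gr_closed[OF F(1)] G.gr_closed[OF F(2)] by (rule H.a_closed)
    have HKc: "HK ` PL \<subseteq> carrier H" using HK_closed by auto
    have "HK (- l) \<in> lin_span H (HK ` PL)"
      using lPL HK_closed by (intro H.lin_span_base) auto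
    then show "gr m (Psi ?x1) \<in> lin_span H (HK ` PL)"
      unfolding y by (rule H.vsub_scal[OF H.vsub_lin_span[OF HKc]])
    have "gr m (Psi ?x) \<ominus>\<^bsub>H\<^esub> gr m (Psi ?x1) = gr m (Psi ?x2)"
      unfolding e using G.gr_closed[OF F(1)] G.gr_closed[OF F(2)]
      by (simp add: H.minus_eq H.a_comm[of "gr m (Psi ?x1)"] H.a_assoc H.r_neg)
    then show "gr m (Psi ?x) \<ominus>\<^bsub>H\<^esub> gr m (Psi ?x1) \<in> lin_span H Waug"
      using gr_Waug[OF on(2)] by simp
  qed
  then show ?thesis using nc_eval_B_Heis(1)[OF p] y by (simp add: m_def)
qed

end

theorem theorem2p17:
  fixes chi :: "'i::{finite,linorder} zn \<Rightarrow> 'i zn \<Rightarrow> 'k::field"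
    and J :: "('i, 'k) nc_poly set"
    and tau :: "'i \<Rightarrow> 'i"
    and c :: "('k, 'i) vec"
    and p :: "('i, 'k) nc_poly"
    and l :: "'i zn"
  assumes "bicharacter chi"
    and "\<And>i j. chi (alpha i) (alpha j) = chi (alpha j) (alpha i)"
    and "biideal chi J" and "graded_subspace J" and "J \<subseteq> length_at_least_two"
    and "bij tau" and "\<And>i. tau (tau i) = i"
    and "\<And>i j. chi (alpha (tau i)) (alpha (tau j)) = chi (alpha i) (alpha j)"
    and "tau_tensor tau ` J = J"
    and "l \<in> nonneg" and "p \<in> homogeneous l"
  shows "K_identified chi J tau
           (pi00 chi J (P_proj chi J (- l) (nc_eval (U_alg chi J) (B_elem chi J tau c) p)))
           (pi00_Heis chi J tau (nc_eval (Heis chi J tau) (B_Heis chi J tau c) p)) \<and>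
         (l \<notin> tau_submonoid tau \<longrightarrow>
           P_proj chi J (- l) (pi00 chi J (nc_eval (U_alg chi J) (B_elem chi J tau c) p))
             = \<zero>\<^bsub>U_poly chi J tau\<^esub>)"
proof -
  interpret coideal chi J tau c
    by unfold_locales (use assms in auto)
  \<comment> \<open>Both sides turn out to be this multiple of K_{-l}, so the combination with the
    single index - l witnesses \<open>K_identified\<close>.\<close>
  let ?a = "coef (eta p) (0, - l, 0)"
  have PL: "- l \<in> PL" using PL_minus[OF PL_zero \<open>l \<in> nonneg\<close>] by simp
  have "Psi (sing (0, - l, 0) ?a) = scal U ?a \<otimes>\<^bsub>U\<^esub> U_K chi J (- l)"
    using U.linto_scale[OF linto_Psi, of ?a "sing (0, - l, 0) 1"] by (simp add: Psi_H)
  also have "\<dots> = lin_comb U (U_K chi J) (sing (- l) ?a)"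
    by (rule U.lin_comb_sing[symmetric]) (simp add: U_K_eq)
  finally have 1: "pi00 chi J (P_proj chi J (- l) (nc_eval U (B_elem chi J tau c) p)) =
      lin_comb U (U_K chi J) (sing (- l) ?a)"
    by (simp add: nc_eval_B pi00_P_proj)
  have 2: "pi00_Heis chi J tau (nc_eval (Heis chi J tau) (B_Heis chi J tau c) p) =
      lin_comb (Heis chi J tau) (Heis_K chi J tau) (sing (- l) ?a)"
    using pi00_Heis_B[OF \<open>p \<in> homogeneous l\<close> \<open>l \<in> nonneg\<close>] H.lin_comb_sing[where v = HK, OF HK_closed[OF PL], of ?a]
    by (simp add: Heis_def)
  have "supp (sing (- l) ?a) \<subseteq> PL" using PL by simp
  then have "K_identified chi J tau
           (pi00 chi J (P_proj chi J (- l) (nc_eval (U_alg chi J) (B_elem chi J tau c) p)))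
           (pi00_Heis chi J tau (nc_eval (Heis chi J tau) (B_Heis chi J tau c) p))"
    unfolding K_identified_def using 1 2 by blast
  moreover have "P_proj chi J (- l) (pi00 chi J (nc_eval (U_alg chi J) (B_elem chi J tau c) p))
      = \<zero>\<^bsub>U_poly chi J tau\<^esub>" if "l \<notin> tau_submonoid tau"
    using coef_eta_zero[OF \<open>p \<in> homogeneous l\<close> that]
    by (simp add: nc_eval_B P_proj_pi00 U.linto_zero[OF linto_Psi] Up_simps)
  ultimately show ?thesis by blast
qed

end
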